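(* For every subalgebra $\mathbf{S}\le\mathbf{L}$ there is an adjunction $\mathsf{K}_{\mathbf{S}}\dashv\mathsf{I}_{\mathbf{S}}$ with $\mathsf{I}_{\mathbf{S}}\colon\mathsf{BA}\to\mathcal{A}$ and $\mathsf{K}_{\mathbf{S}}\colon\mathcal{A}\to\mathsf{BA}$, which decomposes as the composite of the two adjunctions $\mathfrak{S}\dashv\mathfrak{P}_{\mathbf{S}}$ (with $\mathfrak{P}_{\mathbf{S}}\colon\mathsf{BA}\to\mathcal{A}_{\mathbf{S}}$ and $\mathfrak{S}\colon\mathcal{A}_{\mathbf{S}}\to\mathsf{BA}$) and $\mathsf{Q}_{\mathbf{S}}\dashv\iota_{\mathbf{S}}$ (with $\iota_{\mathbf{S}}\colon\mathcal{A}_{\mathbf{S}}\to\mathcal{A}$ and $\mathsf{Q}_{\mathbf{S}}\colon\mathcal{A}\to\mathcal{A}_{\mathbf{S}}$); that is, $\mathsf{I}_{\mathbf{S}}=\iota_{\mathbf{S}}\circ\mathfrak{P}_{\mathbf{S}}$ and $\mathsf{K}_{\mathbf{S}}=\mathfrak{S}\circ\mathsf{Q}_{\mathbf{S}}$. Here $\iota_{\mathbf{S}}$ is the natural inclusion functor of the subvariety $\mathcal{A}_{\mathbf{S}}=\mathbb{HSP}(\mathbf{S})$ into $\mathcal{A}=\mathbb{HSP}(\mathbf{L})$, and $\mathsf{Q}_{\mathbf{S}}$ is the quotient functor corresponding to the equation $\chi_S(x)\approx 1$.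
   Context: Setting: $\mathbf{L}$ is a finite algebra with an underlying bounded lattice $(L,\wedge,\vee,0,1)$, $0\neq 1$ (the lattice operations and the bounds belong to the signature of $\mathbf{L}$, so every subalgebra contains $0,1$), and $\mathbf{L}$ is semi-primal: for every $n\ge 1$, every function $f\colon L^n\to L$ that preserves subalgebras (meaning $f(a_1,\dots,a_n)$ always lies in the subalgebra generated by $a_1,\dots,a_n$) is term-definable in $\mathbf{L}$. $\mathcal{A}=\mathbb{HSP}(\mathbf{L})$ is the variety generated by $\mathbf{L}$, considered as a category with homomorphisms; $\mathsf{BA}$ is the category of Boolean algebras. For $\ell\in L$, $T_\ell\colon L\to L$ is given by $T_\ell(\ell)=1$ and $T_\ell(x)=0$ for $x\ne\ell$; these are term-definable in $\mathbf{L}$ and hence interpreted in every $\mathbf{A}\in\mathcal{A}$. For a subalgebra $\mathbf{S}\le\mathbf{L}$ with carrier $S$, $\chi_S(x)=\bigvee_{s\in S}T_s(x)$, a unary term. The quotient functor corresponding to the equation $\chi_S(x)\approx1$ sends $\mathbf{A}\in\mathcal{A}$ to $\mathbf{A}/\theta$, where $\theta$ is the least congruence of $\mathbf{A}$ whose quotient satisfies $\chi_S(x)\approx 1$, and acts on homomorphisms in the induced way. Boolean skeleton: for an algebra $\mathbf{A}$ in $\mathcal{A}$ (in particular in $\mathcal{A}_{\mathbf{S}}$), $\mathfrak{S}(\mathbf{A})$ is the Boolean algebra on $\{a\in A\mid T_1(a)=a\}$ with $\wedge,\vee,0,1$ inherited from $\mathbf{A}$ and complement $T_0$; on homomorphisms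 $\mathfrak{S}$ acts by restriction. Boolean power: $\mathfrak{P}_{\mathbf{S}}(\mathbf{B})=\mathbf{S}[\mathbf{B}]$ has as carrier all maps $\xi\colon S\to B$ with $\xi(\ell)\wedge\xi(\ell')=0$ for $\ell\neq\ell'$ and $\bigvee_{\ell\in S}\xi(\ell)=1$; for a $k$-ary operation $o$ of $\mathbf{S}$, $o^{\mathbf{S}[\mathbf{B}]}(\xi_1,\dots,\xi_k)(\ell)=\bigvee_{o^{\mathbf{S}}(\ell_1,\dots,\ell_k)=\ell}(\xi_1(\ell_1)\wedge\dots\wedge\xi_k(\ell_k))$. On a Boolean homomorphism $\varphi$, $\mathfrak{P}_{\mathbf{S}}\varphi$ is $\xi\mapsto\varphi\circ\xi$. *)

theory Defs
  imports Main "HOL-Library.FuncSet"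
begin

section \<open>Categories, functors, adjunctions\<close>

record ('o, 'm) category =
  Obj :: "'o set"
  Arr :: "'m set"
  Dom :: "'m \<Rightarrow> 'o"
  Cod :: "'m \<Rightarrow> 'o"
  Ident :: "'o \<Rightarrow> 'm"
  Comp :: "'m \<Rightarrow> 'm \<Rightarrow> 'm"  \<comment> \<open>\<open>Comp C g f\<close> is \<open>g\<close> after \<open>f\<close>\<close>

definition Hom :: "('o, 'm) category \<Rightarrow> 'o \<Rightarrow> 'o \<Rightarrow> 'm set" where
  "Hom C A B = {f \<in> Arr C. Dom C f = A \<and> Cod C f = B}"

definition is_category :: "('o, 'm) category \<Rightarrow> bool" where
  "is_category C \<longleftrightarrow>
     (\<forall>f \<in> Arr C. Dom C f \<in> Obj C \<and> Cod C f \<in> Obj C) \<and>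
     (\<forall>A \<in> Obj C. Ident C A \<in> Hom C A A) \<and>
     (\<forall>f \<in> Arr C. \<forall>g \<in> Arr C. Dom C g = Cod C f \<longrightarrow>
        Comp C g f \<in> Hom C (Dom C f) (Cod C g)) \<and>
     (\<forall>f \<in> Arr C. Comp C f (Ident C (Dom C f)) = f \<and> Comp C (Ident C (Cod C f)) f = f) \<and>
     (\<forall>f \<in> Arr C. \<forall>g \<in> Arr C. \<forall>h \<in> Arr C. Dom C g = Cod C f \<longrightarrow> Dom C h = Cod C g \<longrightarrow>
        Comp C h (Comp C g f) = Comp C (Comp C h g) f)"

record ('o1, 'm1, 'o2, 'm2) functor_data =
  fob :: "'o1 \<Rightarrow> 'o2"
  far :: "'m1 \<Rightarrow> 'm2"

definition is_functor ::
    "('o1, 'm1) category \<Rightarrow> ('o2, 'm2) category \<Rightarrow> ('o1, 'm1, 'o2, 'm2) functor_data \<Rightarrow> bool" where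
  "is_functor C D F \<longleftrightarrow> is_category C \<and> is_category D \<and>
     (\<forall>A \<in> Obj C. fob F A \<in> Obj D) \<and>
     (\<forall>f \<in> Arr C. far F f \<in> Hom D (fob F (Dom C f)) (fob F (Cod C f))) \<and>
     (\<forall>A \<in> Obj C. far F (Ident C A) = Ident D (fob F A)) \<and>
     (\<forall>f \<in> Arr C. \<forall>g \<in> Arr C. Dom C g = Cod C f \<longrightarrow>
        far F (Comp C g f) = Comp D (far F g) (far F f))"

definition id_functor :: "('o, 'm, 'o, 'm) functor_data" where
  "id_functor = \<lparr>fob = (\<lambda>A. A), far = (\<lambda>f. f)\<rparr>"

definition functor_comp ::
    "('o2, 'm2, 'o3, 'm3) functor_data \<Rightarrow> ('o1, 'm1, 'o2, 'm2) functor_data \<Rightarrow>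
     ('o1, 'm1, 'o3, 'm3) functor_data"  (infixl \<open>\<circ>\<^sub>F\<close> 55) where
  "G \<circ>\<^sub>F F = \<lparr>fob = (\<lambda>A. fob G (fob F A)), far = (\<lambda>f. far G (far F f))\<rparr>"

definition is_nat_trans ::
    "('o1, 'm1) category \<Rightarrow> ('o2, 'm2) category \<Rightarrow> ('o1, 'm1, 'o2, 'm2) functor_data \<Rightarrow>
     ('o1, 'm1, 'o2, 'm2) functor_data \<Rightarrow> ('o1 \<Rightarrow> 'm2) \<Rightarrow> bool" where
  "is_nat_trans C D F G \<tau> \<longleftrightarrow>
     (\<forall>A \<in> Obj C. \<tau> A \<in> Hom D (fob F A) (fob G A)) \<and>
     (\<forall>f \<in> Arr C. Comp D (far G f) (\<tau> (Dom C f)) = Comp D (\<tau> (Cod C f)) (far F f))"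

text \<open>\<open>F : C \<rightarrow> D\<close> is left adjoint to \<open>G : D \<rightarrow> C\<close>, with unit \<open>\<eta>\<close> and counit \<open>\<epsilon>\<close>.\<close>

definition is_adjunction ::
    "('o1, 'm1) category \<Rightarrow> ('o2, 'm2) category \<Rightarrow> ('o1, 'm1, 'o2, 'm2) functor_data \<Rightarrow>
     ('o2, 'm2, 'o1, 'm1) functor_data \<Rightarrow> ('o1 \<Rightarrow> 'm1) \<Rightarrow> ('o2 \<Rightarrow> 'm2) \<Rightarrow> bool" where
  "is_adjunction C D F G \<eta> \<epsilon> \<longleftrightarrow>
     is_functor C D F \<and> is_functor D C G \<and>
     is_nat_trans C C id_functor (G \<circ>\<^sub>F F) \<eta> \<and>
     is_nat_trans D D (F \<circ>\<^sub>F G) id_functor \<epsilon> \<and>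
     (\<forall>A \<in> Obj C. Comp D (\<epsilon> (fob F A)) (far F (\<eta> A)) = Ident D (fob F A)) \<and>
     (\<forall>B \<in> Obj D. Comp C (far G (\<epsilon> B)) (\<eta> (fob G B)) = Ident C (fob G B))"


section \<open>Universal algebra\<close>

text \<open>All elements of \<open>'f\<close> are operation symbols; four of them are the symbols of
  the bounded lattice operations.\<close>

record 'f lat_signature =
  arity :: "'f \<Rightarrow> nat"
  meet_sym :: 'f
  join_sym :: 'f
  zero_sym :: 'f
  one_sym :: 'f

definition is_lat_signature :: "'f lat_signature \<Rightarrow> bool" where
  "is_lat_signature sig \<longleftrightarrow> arity sig (meet_sym sig) = 2 \<and> arity sig (join_sym sig) = 2 \<and>
     arity sig (zero_sym sig) = 0 \<and> arity sig (one_sym sig) = 0"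

record ('f, 'a) algebra =
  carrier :: "'a set"
  oper :: "'f \<Rightarrow> 'a list \<Rightarrow> 'a"

definition args :: "'f lat_signature \<Rightarrow> 'a set \<Rightarrow> 'f \<Rightarrow> 'a list set" where
  "args sig X f = {xs. length xs = arity sig f \<and> set xs \<subseteq> X}"

definition is_algebra :: "'f lat_signature \<Rightarrow> ('f, 'a) algebra \<Rightarrow> bool" where
  "is_algebra sig A \<longleftrightarrow> (\<forall>f. \<forall>xs \<in> args sig (carrier A) f. oper A f xs \<in> carrier A)"

definition subuniverse :: "'f lat_signature \<Rightarrow> ('f, 'a) algebra \<Rightarrow> 'a set \<Rightarrow> bool" where
  "subuniverse sig A X \<longleftrightarrow> X \<subseteq> carrier A \<and> (\<forall>f. \<forall>xs \<in> args sig X f. oper A f xs \<in> X)"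

definition subalgebra :: "('f, 'a) algebra \<Rightarrow> 'a set \<Rightarrow> ('f, 'a) algebra" where
  "subalgebra A X = \<lparr>carrier = X, oper = oper A\<rparr>"

definition generated :: "'f lat_signature \<Rightarrow> ('f, 'a) algebra \<Rightarrow> 'a set \<Rightarrow> 'a set" where
  "generated sig A X = \<Inter> {Y. subuniverse sig A Y \<and> X \<subseteq> Y}"

text \<open>Homomorphisms are made \<open>undefined\<close> off the carrier, so that equality of functions
  is equality of homomorphisms.\<close>

definition homs :: "'f lat_signature \<Rightarrow> ('f, 'a) algebra \<Rightarrow> ('f, 'b) algebra \<Rightarrow> ('a \<Rightarrow> 'b) set" where
  "homs sig A B = {h \<in> carrier A \<rightarrow>\<^sub>E carrier B.
     \<forall>f. \<forall>xs \<in> args sig (carrier A) f. h (oper A f xs) = oper B f (map h xs)}"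

definition power_algebra :: "('f, 'a) algebra \<Rightarrow> 'i set \<Rightarrow> ('f, 'i \<Rightarrow> 'a) algebra" where
  "power_algebra A I = \<lparr>carrier = I \<rightarrow>\<^sub>E carrier A,
     oper = (\<lambda>f xs. \<lambda>i\<in>I. oper A f (map (\<lambda>x. x i) xs))\<rparr>"

text \<open>Homomorphic images, with carrier in the type \<open>'a\<close>, of subalgebras of powers of \<open>L\<close>.
  Index sets are taken in \<open>'a \<Rightarrow> 'l\<close>. This loses nothing: any such image \<open>A\<close> is an image of the
  free algebra over the set \<open>carrier A\<close>, which is a subalgebra of the power of \<open>L\<close> indexed by
  all maps \<open>carrier A \<rightarrow> carrier L\<close>.\<close>

definition HSP :: "'f lat_signature \<Rightarrow> ('f, 'l) algebra \<Rightarrow> ('f, 'a) algebra set" where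
  "HSP sig L = {A. is_algebra sig A \<and>
     (\<exists>(I :: ('a \<Rightarrow> 'l) set) R h.
        subuniverse sig (power_algebra L I) R \<and>
        h \<in> homs sig (subalgebra (power_algebra L I) R) A \<and> h ` R = carrier A)}"

datatype 'f trm = Var nat | App 'f "'f trm list"

fun is_term :: "'f lat_signature \<Rightarrow> nat \<Rightarrow> 'f trm \<Rightarrow> bool" where
  "is_term sig n (Var i) \<longleftrightarrow> i < n"
| "is_term sig n (App f ts) \<longleftrightarrow> length ts = arity sig f \<and> (\<forall>t \<in> set ts. is_term sig n t)"

fun interp :: "('f, 'a) algebra \<Rightarrow> (nat \<Rightarrow> 'a) \<Rightarrow> 'f trm \<Rightarrow> 'a" where
  "interp A \<rho> (Var i) = \<rho> i"
| "interp A \<rho> (App f ts) = oper A f (map (interp A \<rho>) ts)"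

definition satisfies :: "('f, 'a) algebra \<Rightarrow> 'f trm \<Rightarrow> 'f trm \<Rightarrow> bool" where
  "satisfies A s t \<longleftrightarrow> (\<forall>\<rho>. range \<rho> \<subseteq> carrier A \<longrightarrow> interp A \<rho> s = interp A \<rho> t)"

definition semi_primal :: "'f lat_signature \<Rightarrow> ('f, 'l) algebra \<Rightarrow> bool" where
  "semi_primal sig L \<longleftrightarrow>
     (\<forall>n \<ge> 1. \<forall>g :: 'l list \<Rightarrow> 'l.
        (\<forall>xs. length xs = n \<longrightarrow> set xs \<subseteq> carrier L \<longrightarrow> g xs \<in> generated sig L (set xs)) \<longrightarrow>
        (\<exists>t. is_term sig n t \<and>
           (\<forall>xs. length xs = n \<longrightarrow> set xs \<subseteq> carrier L \<longrightarrow> interp L (\<lambda>i. xs ! i) t = g xs)))"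

definition congruence :: "'f lat_signature \<Rightarrow> ('f, 'a) algebra \<Rightarrow> ('a \<times> 'a) set \<Rightarrow> bool" where
  "congruence sig A \<theta> \<longleftrightarrow> equiv (carrier A) \<theta> \<and>
     (\<forall>f. \<forall>xs \<in> args sig (carrier A) f. \<forall>ys \<in> args sig (carrier A) f.
        list_all2 (\<lambda>x y. (x, y) \<in> \<theta>) xs ys \<longrightarrow> (oper A f xs, oper A f ys) \<in> \<theta>)"

definition rep :: "'a set \<Rightarrow> 'a" where
  "rep X = (SOME x. x \<in> X)"

definition quotient_algebra :: "('f, 'a) algebra \<Rightarrow> ('a \<times> 'a) set \<Rightarrow> ('f, 'a set) algebra" where
  "quotient_algebra A \<theta> = \<lparr>carrier = carrier A // \<theta>,
     oper = (\<lambda>f Xs. \<theta> `` {oper A f (map rep Xs)})\<rparr>"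

text \<open>The isomorphic copy of \<open>A\<close> along a function injective on the carrier.\<close>

definition transport :: "('a \<Rightarrow> 'b) \<Rightarrow> ('f, 'a) algebra \<Rightarrow> ('f, 'b) algebra" where
  "transport g A = \<lparr>carrier = g ` carrier A,
     oper = (\<lambda>f ys. g (oper A f (map (the_inv_into (carrier A) g) ys)))\<rparr>"


section \<open>Bounded lattices and Boolean algebras\<close>

definition meet :: "'f lat_signature \<Rightarrow> ('f, 'a) algebra \<Rightarrow> 'a \<Rightarrow> 'a \<Rightarrow> 'a" where
  "meet sig A x y = oper A (meet_sym sig) [x, y]"

definition join :: "'f lat_signature \<Rightarrow> ('f, 'a) algebra \<Rightarrow> 'a \<Rightarrow> 'a \<Rightarrow> 'a" where
  "join sig A x y = oper A (join_sym sig) [x, y]"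

definition zero :: "'f lat_signature \<Rightarrow> ('f, 'a) algebra \<Rightarrow> 'a" where
  "zero sig A = oper A (zero_sym sig) []"

definition one :: "'f lat_signature \<Rightarrow> ('f, 'a) algebra \<Rightarrow> 'a" where
  "one sig A = oper A (one_sym sig) []"

definition is_bounded_lattice :: "'f lat_signature \<Rightarrow> ('f, 'a) algebra \<Rightarrow> bool" where
  "is_bounded_lattice sig A \<longleftrightarrow> is_lat_signature sig \<and> is_algebra sig A \<and>
     (\<forall>x \<in> carrier A. \<forall>y \<in> carrier A.
        meet sig A x y = meet sig A y x \<and> join sig A x y = join sig A y x \<and>
        meet sig A x (join sig A x y) = x \<and> join sig A x (meet sig A x y) = x) \<and>
     (\<forall>x \<in> carrier A. \<forall>y \<in> carrier A. \<forall>z \<in> carrier A.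
        meet sig A x (meet sig A y z) = meet sig A (meet sig A x y) z \<and>
        join sig A x (join sig A y z) = join sig A (join sig A x y) z) \<and>
     (\<forall>x \<in> carrier A. meet sig A x (one sig A) = x \<and> join sig A x (zero sig A) = x)"

definition leq :: "'f lat_signature \<Rightarrow> ('f, 'a) algebra \<Rightarrow> 'a \<Rightarrow> 'a \<Rightarrow> bool" where
  "leq sig A x y \<longleftrightarrow> meet sig A x y = x"

definition Join :: "'f lat_signature \<Rightarrow> ('f, 'a) algebra \<Rightarrow> 'a set \<Rightarrow> 'a" where
  "Join sig A X = (THE z. z \<in> carrier A \<and> (\<forall>x \<in> X. leq sig A x z) \<and>
     (\<forall>w \<in> carrier A. (\<forall>x \<in> X. leq sig A x w) \<longrightarrow> leq sig A z w))"

datatype bool_op = BMeet | BJoin | BCompl | BZero | BOne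

definition bool_sig :: "bool_op lat_signature" where
  "bool_sig = \<lparr>
     arity = (\<lambda>p. case p of BMeet \<Rightarrow> 2 | BJoin \<Rightarrow> 2 | BCompl \<Rightarrow> 1 | BZero \<Rightarrow> 0 | BOne \<Rightarrow> 0),
     meet_sym = BMeet, join_sym = BJoin, zero_sym = BZero, one_sym = BOne\<rparr>"

definition boolean_algebras :: "(bool_op, 'b) algebra set" where
  "boolean_algebras = {B. is_bounded_lattice bool_sig B \<and>
     (\<forall>x \<in> carrier B. \<forall>y \<in> carrier B. \<forall>z \<in> carrier B.
        meet bool_sig B x (join bool_sig B y z) =
          join bool_sig B (meet bool_sig B x y) (meet bool_sig B x z)) \<and>
     (\<forall>x \<in> carrier B.
        meet bool_sig B x (oper B BCompl [x]) = zero bool_sig B \<and>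
        join bool_sig B x (oper B BCompl [x]) = one bool_sig B)}"


section \<open>Categories of algebras\<close>

record ('f, 'a) alg_arrow =
  src :: "('f, 'a) algebra"
  tgt :: "('f, 'a) algebra"
  fn :: "'a \<Rightarrow> 'a"

type_synonym ('f, 'a) alg_category = "(('f, 'a) algebra, ('f, 'a) alg_arrow) category"

text \<open>The full category on a class \<open>\<K>\<close> of algebras whose carriers are subsets of \<open>'a\<close>.\<close>

definition alg_category :: "'f lat_signature \<Rightarrow> ('f, 'a) algebra set \<Rightarrow> ('f, 'a) alg_category" where
  "alg_category sig \<K> = \<lparr>
     Obj = \<K>,
     Arr = {m. src m \<in> \<K> \<and> tgt m \<in> \<K> \<and> fn m \<in> homs sig (src m) (tgt m)},
     Dom = src,
     Cod = tgt,
     Ident = (\<lambda>A. \<lparr>src = A, tgt = A, fn = (\<lambda>x\<in>carrier A. x)\<rparr>),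
     Comp = (\<lambda>n m. \<lparr>src = src m, tgt = tgt n, fn = compose (carrier (src m)) (fn n) (fn m)\<rparr>)\<rparr>"

definition variety :: "'f lat_signature \<Rightarrow> ('f, 'l) algebra \<Rightarrow> ('f, 'a) alg_category" where
  "variety sig L = alg_category sig (HSP sig L)"

definition BA :: "(bool_op, 'b) alg_category" where
  "BA = alg_category bool_sig boolean_algebras"


section \<open>The terms \<open>T\<close> and \<open>\<chi>\<close>\<close>

text \<open>Any two terms inducing the same operation on \<open>L\<close> agree on all algebras of the variety, so
  the choices below are immaterial there.\<close>

definition T_term :: "'f lat_signature \<Rightarrow> ('f, 'l) algebra \<Rightarrow> 'l \<Rightarrow> 'f trm" where
  "T_term sig L l = (SOME t. is_term sig 1 t \<and>
     (\<forall>x \<in> carrier L. interp L (\<lambda>_. x) t = (if x = l then one sig L else zero sig L)))"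

definition T_op :: "'f lat_signature \<Rightarrow> ('f, 'l) algebra \<Rightarrow> 'l \<Rightarrow> ('f, 'a) algebra \<Rightarrow> 'a \<Rightarrow> 'a" where
  "T_op sig L l A a = interp A (\<lambda>_. a) (T_term sig L l)"

definition chi_term :: "'f lat_signature \<Rightarrow> ('f, 'l) algebra \<Rightarrow> 'l set \<Rightarrow> 'f trm" where
  "chi_term sig L S =
     foldr (\<lambda>s t. App (join_sym sig) [T_term sig L s, t])
       (SOME ss. set ss = S \<and> distinct ss) (App (zero_sym sig) [])"


section \<open>The universe of elements\<close>

text \<open>All functors have to live on algebras over one type, which must accommodate Boolean powers;
  \<open>Tuple\<close> turns a map from (a subset of) \<open>'l\<close> to the universe into an element of it. The
  type \<open>'u\<close> of atoms is arbitrary, and every algebra \<open>A\<close> over \<open>'u\<close> has an isomorphic copy with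
  carrier \<open>Atom ` carrier A\<close>, so there is no bound on cardinalities.\<close>

datatype ('l, 'u) univ = Atom 'u | Tuple (untuple: "'l \<Rightarrow> ('l, 'u) univ")


section \<open>The four functors\<close>

definition skeleton ::
    "'f lat_signature \<Rightarrow> ('f, 'l) algebra \<Rightarrow> ('f, 'a) algebra \<Rightarrow> (bool_op, 'a) algebra" where
  "skeleton sig L A = \<lparr>
     carrier = {a \<in> carrier A. T_op sig L (one sig L) A a = a},
     oper = (\<lambda>p xs. case p of
         BMeet \<Rightarrow> oper A (meet_sym sig) xs
       | BJoin \<Rightarrow> oper A (join_sym sig) xs
       | BCompl \<Rightarrow> T_op sig L (zero sig L) A (hd xs)
       | BZero \<Rightarrow> oper A (zero_sym sig) xs
       | BOne \<Rightarrow> oper A (one_sym sig) xs)\<rparr>"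

definition skeleton_functor ::
    "'f lat_signature \<Rightarrow> ('f, 'l) algebra \<Rightarrow>
     (('f, 'a) algebra, ('f, 'a) alg_arrow, (bool_op, 'a) algebra, (bool_op, 'a) alg_arrow) functor_data"
  where
  "skeleton_functor sig L = \<lparr>
     fob = skeleton sig L,
     far = (\<lambda>m. \<lparr>src = skeleton sig L (src m), tgt = skeleton sig L (tgt m),
                  fn = restrict (fn m) (carrier (skeleton sig L (src m)))\<rparr>)\<rparr>"

text \<open>A term of the join defining an operation is the meet of the
  \<open>\<xi>\<^sub>i(l\<^sub>i)\<close>; for a constant symbol it is the empty meet \<open>1\<close>.\<close>

definition boolean_power ::
    "'f lat_signature \<Rightarrow> ('f, 'l) algebra \<Rightarrow> (bool_op, 'b) algebra \<Rightarrow> ('f, 'l \<Rightarrow> 'b) algebra" where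
  "boolean_power sig S B = \<lparr>
     carrier = {\<xi> \<in> carrier S \<rightarrow>\<^sub>E carrier B.
       (\<forall>l \<in> carrier S. \<forall>l' \<in> carrier S. l \<noteq> l' \<longrightarrow> meet bool_sig B (\<xi> l) (\<xi> l') = zero bool_sig B) \<and>
       Join bool_sig B (\<xi> ` carrier S) = one bool_sig B},
     oper = (\<lambda>f \<xi>s. \<lambda>l\<in>carrier S. Join bool_sig B
       {foldr (meet bool_sig B) (map2 (\<lambda>\<xi> k. \<xi> k) \<xi>s ls) (one bool_sig B) | ls.
          ls \<in> args sig (carrier S) f \<and> oper S f ls = l})\<rparr>"

definition power_ob ::
    "'f lat_signature \<Rightarrow> ('f, 'l) algebra \<Rightarrow> (bool_op, ('l, 'u) univ) algebra \<Rightarrow>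
     ('f, ('l, 'u) univ) algebra" where
  "power_ob sig S B = transport Tuple (boolean_power sig S B)"

definition power_functor ::
    "'f lat_signature \<Rightarrow> ('f, 'l) algebra \<Rightarrow>
     ((bool_op, ('l, 'u) univ) algebra, (bool_op, ('l, 'u) univ) alg_arrow,
      ('f, ('l, 'u) univ) algebra, ('f, ('l, 'u) univ) alg_arrow) functor_data" where
  "power_functor sig S = \<lparr>
     fob = power_ob sig S,
     far = (\<lambda>m. \<lparr>src = power_ob sig S (src m), tgt = power_ob sig S (tgt m),
                  fn = (\<lambda>x\<in>carrier (power_ob sig S (src m)).
                          Tuple (compose (carrier S) (fn m) (untuple x)))\<rparr>)\<rparr>"

text \<open>The quotient by the least congruence enforcing \<open>\<chi>\<^sub>S(x) \<approx> 1\<close>; to stay within the type of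
  elements, a congruence class is coded by its chosen representative.\<close>

definition chi_congruence ::
    "'f lat_signature \<Rightarrow> ('f, 'l) algebra \<Rightarrow> 'l set \<Rightarrow> ('f, 'a) algebra \<Rightarrow> ('a \<times> 'a) set" where
  "chi_congruence sig L S A = (LEAST \<theta>. congruence sig A \<theta> \<and>
     satisfies (quotient_algebra A \<theta>) (chi_term sig L S) (App (one_sym sig) []))"

definition quotient_ob ::
    "'f lat_signature \<Rightarrow> ('f, 'l) algebra \<Rightarrow> 'l set \<Rightarrow> ('f, 'a) algebra \<Rightarrow> ('f, 'a) algebra" where
  "quotient_ob sig L S A = transport rep (quotient_algebra A (chi_congruence sig L S A))"

definition quotient_functor ::
    "'f lat_signature \<Rightarrow> ('f, 'l) algebra \<Rightarrow> 'l set \<Rightarrow>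
     (('f, 'a) algebra, ('f, 'a) alg_arrow, ('f, 'a) algebra, ('f, 'a) alg_arrow) functor_data" where
  "quotient_functor sig L S = \<lparr>
     fob = quotient_ob sig L S,
     far = (\<lambda>m. \<lparr>src = quotient_ob sig L S (src m), tgt = quotient_ob sig L S (tgt m),
                  fn = (\<lambda>x\<in>carrier (quotient_ob sig L S (src m)).
                          rep (chi_congruence sig L S (tgt m) `` {fn m x}))\<rparr>)\<rparr>"

text \<open>Both varieties have the same signature, so the inclusion acts as the identity.\<close>

definition inclusion_functor ::
    "(('f, 'a) algebra, ('f, 'a) alg_arrow, ('f, 'a) algebra, ('f, 'a) alg_arrow) functor_data" where
  "inclusion_functor = \<lparr>fob = (\<lambda>A. A), far = (\<lambda>m. m)\<rparr>"

end

theory Submission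
  imports Defs
begin

text \<open>Adjunctions compose, so it suffices to establish the two factors.

  For the Boolean power adjunction, Boolean algebras are viewed through their \<open>{0,1}\<close>-valued
  characters, which separate points (Zorn). A character \<open>u\<close> of \<open>B\<close> picks from \<open>\<xi>\<close> in \<open>S[B]\<close> the unique
  \<open>l\<close> with \<open>u(\<xi>(l)) = 1\<close>, and this is a homomorphism \<open>S[B] \<rightarrow> S\<close>; hence \<open>S[B]\<close> lies in the variety of
  \<open>S\<close>. The unit is \<open>a \<mapsto> (l \<mapsto> T\<^sub>l(a))\<close> and the counit is \<open>\<xi> \<mapsto> \<xi>(1)\<close>; semi-primality enters only
  through the terms \<open>T\<^sub>l\<close>, whose identities transfer from \<open>L\<close> to its variety.

  For the quotient adjunction the point is that \<open>A/\<theta>\<close> lies in the variety of \<open>S\<close>: if \<open>A\<close> is an image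
  of \<open>R \<le> L\<^sup>I\<close>, then \<open>R \<inter> S\<^sup>I\<close> still maps onto \<open>A/\<theta>\<close>, because \<open>\<chi>\<^sub>S(r) \<and> r\<close> lies in \<open>S\<^sup>I\<close> and is
  congruent to \<open>r\<close>.\<close>

section \<open>Categories of algebras and composition of adjunctions\<close>

text \<open>An operation of S[B] is a join over argument tuples, and preserving it by hand means
  distributing nested joins over meets. At a character such a join has at most one true term, and
  the operation turns into that of S on single values. Finiteness of L is what lets characters
  commute with these joins. The unit preserves an operation o because of one family of identities of
  L: the meet of the T_{l_i}(x_i) lies below T_{o(l)}(o(x)). Laws that hold only on the skeleton are
  also transferred as identities, by writing T_1(x) for x. On the quotient side the obstacle is the
  coding of a class by an arbitrary representative. Homomorphisms do not respect that choice, so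
  functoriality and naturality hold only after renormalising in the codomain. This works because the
  congruence is least: pulling back the one of the codomain gives a competitor in the domain. On the
  variety of S the congruence is equality, which forces the representatives and makes the counit an
  identity map.\<close>

lemma Comp_Hom:
  assumes "is_category C" "f \<in> Hom C X Y" "g \<in> Hom C Y Z"
  shows "Comp C g f \<in> Hom C X Z"
  using assms unfolding is_category_def Hom_def by auto

lemma Comp_assoc:
  assumes "is_category C" "f \<in> Hom C W X" "g \<in> Hom C X Y" "h \<in> Hom C Y Z"
  shows "Comp C h (Comp C g f) = Comp C (Comp C h g) f"
  using assms unfolding is_category_def Hom_def by auto

lemma Comp_Ident:
  assumes "is_category C" "f \<in> Hom C X Y"
  shows "Comp C f (Ident C X) = f" "Comp C (Ident C Y) f = f"
  using assms unfolding is_category_def Hom_def by auto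

lemma far_Hom:
  assumes "is_functor C D F" "f \<in> Hom C X Y"
  shows "far F f \<in> Hom D (fob F X) (fob F Y)"
  using assms unfolding is_functor_def Hom_def by auto

lemma far_Comp:
  assumes "is_functor C D F" "f \<in> Hom C X Y" "g \<in> Hom C Y Z"
  shows "far F (Comp C g f) = Comp D (far F g) (far F f)"
  using assms unfolding is_functor_def Hom_def by auto

lemma functor_comp_simps [simp]:
  "fob (G \<circ>\<^sub>F F) A = fob G (fob F A)" "far (G \<circ>\<^sub>F F) f = far G (far F f)"
  by (simp_all add: functor_comp_def)

lemma id_functor_simps [simp]: "fob id_functor A = A" "far id_functor f = f"
  by (simp_all add: id_functor_def)

lemma is_functor_comp:
  assumes "is_functor C D F" "is_functor D E G"
  shows "is_functor C E (G \<circ>\<^sub>F F)"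
  using assms unfolding is_functor_def Hom_def by auto

lemma nat_trans_Hom:
  assumes "is_nat_trans C D F G \<tau>" "A \<in> Obj C"
  shows "\<tau> A \<in> Hom D (fob F A) (fob G A)"
  using assms unfolding is_nat_trans_def by auto

lemma nat_trans_natural:
  assumes "is_nat_trans C D F G \<tau>" "f \<in> Hom C X Y"
  shows "Comp D (far G f) (\<tau> X) = Comp D (\<tau> Y) (far F f)"
  using assms unfolding is_nat_trans_def Hom_def by auto

text \<open>Unit and counit are the usual whiskered composites, so the triangles are the point. In
  the left one, naturality of \<epsilon> along \<eta>' brings the two halves of the triangle of F
  and G together; they cancel and leave the triangle of F' and G'. In the right one, naturality of
  \<eta>' along \<epsilon> first cancels F' against G' and leaves the triangle of F and G.\<close>

lemma is_adjunction_comp: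
  assumes adj1: "is_adjunction C D F G \<eta> \<epsilon>" and adj2: "is_adjunction D E F' G' \<eta>' \<epsilon>'"
  shows "is_adjunction C E (F' \<circ>\<^sub>F F) (G \<circ>\<^sub>F G')
    (\<lambda>A. Comp C (far G (\<eta>' (fob F A))) (\<eta> A)) (\<lambda>B. Comp E (\<epsilon>' B) (far F' (\<epsilon> (fob G' B))))"
proof -
  have F: "is_functor C D F" and G: "is_functor D C G"
    and F': "is_functor D E F'" and G': "is_functor E D G'"
    using adj1 adj2 by (auto simp: is_adjunction_def)
  have cat: "is_category C" "is_category D" "is_category E"
    using F F' by (auto simp: is_functor_def)
  have nt: "is_nat_trans C C id_functor (G \<circ>\<^sub>F F) \<eta>" "is_nat_trans D D (F \<circ>\<^sub>F G) id_functor \<epsilon>"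
    "is_nat_trans D D id_functor (G' \<circ>\<^sub>F F') \<eta>'" "is_nat_trans E E (F' \<circ>\<^sub>F G') id_functor \<epsilon>'"
    using adj1 adj2 by (auto simp: is_adjunction_def)
  have ob: "A \<in> Obj C \<Longrightarrow> fob F A \<in> Obj D" "B \<in> Obj D \<Longrightarrow> fob G B \<in> Obj C"
    "B \<in> Obj D \<Longrightarrow> fob F' B \<in> Obj E" "Z \<in> Obj E \<Longrightarrow> fob G' Z \<in> Obj D" for A B Z
    using F G F' G' by (auto simp: is_functor_def)
  have arrC: "f \<in> Hom C (Dom C f) (Cod C f)" "Dom C f \<in> Obj C" "Cod C f \<in> Obj C" if "f \<in> Arr C" for f
    using that cat(1) by (auto simp: is_category_def Hom_def)
  have arrE: "f \<in> Hom E (Dom E f) (Cod E f)" "Dom E f \<in> Obj E" "Cod E f \<in> Obj E" if "f \<in> Arr E" for f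
    using that cat(3) by (auto simp: is_category_def Hom_def)
  have \<eta>: "A \<in> Obj C \<Longrightarrow> \<eta> A \<in> Hom C A (fob G (fob F A))" for A
    using nat_trans_Hom[OF nt(1)] by simp
  have \<epsilon>: "B \<in> Obj D \<Longrightarrow> \<epsilon> B \<in> Hom D (fob F (fob G B)) B" for B
    using nat_trans_Hom[OF nt(2)] by simp
  have \<eta>': "B \<in> Obj D \<Longrightarrow> \<eta>' B \<in> Hom D B (fob G' (fob F' B))" for B
    using nat_trans_Hom[OF nt(3)] by simp
  have \<epsilon>': "Z \<in> Obj E \<Longrightarrow> \<epsilon>' Z \<in> Hom E (fob F' (fob G' Z)) Z" for Z
    using nat_trans_Hom[OF nt(4)] by simp
  have tri: "A \<in> Obj C \<Longrightarrow> Comp D (\<epsilon> (fob F A)) (far F (\<eta> A)) = Ident D (fob F A)"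
    "B \<in> Obj D \<Longrightarrow> Comp C (far G (\<epsilon> B)) (\<eta> (fob G B)) = Ident C (fob G B)"
    "B \<in> Obj D \<Longrightarrow> Comp E (\<epsilon>' (fob F' B)) (far F' (\<eta>' B)) = Ident E (fob F' B)"
    "Z \<in> Obj E \<Longrightarrow> Comp D (far G' (\<epsilon>' Z)) (\<eta>' (fob G' Z)) = Ident D (fob G' Z)" for A B Z
    using adj1 adj2 by (auto simp: is_adjunction_def)
  have 1: "is_nat_trans C C id_functor ((G \<circ>\<^sub>F G') \<circ>\<^sub>F (F' \<circ>\<^sub>F F)) (\<lambda>A. Comp C (far G (\<eta>' (fob F A))) (\<eta> A))"
    unfolding is_nat_trans_def
  proof (intro conjI ballI)
    fix A assume A: "A \<in> Obj C"
    show "Comp C (far G (\<eta>' (fob F A))) (\<eta> A)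
        \<in> Hom C (fob id_functor A) (fob ((G \<circ>\<^sub>F G') \<circ>\<^sub>F (F' \<circ>\<^sub>F F)) A)"
      using Comp_Hom[OF cat(1) \<eta>[OF A] far_Hom[OF G \<eta>'[OF ob(1)[OF A]]]] by simp
  next
    fix f assume f: "f \<in> Arr C"
    define X Y where "X = Dom C f" and "Y = Cod C f"
    have fh: "f \<in> Hom C X Y" and X: "X \<in> Obj C" and Y: "Y \<in> Obj C"
      using arrC[OF f] by (auto simp: X_def Y_def)
    note Ff = far_Hom[OF F fh] and GFf = far_Hom[OF G far_Hom[OF F fh]]
    note GGf = far_Hom[OF G far_Hom[OF G' far_Hom[OF F' Ff]]]
    have "Comp C (far G (far G' (far F' (far F f)))) (Comp C (far G (\<eta>' (fob F X))) (\<eta> X))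
        = Comp C (Comp C (far G (far G' (far F' (far F f)))) (far G (\<eta>' (fob F X)))) (\<eta> X)"
      using Comp_assoc[OF cat(1) \<eta>[OF X] far_Hom[OF G \<eta>'[OF ob(1)[OF X]]] GGf] .
    also have "\<dots> = Comp C (far G (Comp D (far G' (far F' (far F f))) (\<eta>' (fob F X)))) (\<eta> X)"
      using far_Comp[OF G \<eta>'[OF ob(1)[OF X]] far_Hom[OF G' far_Hom[OF F' Ff]]] by simp
    also have "\<dots> = Comp C (far G (Comp D (\<eta>' (fob F Y)) (far F f))) (\<eta> X)"
      using nat_trans_natural[OF nt(3) Ff] by simp
    also have "\<dots> = Comp C (Comp C (far G (\<eta>' (fob F Y))) (far G (far F f))) (\<eta> X)"
      using far_Comp[OF G Ff \<eta>'[OF ob(1)[OF Y]]] by simp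
    also have "\<dots> = Comp C (far G (\<eta>' (fob F Y))) (Comp C (far G (far F f)) (\<eta> X))"
      using Comp_assoc[OF cat(1) \<eta>[OF X] GFf far_Hom[OF G \<eta>'[OF ob(1)[OF Y]]]] by simp
    also have "\<dots> = Comp C (far G (\<eta>' (fob F Y))) (Comp C (\<eta> Y) f)"
      using nat_trans_natural[OF nt(1) fh] by simp
    also have "\<dots> = Comp C (Comp C (far G (\<eta>' (fob F Y))) (\<eta> Y)) f"
      using Comp_assoc[OF cat(1) fh \<eta>[OF Y] far_Hom[OF G \<eta>'[OF ob(1)[OF Y]]]] .
    finally show "Comp C (far ((G \<circ>\<^sub>F G') \<circ>\<^sub>F (F' \<circ>\<^sub>F F)) f)
        (Comp C (far G (\<eta>' (fob F (Dom C f)))) (\<eta> (Dom C f)))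
      = Comp C (Comp C (far G (\<eta>' (fob F (Cod C f)))) (\<eta> (Cod C f))) (far id_functor f)"
      by (simp add: X_def Y_def)
  qed
  have 2: "is_nat_trans E E ((F' \<circ>\<^sub>F F) \<circ>\<^sub>F (G \<circ>\<^sub>F G')) id_functor
      (\<lambda>B. Comp E (\<epsilon>' B) (far F' (\<epsilon> (fob G' B))))"
    unfolding is_nat_trans_def
  proof (intro conjI ballI)
    fix A assume A: "A \<in> Obj E"
    show "Comp E (\<epsilon>' A) (far F' (\<epsilon> (fob G' A)))
        \<in> Hom E (fob ((F' \<circ>\<^sub>F F) \<circ>\<^sub>F (G \<circ>\<^sub>F G')) A) (fob id_functor A)"
      using Comp_Hom[OF cat(3) far_Hom[OF F' \<epsilon>[OF ob(4)[OF A]]] \<epsilon>'[OF A]] by simp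
  next
    fix f assume f: "f \<in> Arr E"
    define X Y where "X = Dom E f" and "Y = Cod E f"
    have fh: "f \<in> Hom E X Y" and X: "X \<in> Obj E" and Y: "Y \<in> Obj E"
      using arrE[OF f] by (auto simp: X_def Y_def)
    note Gf = far_Hom[OF G' fh]
    note FGf = far_Hom[OF F far_Hom[OF G Gf]]
    have "Comp E (Comp E (\<epsilon>' Y) (far F' (\<epsilon> (fob G' Y)))) (far F' (far F (far G (far G' f))))
      = Comp E (\<epsilon>' Y) (Comp E (far F' (\<epsilon> (fob G' Y))) (far F' (far F (far G (far G' f)))))"
      using Comp_assoc[OF cat(3) far_Hom[OF F' FGf] far_Hom[OF F' \<epsilon>[OF ob(4)[OF Y]]] \<epsilon>'[OF Y]] by simp
    also have "\<dots> = Comp E (\<epsilon>' Y) (far F' (Comp D (\<epsilon> (fob G' Y)) (far F (far G (far G' f)))))"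
      using far_Comp[OF F' FGf \<epsilon>[OF ob(4)[OF Y]]] by simp
    also have "\<dots> = Comp E (\<epsilon>' Y) (far F' (Comp D (far G' f) (\<epsilon> (fob G' X))))"
      using nat_trans_natural[OF nt(2) Gf] by simp
    also have "\<dots> = Comp E (\<epsilon>' Y) (Comp E (far F' (far G' f)) (far F' (\<epsilon> (fob G' X))))"
      using far_Comp[OF F' \<epsilon>[OF ob(4)[OF X]] Gf] by simp
    also have "\<dots> = Comp E (Comp E (\<epsilon>' Y) (far F' (far G' f))) (far F' (\<epsilon> (fob G' X)))"
      using Comp_assoc[OF cat(3) far_Hom[OF F' \<epsilon>[OF ob(4)[OF X]]] far_Hom[OF F' Gf] \<epsilon>'[OF Y]] by simp
    also have "\<dots> = Comp E (Comp E f (\<epsilon>' X)) (far F' (\<epsilon> (fob G' X)))"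
      using nat_trans_natural[OF nt(4) fh] by simp
    also have "\<dots> = Comp E f (Comp E (\<epsilon>' X) (far F' (\<epsilon> (fob G' X))))"
      using Comp_assoc[OF cat(3) far_Hom[OF F' \<epsilon>[OF ob(4)[OF X]]] \<epsilon>'[OF X] fh] by simp
    finally show "Comp E (far id_functor f) (Comp E (\<epsilon>' (Dom E f)) (far F' (\<epsilon> (fob G' (Dom E f)))))
      = Comp E (Comp E (\<epsilon>' (Cod E f)) (far F' (\<epsilon> (fob G' (Cod E f)))))
          (far ((F' \<circ>\<^sub>F F) \<circ>\<^sub>F (G \<circ>\<^sub>F G')) f)"
      by (simp add: X_def Y_def)
  qed
  have 3: "Comp E (Comp E (\<epsilon>' (fob (F' \<circ>\<^sub>F F) A)) (far F' (\<epsilon> (fob G' (fob (F' \<circ>\<^sub>F F) A)))))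
      (far (F' \<circ>\<^sub>F F) (Comp C (far G (\<eta>' (fob F A))) (\<eta> A))) = Ident E (fob (F' \<circ>\<^sub>F F) A)"
    if A: "A \<in> Obj C" for A
  proof -
    define H where "H = fob F A"
    define e where "e = \<epsilon> (fob G' (fob F' H))"
    have H: "H \<in> Obj D" using A ob by (simp add: H_def)
    note eH = \<epsilon>[OF ob(4)[OF ob(3)[OF H]], folded e_def]
    note F\<eta> = far_Hom[OF F \<eta>[OF A], folded H_def]
    note FG\<eta>' = far_Hom[OF F far_Hom[OF G \<eta>'[OF H]]]
    have "far F (Comp C (far G (\<eta>' H)) (\<eta> A)) = Comp D (far F (far G (\<eta>' H))) (far F (\<eta> A))"
      using far_Comp[OF F \<eta>[OF A] far_Hom[OF G \<eta>'[OF H], unfolded H_def]] by (simp add: H_def)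
    then have "Comp D e (far F (Comp C (far G (\<eta>' H)) (\<eta> A)))
       = Comp D (Comp D e (far F (far G (\<eta>' H)))) (far F (\<eta> A))"
      using Comp_assoc[OF cat(2) F\<eta> FG\<eta>' eH] by simp
    also have "\<dots> = Comp D (Comp D (\<eta>' H) (\<epsilon> H)) (far F (\<eta> A))"
      using nat_trans_natural[OF nt(2) \<eta>'[OF H]] by (simp add: e_def)
    also have "\<dots> = Comp D (\<eta>' H) (Comp D (\<epsilon> H) (far F (\<eta> A)))"
      using Comp_assoc[OF cat(2) F\<eta> \<epsilon>[OF H] \<eta>'[OF H]] by simp
    also have "\<dots> = \<eta>' H"
      using tri(1)[OF A] Comp_Ident(1)[OF cat(2) \<eta>'[OF H]] by (simp add: H_def)
    finally have e1: "Comp D e (far F (Comp C (far G (\<eta>' H)) (\<eta> A))) = \<eta>' H" .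
    have h: "Comp C (far G (\<eta>' H)) (\<eta> A) \<in> Hom C A (fob G (fob G' (fob F' H)))"
      using Comp_Hom[OF cat(1) \<eta>[OF A] far_Hom[OF G \<eta>'[OF H], unfolded H_def]] by (simp add: H_def)
    note Fh = far_Hom[OF F h, folded H_def]
    have "Comp E (Comp E (\<epsilon>' (fob F' H)) (far F' e)) (far F' (far F (Comp C (far G (\<eta>' H)) (\<eta> A))))
       = Comp E (\<epsilon>' (fob F' H)) (far F' (Comp D e (far F (Comp C (far G (\<eta>' H)) (\<eta> A)))))"
      using Comp_assoc[OF cat(3) far_Hom[OF F' Fh] far_Hom[OF F' eH] \<epsilon>'[OF ob(3)[OF H]]]
        far_Comp[OF F' Fh eH] by simp
    also have "\<dots> = Ident E (fob F' H)" using e1 tri(3)[OF H] by simp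
    finally show ?thesis by (simp add: H_def e_def)
  qed
  have 4: "Comp C (far (G \<circ>\<^sub>F G') (Comp E (\<epsilon>' B) (far F' (\<epsilon> (fob G' B)))))
      (Comp C (far G (\<eta>' (fob F (fob (G \<circ>\<^sub>F G') B)))) (\<eta> (fob (G \<circ>\<^sub>F G') B)))
      = Ident C (fob (G \<circ>\<^sub>F G') B)"
    if B: "B \<in> Obj E" for B
  proof -
    define H where "H = fob G' B"
    define n where "n = \<eta>' (fob F (fob G H))"
    have H: "H \<in> Obj D" using B ob by (simp add: H_def)
    note nH = \<eta>'[OF ob(1)[OF ob(2)[OF H]], folded n_def]
    note G\<epsilon>' = far_Hom[OF G' \<epsilon>'[OF B], folded H_def]
    note GF\<epsilon> = far_Hom[OF G' far_Hom[OF F' \<epsilon>[OF H]]]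
    note h = Comp_Hom[OF cat(3) far_Hom[OF F' \<epsilon>[OF H]] \<epsilon>'[OF B, folded H_def]]
    note Gh = far_Hom[OF G' h, folded H_def]
    have "far G' (Comp E (\<epsilon>' B) (far F' (\<epsilon> H))) = Comp D (far G' (\<epsilon>' B)) (far G' (far F' (\<epsilon> H)))"
      using far_Comp[OF G' far_Hom[OF F' \<epsilon>[OF H]] \<epsilon>'[OF B, folded H_def]] .
    then have "Comp D (far G' (Comp E (\<epsilon>' B) (far F' (\<epsilon> H)))) n
       = Comp D (far G' (\<epsilon>' B)) (Comp D (far G' (far F' (\<epsilon> H))) n)"
      using Comp_assoc[OF cat(2) nH GF\<epsilon> G\<epsilon>'] by simp
    also have "\<dots> = Comp D (far G' (\<epsilon>' B)) (Comp D (\<eta>' H) (\<epsilon> H))"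
      using nat_trans_natural[OF nt(3) \<epsilon>[OF H]] by (simp add: n_def)
    also have "\<dots> = Comp D (Comp D (far G' (\<epsilon>' B)) (\<eta>' H)) (\<epsilon> H)"
      using Comp_assoc[OF cat(2) \<epsilon>[OF H] \<eta>'[OF H] G\<epsilon>'] .
    also have "\<dots> = \<epsilon> H"
      using tri(4)[OF B] Comp_Ident(2)[OF cat(2) \<epsilon>[OF H]] by (simp add: H_def)
    finally have e1: "Comp D (far G' (Comp E (\<epsilon>' B) (far F' (\<epsilon> H)))) n = \<epsilon> H" .
    have "Comp C (far G (far G' (Comp E (\<epsilon>' B) (far F' (\<epsilon> H))))) (Comp C (far G n) (\<eta> (fob G H)))
        = Comp C (far G (Comp D (far G' (Comp E (\<epsilon>' B) (far F' (\<epsilon> H)))) n)) (\<eta> (fob G H))"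
      using Comp_assoc[OF cat(1) \<eta>[OF ob(2)[OF H]] far_Hom[OF G nH] far_Hom[OF G Gh]]
        far_Comp[OF G nH Gh] by simp
    also have "\<dots> = Ident C (fob G H)" using e1 tri(2)[OF H] by simp
    finally show ?thesis by (simp add: H_def n_def)
  qed
  show ?thesis
    unfolding is_adjunction_def
    using is_functor_comp[OF F F'] is_functor_comp[OF G' G] 1 2 3 4 by blast
qed

section \<open>The category formed by a class of algebras\<close>

lemma alg_category_simps [simp]:
  "Obj (alg_category sig \<K>) = \<K>"
  "Arr (alg_category sig \<K>) = {m. src m \<in> \<K> \<and> tgt m \<in> \<K> \<and> fn m \<in> homs sig (src m) (tgt m)}"
  "Dom (alg_category sig \<K>) = src"
  "Cod (alg_category sig \<K>) = tgt"
  "Ident (alg_category sig \<K>) A = \<lparr>src = A, tgt = A, fn = (\<lambda>x\<in>carrier A. x)\<rparr>"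
  "Comp (alg_category sig \<K>) n m =
     \<lparr>src = src m, tgt = tgt n, fn = compose (carrier (src m)) (fn n) (fn m)\<rparr>"
  by (simp_all add: alg_category_def)

lemma homs_mem: "h \<in> homs sig A B \<Longrightarrow> x \<in> carrier A \<Longrightarrow> h x \<in> carrier B"
  unfolding homs_def by auto

lemma homs_oper:
  "h \<in> homs sig A B \<Longrightarrow> xs \<in> args sig (carrier A) f \<Longrightarrow> h (oper A f xs) = oper B f (map h xs)"
  unfolding homs_def by auto

lemma homs_extensional: "h \<in> homs sig A B \<Longrightarrow> h \<in> extensional (carrier A)"
  unfolding homs_def by (auto simp: PiE_def)

lemma args_mono: "xs \<in> args sig X f \<Longrightarrow> X \<subseteq> Y \<Longrightarrow> xs \<in> args sig Y f"
  unfolding args_def by auto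

lemma map_args: "(\<And>x. x \<in> X \<Longrightarrow> h x \<in> Y) \<Longrightarrow> xs \<in> args sig X f \<Longrightarrow> map h xs \<in> args sig Y f"
  unfolding args_def by auto

lemma is_algebra_oper: "is_algebra sig A \<Longrightarrow> xs \<in> args sig (carrier A) f \<Longrightarrow> oper A f xs \<in> carrier A"
  unfolding is_algebra_def by auto

text \<open>Closure of A under its operations makes the restriction invisible on results, so the
  homomorphism equation can be checked for h itself.\<close>

lemma homs_restrictI:
  assumes "\<And>x. x \<in> carrier A \<Longrightarrow> h x \<in> carrier B"
    and "\<And>f xs. xs \<in> args sig (carrier A) f \<Longrightarrow> h (oper A f xs) = oper B f (map h xs)"
    and "is_algebra sig A"
  shows "restrict h (carrier A) \<in> homs sig A B"
proof -
  have "restrict h (carrier A) (oper A f xs) = oper B f (map (restrict h (carrier A)) xs)"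
    if "xs \<in> args sig (carrier A) f" for f xs
  proof -
    have *: "map (restrict h (carrier A)) xs = map h xs"
      using that by (auto simp: args_def)
    show ?thesis
      unfolding * using assms(2)[OF that] is_algebra_oper[OF assms(3) that] by simp
  qed
  then show ?thesis
    using assms(1) unfolding homs_def by auto
qed

lemma homs_compose:
  assumes "is_algebra sig A" "h \<in> homs sig A B" "k \<in> homs sig B C"
  shows "compose (carrier A) k h \<in> homs sig A C"
proof -
  have "(\<lambda>x\<in>carrier A. k (h x)) \<in> homs sig A C"
  proof (rule homs_restrictI)
    fix f xs assume xs: "xs \<in> args sig (carrier A) f"
    show "k (h (oper A f xs)) = oper C f (map (\<lambda>x. k (h x)) xs)"
      using homs_oper[OF assms(2) xs] homs_oper[OF assms(3) map_args[OF homs_mem[OF assms(2)] xs]]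
      by (simp add: comp_def)
  qed (use assms in \<open>auto intro: homs_mem\<close>)
  then show ?thesis by (simp add: compose_def)
qed

lemma alg_arrow_eqI:
  "src m = src m' \<Longrightarrow> tgt m = tgt m' \<Longrightarrow> fn m = fn m' \<Longrightarrow> m = (m' :: ('f, 'a) alg_arrow)"
  by simp

lemma is_category_alg_category:
  assumes "\<And>A. A \<in> \<K> \<Longrightarrow> is_algebra sig A"
  shows "is_category (alg_category sig \<K>)"
proof -
  have id: "(\<lambda>x\<in>carrier A. x) \<in> homs sig A A" if "A \<in> \<K>" for A
    by (rule homs_restrictI) (use assms[OF that] in auto)
  have r: "compose (carrier A) h (\<lambda>x\<in>carrier A. x) = h" if "h \<in> homs sig A B" for h A B
    using homs_extensional[OF that] by (auto simp: compose_def extensional_def)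
  have l: "compose (carrier A) (\<lambda>x\<in>carrier B. x) h = h" if "h \<in> homs sig A B" for h A B
    using homs_extensional[OF that] homs_mem[OF that] by (auto simp: compose_def extensional_def)
  have assoc: "compose (carrier A) k (compose (carrier A) h g) = compose (carrier A) (compose (carrier B) k h) g"
    if "g \<in> homs sig A B" for A B C g h k
    using homs_mem[OF that] by (auto simp: compose_def)
  show ?thesis
    unfolding is_category_def Hom_def
    using id assms
    by (auto simp: homs_compose intro!: alg_arrow_eqI r l assoc)
qed

text \<open>Arrows carry their source and target, and \<open>arr\<close> fixes both for image
  arrows. Equality of arrows is then equality of maps, which extensionality reduces to points of the
  carrier.\<close>

lemma is_functor_algI:
  assumes "\<And>A. A \<in> \<K> \<Longrightarrow> is_algebra sig A" "\<And>A. A \<in> \<M> \<Longrightarrow> is_algebra sig' A"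
    and ob: "\<And>A. A \<in> \<K> \<Longrightarrow> fob F A \<in> \<M>"
    and arr: "\<And>m. far F m = \<lparr>src = fob F (src m), tgt = fob F (tgt m), fn = fn (far F m)\<rparr>"
    and hom: "\<And>A B h. A \<in> \<K> \<Longrightarrow> B \<in> \<K> \<Longrightarrow> h \<in> homs sig A B \<Longrightarrow>
      fn (far F \<lparr>src = A, tgt = B, fn = h\<rparr>) \<in> homs sig' (fob F A) (fob F B)"
    and id: "\<And>A x. A \<in> \<K> \<Longrightarrow> x \<in> carrier (fob F A) \<Longrightarrow>
      fn (far F \<lparr>src = A, tgt = A, fn = (\<lambda>x\<in>carrier A. x)\<rparr>) x = x"
    and comp: "\<And>A B C h k x. A \<in> \<K> \<Longrightarrow> B \<in> \<K> \<Longrightarrow> C \<in> \<K> \<Longrightarrow>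
      h \<in> homs sig A B \<Longrightarrow> k \<in> homs sig B C \<Longrightarrow> x \<in> carrier (fob F A) \<Longrightarrow>
      fn (far F \<lparr>src = A, tgt = C, fn = compose (carrier A) k h\<rparr>) x =
      fn (far F \<lparr>src = B, tgt = C, fn = k\<rparr>) (fn (far F \<lparr>src = A, tgt = B, fn = h\<rparr>) x)"
  shows "is_functor (alg_category sig \<K>) (alg_category sig' \<M>) F"
proof -
  have st: "src (far F m) = fob F (src m)" "tgt (far F m) = fob F (tgt m)" for m
    by (subst arr, simp)+
  have hom': "fn (far F m) \<in> homs sig' (fob F (src m)) (fob F (tgt m))"
    if "src m \<in> \<K>" "tgt m \<in> \<K>" "fn m \<in> homs sig (src m) (tgt m)" for m
  proof -
    have "\<lparr>src = src m, tgt = tgt m, fn = fn m\<rparr> = m" by simp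
    then show ?thesis using hom[OF that] by metis
  qed
  have id': "far F \<lparr>src = A, tgt = A, fn = (\<lambda>x\<in>carrier A. x)\<rparr> =
      \<lparr>src = fob F A, tgt = fob F A, fn = (\<lambda>x\<in>carrier (fob F A). x)\<rparr>" if "A \<in> \<K>" for A
  proof (rule alg_arrow_eqI)
    have "(\<lambda>x\<in>carrier A. x) \<in> homs sig A A"
      by (rule homs_restrictI) (use assms(1)[OF that] in auto)
    from homs_extensional[OF hom[OF that that this]]
    show "fn (far F \<lparr>src = A, tgt = A, fn = (\<lambda>x\<in>carrier A. x)\<rparr>) =
      fn \<lparr>src = fob F A, tgt = fob F A, fn = (\<lambda>x\<in>carrier (fob F A). x)\<rparr>"
      using id[OF that] by (auto simp: extensional_def restrict_def intro!: ext)
  qed (simp_all add: st)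
  have comp': "far F \<lparr>src = src m, tgt = tgt n, fn = compose (carrier (src m)) (fn n) (fn m)\<rparr> =
      \<lparr>src = fob F (src m), tgt = fob F (tgt n),
        fn = compose (carrier (fob F (src m))) (fn (far F n)) (fn (far F m))\<rparr>"
    if "src m \<in> \<K>" "tgt m \<in> \<K>" "fn m \<in> homs sig (src m) (tgt m)"
      "tgt n \<in> \<K>" "fn n \<in> homs sig (tgt m) (tgt n)" "src n = tgt m" for m n
  proof (rule alg_arrow_eqI)
    have n: "\<lparr>src = tgt m, tgt = tgt n, fn = fn n\<rparr> = n" and m: "\<lparr>src = src m, tgt = tgt m, fn = fn m\<rparr> = m"
      using that by simp_all
    have "compose (carrier (src m)) (fn n) (fn m) \<in> homs sig (src m) (tgt n)"
      using homs_compose assms(1) that by blast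
    from homs_extensional[OF hom[OF that(1,4) this]]
    show "fn (far F \<lparr>src = src m, tgt = tgt n, fn = compose (carrier (src m)) (fn n) (fn m)\<rparr>) =
      fn \<lparr>src = fob F (src m), tgt = fob F (tgt n),
        fn = compose (carrier (fob F (src m))) (fn (far F n)) (fn (far F m))\<rparr>"
      using comp[OF that(1,2,4,3,5)] unfolding n m
      by (auto simp: extensional_def restrict_def compose_def intro!: ext)
  qed (simp_all add: st)
  show ?thesis
    unfolding is_functor_def
    using is_category_alg_category[of \<K> sig, OF assms(1)] is_category_alg_category[of \<M> sig', OF assms(2)]
      ob hom' id' comp'
    by (auto simp: Hom_def st)
qed

text \<open>In a naturality square \<open>compose\<close> restricts both composites to the same
  carrier, so only an equation between elements remains.\<close>

lemma is_nat_trans_algI: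
  assumes "is_functor C (alg_category sig \<K>) F" "is_functor C (alg_category sig \<K>) G"
    and \<tau>: "\<And>A. A \<in> Obj C \<Longrightarrow> src (\<tau> A) = fob F A \<and> tgt (\<tau> A) = fob G A \<and>
      fn (\<tau> A) \<in> homs sig (fob F A) (fob G A)"
    and nat: "\<And>f x. f \<in> Arr C \<Longrightarrow> x \<in> carrier (fob F (Dom C f)) \<Longrightarrow>
      fn (far G f) (fn (\<tau> (Dom C f)) x) = fn (\<tau> (Cod C f)) (fn (far F f) x)"
  shows "is_nat_trans C (alg_category sig \<K>) F G \<tau>"
proof -
  have DC: "Dom C f \<in> Obj C" "Cod C f \<in> Obj C" if "f \<in> Arr C" for f
    using assms(1) that by (auto simp: is_functor_def is_category_def)
  have ob: "fob F A \<in> \<K>" "fob G A \<in> \<K>" if "A \<in> Obj C" for A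
    using assms(1,2) that by (auto simp: is_functor_def)
  have ar: "src (far F f) = fob F (Dom C f)" "tgt (far F f) = fob F (Cod C f)"
    "src (far G f) = fob G (Dom C f)" "tgt (far G f) = fob G (Cod C f)" if "f \<in> Arr C" for f
    using assms(1,2) that by (auto simp: is_functor_def Hom_def)
  show ?thesis
    unfolding is_nat_trans_def Hom_def
    using DC ob ar \<tau> nat by (auto simp: compose_def restrict_def intro!: ext)
qed

section \<open>Terms and varieties\<close>

lemma args_image:
  assumes "xs \<in> args sig (h ` X) f"
  obtains ys where "ys \<in> args sig X f" "xs = map h ys"
proof
  let ?ys = "map (inv_into X h) xs"
  have "inv_into X h x \<in> X" "h (inv_into X h x) = x" if "x \<in> set xs" for x
    using that assms by (auto simp: args_def f_inv_into_f inv_into_into subset_iff)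
  then show "?ys \<in> args sig X f" "xs = map h ?ys"
    using assms by (auto simp: args_def o_def map_idI)
qed

lemma carrier_subalgebra [simp]: "carrier (subalgebra A X) = X"
  and oper_subalgebra [simp]: "oper (subalgebra A X) = oper A"
  by (simp_all add: subalgebra_def)

lemma carrier_power [simp]: "carrier (power_algebra A I) = I \<rightarrow>\<^sub>E carrier A"
  and oper_power: "oper (power_algebra A I) f xs = (\<lambda>i\<in>I. oper A f (map (\<lambda>x. x i) xs))"
  by (simp_all add: power_algebra_def)

lemma subuniverse_oper: "subuniverse sig A X \<Longrightarrow> xs \<in> args sig X f \<Longrightarrow> oper A f xs \<in> X"
  unfolding subuniverse_def by auto

lemma is_algebra_subalgebra: "subuniverse sig A X \<Longrightarrow> is_algebra sig (subalgebra A X)"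
  by (simp add: subuniverse_def is_algebra_def)

lemma is_algebra_subuniverse: "is_algebra sig A \<Longrightarrow> subuniverse sig A (carrier A)"
  by (simp add: subuniverse_def is_algebra_def)

lemma interp_subalgebra [simp]: "interp (subalgebra A X) \<rho> t = interp A \<rho> t"
  by (induction t) (auto cong: map_cong)

lemma interp_closed:
  assumes "subuniverse sig A X" "\<And>i. \<rho> i \<in> X"
  shows "is_term sig n t \<Longrightarrow> interp A \<rho> t \<in> X"
proof (induction t)
  case (App f ts)
  then show ?case
    by (auto simp: args_def intro!: subuniverse_oper[OF assms(1)])
qed (simp add: assms)

lemma interp_power:
  "i \<in> I \<Longrightarrow> interp (power_algebra A I) \<rho> t i = interp A (\<lambda>n. \<rho> n i) t"
proof (induction t)
  case (App f ts)
  then have *: "map (\<lambda>t. interp (power_algebra A I) \<rho> t i) ts = map (interp A (\<lambda>n. \<rho> n i)) ts"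
    by auto
  from App(2) show ?case
    unfolding interp.simps oper_power map_map o_def by (simp only: * restrict_apply')
qed simp

lemma homs_interp:
  assumes "is_algebra sig A" "h \<in> homs sig A B" "\<And>i. \<rho> i \<in> carrier A"
  shows "is_term sig n t \<Longrightarrow> h (interp A \<rho> t) = interp B (\<lambda>i. h (\<rho> i)) t"
proof (induction t)
  case (App f ts)
  then have "map (interp A \<rho>) ts \<in> args sig (carrier A) f"
    using interp_closed[OF is_algebra_subuniverse[OF assms(1)] assms(3)] by (auto simp: args_def)
  from homs_oper[OF assms(2) this] App show ?case by (simp add: o_def cong: map_cong)
qed simp

section \<open>Varieties and their identities\<close>

lemma HSP_is_algebra: "A \<in> HSP sig L \<Longrightarrow> is_algebra sig A"
  by (simp add: HSP_def)

lemma HSP_E: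
  assumes "A \<in> HSP sig (L :: ('f, 'l) algebra)"
  obtains I :: "('a \<Rightarrow> 'l) set" and R h where
    "subuniverse sig (power_algebra L I) R"
    "h \<in> homs sig (subalgebra (power_algebra L I) R) (A :: ('f, 'a) algebra)"
    "h ` R = carrier A"
  using assms unfolding HSP_def by blast

text \<open>The easy half of Birkhoff's theorem. A valuation in A is lifted along the surjection h
  to R, where the identity holds coordinate by coordinate. Well-formedness of the terms matters:
  closure of R and preservation by h are known only for argument lists of the right length.\<close>

lemma HSP_satisfies:
  fixes A :: "('f, 'a) algebra" and L :: "('f, 'l) algebra"
  assumes A: "A \<in> HSP sig L" and "satisfies L s t" and st: "is_term sig n s" "is_term sig n t"
  shows "satisfies A s t"
  unfolding satisfies_def
proof (intro allI impI)
  fix \<rho> :: "nat \<Rightarrow> 'a" assume \<rho>: "range \<rho> \<subseteq> carrier A"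
  obtain I :: "('a \<Rightarrow> 'l) set" and R h where R: "subuniverse sig (power_algebra L I) R"
    and h: "h \<in> homs sig (subalgebra (power_algebra L I) R) A" "h ` R = carrier A"
    using HSP_E[OF A] .
  define \<sigma> where "\<sigma> i = inv_into R h (\<rho> i)" for i :: nat
  have \<sigma>: "\<sigma> i \<in> R" "h (\<sigma> i) = \<rho> i" for i :: nat
  proof -
    have "\<rho> i \<in> h ` R" using \<rho> h(2) by auto
    then show "\<sigma> i \<in> R" "h (\<sigma> i) = \<rho> i"
      by (simp_all add: \<sigma>_def f_inv_into_f inv_into_into)
  qed
  have RL: "r i \<in> carrier L" if "r \<in> R" "i \<in> I" for r i
    using that R by (auto simp: subuniverse_def)
  have *: "interp (power_algebra L I) \<sigma> s = interp (power_algebra L I) \<sigma> t"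
  proof (rule PiE_ext)
    have "\<And>u. is_term sig n u \<Longrightarrow> interp (power_algebra L I) \<sigma> u \<in> I \<rightarrow>\<^sub>E carrier L"
    proof -
      fix u :: "'f trm" assume "is_term sig n u"
      then have "interp (power_algebra L I) \<sigma> u \<in> R" by (rule interp_closed[OF R \<sigma>(1)])
      with R show "interp (power_algebra L I) \<sigma> u \<in> I \<rightarrow>\<^sub>E carrier L"
        unfolding subuniverse_def by auto
    qed
    then show "interp (power_algebra L I) \<sigma> s \<in> I \<rightarrow>\<^sub>E carrier L"
      "interp (power_algebra L I) \<sigma> t \<in> I \<rightarrow>\<^sub>E carrier L" using st by auto
    show "interp (power_algebra L I) \<sigma> s i = interp (power_algebra L I) \<sigma> t i" if "i \<in> I" for i
      using assms(2) RL[OF \<sigma>(1) that] that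
      by (auto simp: interp_power satisfies_def image_subset_iff)
  qed
  have "h (interp (power_algebra L I) \<sigma> u) = interp A \<rho> u" if "is_term sig n u" for u
    using homs_interp[OF is_algebra_subalgebra[OF R] h(1) _ that, of \<sigma>] \<sigma> by simp
  then show "interp A \<rho> s = interp A \<rho> t" using * st by metis
qed

text \<open>Passing from S to L enlarges the carrier of a power but leaves its operations as they
  are, so the same I, R and h serve as witnesses.\<close>

lemma HSP_subalgebra_subset:
  fixes L :: "('f, 'l) algebra"
  assumes "subuniverse sig L S"
  shows "(HSP sig (subalgebra L S) :: ('f, 'a) algebra set) \<subseteq> HSP sig L"
proof
  fix A :: "('f, 'a) algebra" assume A: "A \<in> HSP sig (subalgebra L S)"
  obtain I :: "('a \<Rightarrow> 'l) set" and R h where R: "subuniverse sig (power_algebra (subalgebra L S) I) R"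
    and h: "h \<in> homs sig (subalgebra (power_algebra (subalgebra L S) I) R) A" "h ` R = carrier A"
    using HSP_E[OF A] .
  have op: "oper (power_algebra (subalgebra L S) I) = oper (power_algebra L I)"
    by (simp add: power_algebra_def)
  then have eq: "subalgebra (power_algebra (subalgebra L S) I) R = subalgebra (power_algebra L I) R"
    by (simp add: subalgebra_def)
  have "I \<rightarrow>\<^sub>E S \<subseteq> I \<rightarrow>\<^sub>E carrier L"
    using assms by (auto simp: subuniverse_def)
  then have "subuniverse sig (power_algebra L I) R"
    using R op by (auto simp: subuniverse_def)
  with h eq HSP_is_algebra[OF A] show "A \<in> HSP sig L"
    unfolding HSP_def by auto
qed

text \<open>Evaluation embeds A into the power of L indexed by all homomorphisms from A to L, an
  index set of exactly the type that \<open>HSP\<close> prescribes. The required surjection is the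
  inverse of this embedding.\<close>

lemma separated_imp_HSP:
  fixes A :: "('f, 'a) algebra" and L :: "('f, 'l) algebra"
  assumes A: "is_algebra sig A"
    and sep: "\<And>x y. x \<in> carrier A \<Longrightarrow> y \<in> carrier A \<Longrightarrow> (\<And>h. h \<in> homs sig A L \<Longrightarrow> h x = h y) \<Longrightarrow> x = y"
  shows "A \<in> HSP sig L"
proof -
  define I where "I = homs sig A L"
  define e where "e x = (\<lambda>i\<in>I. i x)" for x
  define R where "R = e ` carrier A"
  define g where "g = the_inv_into (carrier A) e"
  have inj: "inj_on e (carrier A)"
    by (rule inj_onI, rule sep) (auto simp: e_def I_def dest!: fun_cong split: if_splits)
  have ge: "g (e x) = x" if "x \<in> carrier A" for x
    using the_inv_into_f_f[OF inj that] by (simp add: g_def)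
  have eop: "oper (power_algebra L I) f (map e ys) = e (oper A f ys)"
    if "ys \<in> args sig (carrier A) f" for f ys
  proof -
    have "i (oper A f ys) = oper L f (map (\<lambda>y. i y) ys)" if "i \<in> I" for i
      using that \<open>ys \<in> _\<close> by (simp add: I_def homs_oper)
    then show ?thesis
      by (auto simp: oper_power e_def o_def intro!: ext)
  qed
  have R: "subuniverse sig (power_algebra L I) R"
    unfolding subuniverse_def
  proof (intro conjI allI ballI)
    show "R \<subseteq> carrier (power_algebra L I)"
      by (auto simp: R_def e_def I_def homs_mem)
    fix f xs assume "xs \<in> args sig R f"
    then obtain ys where ys: "ys \<in> args sig (carrier A) f" "xs = map e ys"
      unfolding R_def by (rule args_image)
    then show "oper (power_algebra L I) f xs \<in> R"
      using eop[OF ys(1)] is_algebra_oper[OF A ys(1)] by (simp add: R_def)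
  qed
  have "restrict g (carrier (subalgebra (power_algebra L I) R))
      \<in> homs sig (subalgebra (power_algebra L I) R) A"
  proof (rule homs_restrictI)
    fix f xs assume "xs \<in> args sig (carrier (subalgebra (power_algebra L I) R)) f"
    then have "xs \<in> args sig (e ` carrier A) f" by (simp add: R_def)
    then obtain ys where ys: "ys \<in> args sig (carrier A) f" "xs = map e ys"
      by (rule args_image)
    have "map g (map e ys) = ys"
      using ys(1) ge by (auto simp: args_def o_def intro!: map_idI)
    then show "g (oper (subalgebra (power_algebra L I) R) f xs) = oper A f (map g xs)"
      using eop[OF ys(1)] ge[OF is_algebra_oper[OF A ys(1)]] ys(2) by simp
  qed (use ge is_algebra_subalgebra[OF R] in \<open>auto simp: R_def\<close>)
  moreover have "restrict g R ` R = carrier A"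
    using ge by (force simp: R_def)
  ultimately show ?thesis
    unfolding HSP_def
    by (intro CollectI conjI exI[of _ I] exI[of _ R] exI[of _ "restrict g R"] A R) simp_all
qed

text \<open>One term replaces all variables at once: this is composition with a unary term, and it
  is applied only to the terms for T.\<close>

fun tsub :: "'f trm \<Rightarrow> 'f trm \<Rightarrow> 'f trm" where
  "tsub s (Var i) = s"
| "tsub s (App f ts) = App f (map (tsub s) ts)"

lemma interp_tsub: "interp A \<rho> (tsub s t) = interp A (\<lambda>_. interp A \<rho> s) t"
  by (induction t) (auto simp: o_def cong: map_cong)

lemma is_term_tsub: "is_term sig n s \<Longrightarrow> is_term sig m t \<Longrightarrow> is_term sig n (tsub s t)"
  by (induction t) auto

section \<open>Boolean algebras and their characters\<close>

text \<open>The points of the Stone space of \<open>B\<close>. They separate the elements of \<open>B\<close>, so every identity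
  between elements of a Boolean algebra below is checked at the points.\<close>

definition bchars :: "(bool_op, 'b) algebra \<Rightarrow> ('b \<Rightarrow> bool) set" where
  "bchars B = {u. u (one bool_sig B) \<and>
     (\<forall>x \<in> carrier B. \<forall>y \<in> carrier B. u (meet bool_sig B x y) \<longleftrightarrow> u x \<and> u y) \<and>
     (\<forall>x \<in> carrier B. u (oper B BCompl [x]) \<longleftrightarrow> \<not> u x)}"

locale boolean_alg =
  fixes B :: "(bool_op, 'b) algebra"
  assumes B: "B \<in> boolean_algebras"
begin

abbreviation bmeet (infixl "\<sqinter>" 70) where "x \<sqinter> y \<equiv> meet bool_sig B x y"
abbreviation bjoin (infixl "\<squnion>" 65) where "x \<squnion> y \<equiv> join bool_sig B x y"
abbreviation bcompl where "bcompl x \<equiv> oper B BCompl [x]"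
abbreviation bzero where "bzero \<equiv> zero bool_sig B"
abbreviation bone where "bone \<equiv> one bool_sig B"

lemma is_algebra: "is_algebra bool_sig B"
  using B by (simp add: boolean_algebras_def is_bounded_lattice_def)

lemma closed [simp, intro]:
  "x \<in> carrier B \<Longrightarrow> y \<in> carrier B \<Longrightarrow> x \<sqinter> y \<in> carrier B"
  "x \<in> carrier B \<Longrightarrow> y \<in> carrier B \<Longrightarrow> x \<squnion> y \<in> carrier B"
  "x \<in> carrier B \<Longrightarrow> bcompl x \<in> carrier B"
  "bzero \<in> carrier B" "bone \<in> carrier B"
  unfolding meet_def join_def zero_def one_def
  by (auto intro!: is_algebra_oper[OF is_algebra] simp: args_def bool_sig_def)

lemma lattice_laws:
  assumes "x \<in> carrier B" "y \<in> carrier B"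
  shows "x \<sqinter> y = y \<sqinter> x" "x \<squnion> y = y \<squnion> x" "x \<sqinter> (x \<squnion> y) = x" "x \<squnion> (x \<sqinter> y) = x"
  using B assms unfolding boolean_algebras_def is_bounded_lattice_def mem_Collect_eq by blast+

lemma bound_laws:
  assumes "x \<in> carrier B"
  shows "x \<sqinter> bone = x" "x \<squnion> bzero = x" "x \<sqinter> bcompl x = bzero" "x \<squnion> bcompl x = bone"
  using B assms unfolding boolean_algebras_def is_bounded_lattice_def mem_Collect_eq by blast+

lemma lattice_laws3:
  assumes "x \<in> carrier B" "y \<in> carrier B" "z \<in> carrier B"
  shows "x \<sqinter> (y \<sqinter> z) = (x \<sqinter> y) \<sqinter> z" "x \<sqinter> (y \<squnion> z) = (x \<sqinter> y) \<squnion> (x \<sqinter> z)"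
  using B assms unfolding boolean_algebras_def is_bounded_lattice_def mem_Collect_eq by blast+

lemma meet_idem: "x \<in> carrier B \<Longrightarrow> x \<sqinter> x = x"
  using lattice_laws(3)[of x "x \<sqinter> x"] lattice_laws(4)[of x x] by simp

lemma meet_zero: "x \<in> carrier B \<Longrightarrow> x \<sqinter> bzero = bzero"
  using lattice_laws3(1)[of x x "bcompl x"] bound_laws(3)[of x] meet_idem[of x] by simp

lemma zero_join: "x \<in> carrier B \<Longrightarrow> bzero \<squnion> x = x"
  using lattice_laws(2)[of bzero x] bound_laws(2)[of x] by simp

lemma disjoint_imp_le_compl:
  assumes "x \<in> carrier B" "y \<in> carrier B" "x \<sqinter> y = bzero"
  shows "x \<sqinter> bcompl y = x"
proof -
  have "x = x \<sqinter> (y \<squnion> bcompl y)" using assms bound_laws(1,4) by simp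
  also have "\<dots> = (x \<sqinter> y) \<squnion> (x \<sqinter> bcompl y)" using assms by (simp add: lattice_laws3)
  also have "\<dots> = x \<sqinter> bcompl y" using assms by (simp add: zero_join)
  finally show ?thesis by simp
qed

lemma disjoint_compl_imp_le:
  assumes "x \<in> carrier B" "y \<in> carrier B" "x \<sqinter> bcompl y = bzero"
  shows "x \<sqinter> y = x"
proof -
  have "x = x \<sqinter> (y \<squnion> bcompl y)" using assms bound_laws(1,4) by simp
  also have "\<dots> = (x \<sqinter> y) \<squnion> (x \<sqinter> bcompl y)" using assms by (simp add: lattice_laws3)
  also have "\<dots> = x \<sqinter> y" using assms bound_laws(2) by simp
  finally show ?thesis by simp
qed

lemma le_meet_iff:
  assumes "x \<in> carrier B" "y \<in> carrier B" "z \<in> carrier B"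
  shows "x \<sqinter> (y \<sqinter> z) = x \<longleftrightarrow> x \<sqinter> y = x \<and> x \<sqinter> z = x"
proof
  assume l: "x \<sqinter> (y \<sqinter> z) = x"
  have xyz: "(x \<sqinter> y) \<sqinter> z = x" using l assms by (simp add: lattice_laws3(1))
  then have "x \<sqinter> z = x"
    using lattice_laws3(1)[of "x \<sqinter> y" z z] meet_idem[of z] assms by simp
  moreover have "x \<sqinter> y = x"
  proof -
    have "(x \<sqinter> z) \<sqinter> y = x"
      using xyz assms lattice_laws3(1)[of x y z] lattice_laws3(1)[of x z y] lattice_laws(1)[of y z] by simp
    then show ?thesis
      using lattice_laws3(1)[of "x \<sqinter> z" y y] meet_idem[of y] assms by simp
  qed
  ultimately show "x \<sqinter> y = x \<and> x \<sqinter> z = x" by simp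
qed (use assms in \<open>simp add: lattice_laws3(1)\<close>)

lemma le_trans:
  assumes "x \<in> carrier B" "y \<in> carrier B" "z \<in> carrier B" "x \<sqinter> y = x" "y \<sqinter> z = y"
  shows "x \<sqinter> z = x"
  using lattice_laws3(1)[of x y z] assms by simp

lemma meet_le:
  assumes "x \<in> carrier B" "y \<in> carrier B"
  shows "(x \<sqinter> y) \<sqinter> x = x \<sqinter> y" "(x \<sqinter> y) \<sqinter> y = x \<sqinter> y"
  using assms le_meet_iff[of "x \<sqinter> y" x y] meet_idem[of "x \<sqinter> y"] by auto

section \<open>Ultrafilters and separation of points\<close>

text \<open>The equivalence packs closure under meets and upward closure together: if x = x
  \<sqinter> z lies in F, its forward direction puts z into F. It is also the shape of the meet
  clause of a character.\<close>

definition proper_filter :: "'b set \<Rightarrow> bool" where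
  "proper_filter F \<longleftrightarrow> F \<subseteq> carrier B \<and> bone \<in> F \<and> bzero \<notin> F \<and>
     (\<forall>x \<in> carrier B. \<forall>y \<in> carrier B. x \<sqinter> y \<in> F \<longleftrightarrow> x \<in> F \<and> y \<in> F)"

text \<open>If neither y nor its complement is in M, then M and y generate a proper filter: from m
  \<sqinter> y = 0 it would follow that m is below the complement of y, which would then lie in M.
  Maximality puts y into M after all.\<close>

lemma maximal_filter_compl:
  assumes M: "proper_filter M" and max: "\<And>N. proper_filter N \<Longrightarrow> M \<subseteq> N \<Longrightarrow> N = M"
    and y: "y \<in> carrier B"
  shows "bcompl y \<in> M \<longleftrightarrow> y \<notin> M"
proof
  note Mc = M[unfolded proper_filter_def]
  show "y \<notin> M" if "bcompl y \<in> M"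
    using Mc that y bound_laws(3)[OF y] by fastforce
  assume "y \<notin> M"
  show "bcompl y \<in> M"
  proof (rule ccontr)
    assume c: "bcompl y \<notin> M"
    \<comment> \<open>The filter generated by M and y: all elements above some m \<sqinter>
      y.\<close>
    define N where "N = {z \<in> carrier B. \<exists>m \<in> M. (m \<sqinter> y) \<sqinter> z = m \<sqinter> y}"
    have Ms: "m \<in> M \<Longrightarrow> m \<in> carrier B" for m using Mc by auto
    have "bone \<in> N" using Mc y bound_laws(1) Ms unfolding N_def by blast
    moreover have "bzero \<notin> N"
    proof
      assume "bzero \<in> N"
      then obtain m where m: "m \<in> M" "(m \<sqinter> y) \<sqinter> bzero = m \<sqinter> y" by (auto simp: N_def)
      then have "m \<sqinter> y = bzero" using meet_zero[of "m \<sqinter> y"] Ms y by auto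
      from disjoint_imp_le_compl[OF Ms[OF m(1)] y this]
      have "m \<sqinter> bcompl y \<in> M" using m by simp
      then show False using Mc c y Ms[OF m(1)] by auto
    qed
    moreover have "a \<sqinter> b \<in> N \<longleftrightarrow> a \<in> N \<and> b \<in> N" if ab: "a \<in> carrier B" "b \<in> carrier B" for a b
    proof
      assume "a \<in> N \<and> b \<in> N"
      then obtain m n where m: "m \<in> M" "(m \<sqinter> y) \<sqinter> a = m \<sqinter> y" and n: "n \<in> M" "(n \<sqinter> y) \<sqinter> b = n \<sqinter> y"
        by (auto simp: N_def)
      \<comment> \<open>A common lower bound of the two witnesses m \<sqinter> y and n \<sqinter> y,
        again of the form required in N because m \<sqinter> n is in M.\<close>
      define k where "k = (m \<sqinter> n) \<sqinter> y"
      have c: "m \<in> carrier B" "n \<in> carrier B" "k \<in> carrier B" using m n Ms y by (auto simp: k_def)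
      have "k \<sqinter> (m \<sqinter> n) = k" "k \<sqinter> y = k"
        using meet_le[of "m \<sqinter> n" y] c y by (auto simp: k_def)
      then have "k \<sqinter> m = k" "k \<sqinter> n = k" using le_meet_iff[of k m n] c by auto
      with \<open>k \<sqinter> y = k\<close> have "k \<sqinter> (m \<sqinter> y) = k" "k \<sqinter> (n \<sqinter> y) = k"
        using le_meet_iff c y by auto
      then have "k \<sqinter> a = k" "k \<sqinter> b = k"
        using le_trans[OF c(3) _ ab(1) _ m(2)] le_trans[OF c(3) _ ab(2) _ n(2)] c y by auto
      then have "k \<sqinter> (a \<sqinter> b) = k" using le_meet_iff c ab by auto
      moreover have "m \<sqinter> n \<in> M" using m n Mc c by auto
      ultimately show "a \<sqinter> b \<in> N" using ab unfolding N_def k_def by blast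
    next
      assume "a \<sqinter> b \<in> N"
      then obtain m where m: "m \<in> M" "(m \<sqinter> y) \<sqinter> (a \<sqinter> b) = m \<sqinter> y" by (auto simp: N_def)
      then show "a \<in> N \<and> b \<in> N"
        using le_meet_iff[of "m \<sqinter> y" a b] ab Ms y unfolding N_def by auto
    qed
    ultimately have "proper_filter N" by (auto simp: proper_filter_def N_def)
    moreover have "M \<subseteq> N" using meet_le(1) Ms y unfolding N_def by blast
    ultimately have "N = M" by (rule max)
    moreover have "y \<in> N" using Mc meet_le(2)[of bone y] y unfolding N_def by auto
    ultimately show False using \<open>y \<notin> M\<close> by simp
  qed
qed

text \<open>Zorn's lemma on the proper filters containing a. The principal filter of a starts the
  family, being proper precisely because a is not 0; the character is membership in a maximal
  member.\<close>

lemma bchar_exists: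
  assumes a: "a \<in> carrier B" "a \<noteq> bzero"
  shows "\<exists>u \<in> bchars B. u a"
proof -
  define \<F> where "\<F> = {F. proper_filter F \<and> a \<in> F}"
  have "{z \<in> carrier B. a \<sqinter> z = a} \<in> \<F>"
    using a le_meet_iff[OF a(1)] by (simp add: \<F>_def proper_filter_def meet_idem bound_laws(1) meet_zero)
  then have "\<F> \<noteq> {}" by blast
  moreover have "\<Union>C \<in> \<F>" if C: "C \<noteq> {}" "subset.chain \<F> C" for C
  proof -
    have CF: "F \<in> \<F>" if "F \<in> C" for F using C(2) that by (auto simp: subset_chain_def)
    then have pf: "\<And>F. F \<in> C \<Longrightarrow> proper_filter F" by (auto simp: \<F>_def)
    have UC: "x \<sqinter> y \<in> \<Union>C" if "x \<in> carrier B" "y \<in> carrier B" "x \<in> \<Union>C" "y \<in> \<Union>C" for x y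
    proof -
      obtain F G where FG: "F \<in> C" "x \<in> F" "G \<in> C" "y \<in> G" using \<open>x \<in> \<Union>C\<close> \<open>y \<in> \<Union>C\<close> by blast
      moreover have "F \<subseteq> G \<or> G \<subseteq> F" using C(2) FG by (auto simp: subset_chain_def)
      ultimately obtain H where H: "H \<in> C" "x \<in> H" "y \<in> H" by blast
      then have "x \<sqinter> y \<in> H"
        using pf[OF H(1)] that(1,2) unfolding proper_filter_def by blast
      with H(1) show ?thesis by blast
    qed
    then have "proper_filter (\<Union>C)"
    proof -
      have "\<Union>C \<subseteq> carrier B" "bzero \<notin> \<Union>C" "bone \<in> \<Union>C"
        using pf C(1) by (auto simp: proper_filter_def)
      moreover have "x \<sqinter> y \<in> \<Union>C \<longleftrightarrow> x \<in> \<Union>C \<and> y \<in> \<Union>C"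
        if xy: "x \<in> carrier B" "y \<in> carrier B" for x y
      proof
        assume "x \<sqinter> y \<in> \<Union>C"
        then obtain F where F: "F \<in> C" "x \<sqinter> y \<in> F" by (rule UnionE)
        with pf[OF F(1)] xy have "x \<in> F \<and> y \<in> F" unfolding proper_filter_def by blast
        with F(1) show "x \<in> \<Union>C \<and> y \<in> \<Union>C" by (simp only: Union_iff) blast
      next
        assume "x \<in> \<Union>C \<and> y \<in> \<Union>C"
        then show "x \<sqinter> y \<in> \<Union>C" using UC[OF xy] by simp
      qed
      ultimately show ?thesis
        unfolding proper_filter_def by simp
    qed
    then show ?thesis using C(1) CF by (auto simp: \<F>_def)
  qed
  ultimately have "\<exists>M \<in> \<F>. \<forall>X \<in> \<F>. M \<subseteq> X \<longrightarrow> X = M"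
    by (rule subset_Zorn_nonempty)
  then obtain M where M: "M \<in> \<F>" "\<And>X. X \<in> \<F> \<Longrightarrow> M \<subseteq> X \<Longrightarrow> X = M"
    by blast
  then have pM: "proper_filter M" "a \<in> M" by (auto simp: \<F>_def)
  have "bcompl y \<in> M \<longleftrightarrow> y \<notin> M" if "y \<in> carrier B" for y
  proof (rule maximal_filter_compl[OF pM(1) _ that])
    \<comment> \<open>M is maximal only among filters containing a, but every filter above M
      contains a.\<close>
    fix N assume "proper_filter N" "M \<subseteq> N"
    with pM(2) show "N = M" by (intro M(2)) (auto simp: \<F>_def)
  qed
  then have "(\<lambda>x. x \<in> M) \<in> bchars B"
    using pM(1)[unfolded proper_filter_def] by (simp add: bchars_def)
  then show ?thesis using pM(2) by (intro bexI[of _ "\<lambda>x. x \<in> M"])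
qed

text \<open>\<open>bchars\<close> mentions only 1, meet and complement. The value at 0 comes from 0
  being the meet of 1 and its complement. For the join, meeting x \<squnion> y with the complement
  of x leaves only a part of y, and absorption gives the other direction.\<close>

lemma bchar_simps [simp]:
  assumes "u \<in> bchars B"
  shows "u bone" "\<not> u bzero"
    "x \<in> carrier B \<Longrightarrow> y \<in> carrier B \<Longrightarrow> u (x \<sqinter> y) \<longleftrightarrow> u x \<and> u y"
    "x \<in> carrier B \<Longrightarrow> y \<in> carrier B \<Longrightarrow> u (x \<squnion> y) \<longleftrightarrow> u x \<or> u y"
    "x \<in> carrier B \<Longrightarrow> u (bcompl x) \<longleftrightarrow> \<not> u x"
proof -
  show m: "u bone" "x \<in> carrier B \<Longrightarrow> y \<in> carrier B \<Longrightarrow> u (x \<sqinter> y) \<longleftrightarrow> u x \<and> u y"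
    "x \<in> carrier B \<Longrightarrow> u (bcompl x) \<longleftrightarrow> \<not> u x" for x y
    using assms by (auto simp: bchars_def)
  show z: "\<not> u bzero"
    using m(2)[of bone "bcompl bone"] m(3)[of bone] m(1) bound_laws(3)[of bone] by simp
  show "u (x \<squnion> y) \<longleftrightarrow> u x \<or> u y" if xy: "x \<in> carrier B" "y \<in> carrier B"
  proof -
    have "bcompl x \<sqinter> (x \<squnion> y) = bcompl x \<sqinter> y"
      using xy by (simp add: lattice_laws3 zero_join lattice_laws(1)[of "bcompl x" x] bound_laws(3))
    then have "u (x \<squnion> y) \<Longrightarrow> \<not> u x \<Longrightarrow> u y"
      using m(2)[of "bcompl x" "x \<squnion> y"] m(2)[of "bcompl x" y] m(3)[of x] xy by auto
    moreover have "u x \<Longrightarrow> u (x \<squnion> y)"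
      using m(2)[of x "x \<squnion> y"] lattice_laws(3)[of x y] xy by auto
    moreover have "u y \<Longrightarrow> u (x \<squnion> y)"
      using m(2)[of y "y \<squnion> x"] lattice_laws(3)[of y x] lattice_laws(2)[of x y] xy by auto
    ultimately show ?thesis by blast
  qed
qed

text \<open>If x is not below y, the meet of x with the complement of y is nonzero, and a character
  true there refutes the hypothesis.\<close>

lemma bchar_le:
  assumes "x \<in> carrier B" "y \<in> carrier B" "\<And>u. u \<in> bchars B \<Longrightarrow> u x \<Longrightarrow> u y"
  shows "x \<sqinter> y = x"
proof (rule ccontr)
  assume "x \<sqinter> y \<noteq> x"
  then have "x \<sqinter> bcompl y \<noteq> bzero" using disjoint_compl_imp_le assms by blast
  then obtain u where "u \<in> bchars B" "u (x \<sqinter> bcompl y)"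
    using bchar_exists[of "x \<sqinter> bcompl y"] assms by auto
  with assms show False by auto
qed

text \<open>This covers the one-element algebra too: it has no characters, and the conclusion holds
  because there is only one element.\<close>

lemma bchar_eqI:
  assumes "x \<in> carrier B" "y \<in> carrier B" "\<And>u. u \<in> bchars B \<Longrightarrow> u x \<longleftrightarrow> u y"
  shows "x = y"
proof -
  have "x \<sqinter> y = x" "y \<sqinter> x = y" using bchar_le[of x y] bchar_le[of y x] assms by blast+
  then show ?thesis using lattice_laws(1)[OF assms(1,2)] by simp
qed

section \<open>Finite joins and meets at the points\<close>

lemma leq_iff_bchar:
  assumes "x \<in> carrier B" "y \<in> carrier B"
  shows "leq bool_sig B x y \<longleftrightarrow> (\<forall>u \<in> bchars B. u x \<longrightarrow> u y)"
proof
  assume l: "leq bool_sig B x y"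
  show "\<forall>u \<in> bchars B. u x \<longrightarrow> u y"
  proof (intro ballI impI)
    fix u assume u: "u \<in> bchars B" "u x"
    then have "u (x \<sqinter> y)" using l by (simp add: leq_def)
    then show "u y" using u assms by auto
  qed
qed (use bchar_le[OF assms] in \<open>auto simp: leq_def\<close>)

text \<open>Since the order is determined by characters, an element true at exactly those characters
  that are true somewhere on X is a least upper bound. For infinite X a supremum may fail this
  condition; for finite X such a z always exists, by iterated binary joins.\<close>

lemma Join_eqI:
  assumes X: "X \<subseteq> carrier B" and z: "z \<in> carrier B"
    and u: "\<And>u. u \<in> bchars B \<Longrightarrow> u z \<longleftrightarrow> (\<exists>x \<in> X. u x)"
  shows "Join bool_sig B X = z"
  unfolding Join_def
proof (rule the_equality)
  let ?lub = "\<lambda>z. z \<in> carrier B \<and> (\<forall>x \<in> X. leq bool_sig B x z) \<and>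
    (\<forall>w \<in> carrier B. (\<forall>x \<in> X. leq bool_sig B x w) \<longrightarrow> leq bool_sig B z w)"
  have leq: "leq bool_sig B x y \<longleftrightarrow> (\<forall>u \<in> bchars B. u x \<longrightarrow> u y)"
    if "x \<in> carrier B" "y \<in> carrier B" for x y using leq_iff_bchar that .
  show l: "?lub z"
  proof (intro conjI ballI impI z)
    fix x assume x: "x \<in> X"
    then have "x \<in> carrier B" using X by blast
    then show "leq bool_sig B x z" using leq[of x z] z u x by auto
  next
    fix w assume w: "w \<in> carrier B" "\<forall>x \<in> X. leq bool_sig B x w"
    have "u w" if v: "u \<in> bchars B" "u z" for u
    proof -
      obtain x where x: "x \<in> X" "u x" using u v by auto
      then have "x \<in> carrier B" using X by blast
      then show ?thesis using leq[of x w] w x v by auto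
    qed
    then show "leq bool_sig B z w" unfolding leq[OF z w(1)] by blast
  qed
  fix z' assume l': "?lub z'"
  have "leq bool_sig B z z'" "leq bool_sig B z' z" using l l' by blast+
  then show "z' = z" using l l' lattice_laws(1)[of z z'] by (auto simp: leq_def)
qed

lemma Join_finite:
  assumes "finite X" "X \<subseteq> carrier B"
  shows "Join bool_sig B X \<in> carrier B"
    and "\<And>u. u \<in> bchars B \<Longrightarrow> u (Join bool_sig B X) \<longleftrightarrow> (\<exists>x \<in> X. u x)"
proof -
  have "\<exists>z \<in> carrier B. \<forall>u \<in> bchars B. u z \<longleftrightarrow> (\<exists>x \<in> X. u x)"
    using assms
  proof (induction X rule: finite_induct)
    case empty
    show ?case by (intro bexI[of _ bzero]) auto
  next
    case (insert x X)
    then obtain z where "z \<in> carrier B" "\<forall>u \<in> bchars B. u z \<longleftrightarrow> (\<exists>x \<in> X. u x)" by auto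
    then show ?case using insert by (intro bexI[of _ "x \<squnion> z"]) auto
  qed
  then obtain z where z: "z \<in> carrier B" "\<forall>u \<in> bchars B. u z \<longleftrightarrow> (\<exists>x \<in> X. u x)" by auto
  with Join_eqI[OF assms(2) z(1)] have "Join bool_sig B X = z" by blast
  with z show "Join bool_sig B X \<in> carrier B"
    "\<And>u. u \<in> bchars B \<Longrightarrow> u (Join bool_sig B X) \<longleftrightarrow> (\<exists>x \<in> X. u x)" by auto
qed

lemma foldr_meet:
  assumes "set xs \<subseteq> carrier B"
  shows "foldr (meet bool_sig B) xs bone \<in> carrier B"
    and "\<And>u. u \<in> bchars B \<Longrightarrow> u (foldr (meet bool_sig B) xs bone) \<longleftrightarrow> (\<forall>x \<in> set xs. u x)"
  using assms by (induction xs) auto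

end

text \<open>The Stone dual of h: points of C are sent to points of B.\<close>

lemma bchars_comp:
  assumes "h \<in> homs bool_sig B C" "u \<in> bchars C"
  shows "(\<lambda>x. u (h x)) \<in> bchars B"
proof -
  have "h (one bool_sig B) = one bool_sig C"
    using homs_oper[OF assms(1), of "[]" BOne] by (simp add: one_def args_def bool_sig_def)
  moreover have "h (meet bool_sig B x y) = meet bool_sig C (h x) (h y)"
    "h (oper B BCompl [x]) = oper C BCompl [h x]" if "x \<in> carrier B" "y \<in> carrier B" for x y
    using that homs_oper[OF assms(1), of "[x, y]" BMeet] homs_oper[OF assms(1), of "[x]" BCompl]
    by (simp_all add: meet_def args_def bool_sig_def)
  ultimately show ?thesis
    using assms(2) homs_mem[OF assms(1)] unfolding bchars_def by auto
qed

text \<open>Converse to \<open>bchars_comp\<close>. Characters of C separate points and compute all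
  five operations, so pulling characters back to characters already forces h to preserve joins and
  bounds as well.\<close>

lemma bool_homsI:
  assumes B: "B \<in> boolean_algebras" and C: "C \<in> boolean_algebras"
    and mem: "\<And>x. x \<in> carrier B \<Longrightarrow> h x \<in> carrier C"
    and u: "\<And>u. u \<in> bchars C \<Longrightarrow> (\<lambda>x. u (h x)) \<in> bchars B"
  shows "restrict h (carrier B) \<in> homs bool_sig B C"
proof (rule homs_restrictI[OF mem])
  interpret B: boolean_alg B by unfold_locales (rule B)
  interpret C: boolean_alg C by unfold_locales (rule C)
  show "is_algebra bool_sig B" by (rule B.is_algebra)
  fix f xs assume xs: "xs \<in> args bool_sig (carrier B) f"
  then have hxs: "map h xs \<in> args bool_sig (carrier C) f"
    using map_args[of "carrier B" h "carrier C" xs bool_sig f] mem by blast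
  show "h (oper B f xs) = oper C f (map h xs)"
  proof (rule C.bchar_eqI)
    fix u assume v: "u \<in> bchars C"
    note w = u[OF v]
    consider x y where "f = BMeet" "xs = [x, y]" "x \<in> carrier B" "y \<in> carrier B"
      | x y where "f = BJoin" "xs = [x, y]" "x \<in> carrier B" "y \<in> carrier B"
      | x where "f = BCompl" "xs = [x]" "x \<in> carrier B" | "f = BZero" "xs = []" | "f = BOne" "xs = []"
      using xs by (cases f) (auto simp: args_def bool_sig_def length_Suc_conv numeral_2_eq_2)
    then show "u (h (oper B f xs)) \<longleftrightarrow> u (oper C f (map h xs))"
    proof cases
      case 1
      then show ?thesis using B.bchar_simps(3)[OF w] C.bchar_simps(3)[OF v] mem
        by (auto simp: meet_def bool_sig_def)
    next
      case 2
      then show ?thesis using B.bchar_simps(4)[OF w] C.bchar_simps(4)[OF v] mem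
        by (auto simp: join_def bool_sig_def)
    next
      case 3
      then show ?thesis using B.bchar_simps(5)[OF w] C.bchar_simps(5)[OF v] mem by auto
    next
      case 4
      then show ?thesis using B.bchar_simps(2)[OF w] C.bchar_simps(2)[OF v]
        by (auto simp: zero_def bool_sig_def)
    next
      case 5
      then show ?thesis using B.bchar_simps(1)[OF w] C.bchar_simps(1)[OF v]
        by (auto simp: one_def bool_sig_def)
    qed
  qed (use mem is_algebra_oper[OF B.is_algebra xs] is_algebra_oper[OF C.is_algebra hxs] in auto)
qed

section \<open>Boolean powers\<close>

lemma finite_args: "finite X \<Longrightarrow> finite (args sig X f)"
  unfolding args_def by (rule finite_subset[OF _ finite_lists_length_eq[of X "arity sig f"]]) auto

locale bool_power = boolean_alg B
  for B :: "(bool_op, ('l, 'u) univ) algebra" +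
  fixes sig :: "'f lat_signature" and M :: "('f, 'l) algebra"
  assumes fin: "finite (carrier M)" and alg: "is_algebra sig M"
begin

abbreviation BP where "BP \<equiv> boolean_power sig M B"
abbreviation P where "P \<equiv> power_ob sig M B"

text \<open>At a character, pairwise disjointness says that at most one \<xi>(l) is true, and join 1
  says that at least one is. Since characters separate points, both translations are
  equivalences.\<close>

lemma BP_mem:
  "\<xi> \<in> carrier BP \<longleftrightarrow> \<xi> \<in> carrier M \<rightarrow>\<^sub>E carrier B \<and>
     (\<forall>u \<in> bchars B. \<exists>!l. l \<in> carrier M \<and> u (\<xi> l))"
proof (cases "\<xi> \<in> carrier M \<rightarrow>\<^sub>E carrier B")
  case True
  then have \<xi>B: "\<xi> l \<in> carrier B" if "l \<in> carrier M" for l using that by auto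
  have fX: "finite (\<xi> ` carrier M)" "\<xi> ` carrier M \<subseteq> carrier B" using fin \<xi>B by auto
  have BP: "\<xi> \<in> carrier BP \<longleftrightarrow>
      (\<forall>l \<in> carrier M. \<forall>l' \<in> carrier M. l \<noteq> l' \<longrightarrow> meet bool_sig B (\<xi> l) (\<xi> l') = bzero) \<and>
      Join bool_sig B (\<xi> ` carrier M) = bone"
    using True by (simp add: boolean_power_def)
  show ?thesis
  proof (intro iffI conjI ballI True)
    fix u assume "\<xi> \<in> carrier BP" and u: "u \<in> bchars B"
    then have disj: "\<forall>l \<in> carrier M. \<forall>l' \<in> carrier M. l \<noteq> l' \<longrightarrow> meet bool_sig B (\<xi> l) (\<xi> l') = bzero"
      and J: "Join bool_sig B (\<xi> ` carrier M) = bone" unfolding BP by blast+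
    obtain l where l: "l \<in> carrier M" "u (\<xi> l)"
      using Join_finite(2)[OF fX u] bchar_simps(1)[OF u] unfolding J by auto
    show "\<exists>!l. l \<in> carrier M \<and> u (\<xi> l)"
    proof (rule ex1I)
      show "l \<in> carrier M \<and> u (\<xi> l)" using l by simp
      fix l' assume l': "l' \<in> carrier M \<and> u (\<xi> l')"
      then have "u (meet bool_sig B (\<xi> l') (\<xi> l))"
        using bchar_simps(3)[OF u \<xi>B \<xi>B] l by simp
      then show "l' = l" using disj l l' bchar_simps(2)[OF u] by metis
    qed
  next
    assume *: "\<xi> \<in> carrier M \<rightarrow>\<^sub>E carrier B \<and> (\<forall>u \<in> bchars B. \<exists>!l. l \<in> carrier M \<and> u (\<xi> l))"
    have ex1: "\<exists>!l. l \<in> carrier M \<and> u (\<xi> l)" if "u \<in> bchars B" for u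
      by (rule bspec[OF conjunct2[OF *] that])
    have "meet bool_sig B (\<xi> l) (\<xi> l') = bzero"
      if l: "l \<in> carrier M" "l' \<in> carrier M" "l \<noteq> l'" for l l'
    proof (rule bchar_eqI)
      fix u assume u: "u \<in> bchars B"
      show "u (meet bool_sig B (\<xi> l) (\<xi> l')) \<longleftrightarrow> u bzero"
        using ex1[OF u] l bchar_simps(2)[OF u] bchar_simps(3)[OF u \<xi>B[OF l(1)] \<xi>B[OF l(2)]] by blast
    qed (use \<xi>B l in auto)
    moreover have "Join bool_sig B (\<xi> ` carrier M) = bone"
    proof (rule bchar_eqI)
      fix u assume u: "u \<in> bchars B"
      show "u (Join bool_sig B (\<xi> ` carrier M)) \<longleftrightarrow> u bone"
        using ex1[OF u] bchar_simps(1)[OF u] Join_finite(2)[OF fX u] by blast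
    qed (use Join_finite(1)[OF fX] in auto)
    ultimately show "\<xi> \<in> carrier BP" unfolding BP by blast
  qed
qed (simp add: boolean_power_def)

definition ev :: "(('l, 'u) univ \<Rightarrow> bool) \<Rightarrow> ('l \<Rightarrow> ('l, 'u) univ) \<Rightarrow> 'l" where
  "ev u \<xi> = (THE l. l \<in> carrier M \<and> u (\<xi> l))"

lemma ev:
  assumes "\<xi> \<in> carrier BP" "u \<in> bchars B"
  shows "ev u \<xi> \<in> carrier M" "l \<in> carrier M \<Longrightarrow> u (\<xi> l) \<longleftrightarrow> ev u \<xi> = l"
proof -
  have ex1: "\<exists>!l. l \<in> carrier M \<and> u (\<xi> l)" using assms BP_mem by blast
  from theI'[OF this] have *: "ev u \<xi> \<in> carrier M \<and> u (\<xi> (ev u \<xi>))" by (simp add: ev_def)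
  then show "ev u \<xi> \<in> carrier M" by simp
  show "u (\<xi> l) \<longleftrightarrow> ev u \<xi> = l" if "l \<in> carrier M" using that * ex1 by blast
qed

lemma BP_fun: "\<xi> \<in> carrier BP \<Longrightarrow> l \<in> carrier M \<Longrightarrow> \<xi> l \<in> carrier B"
  using BP_mem by auto

lemma BP_eqI:
  assumes "\<xi> \<in> carrier BP" "\<zeta> \<in> carrier BP" "\<And>u. u \<in> bchars B \<Longrightarrow> ev u \<xi> = ev u \<zeta>"
  shows "\<xi> = \<zeta>"
proof (rule PiE_ext)
  show "\<xi> \<in> carrier M \<rightarrow>\<^sub>E carrier B" "\<zeta> \<in> carrier M \<rightarrow>\<^sub>E carrier B" using assms BP_mem by auto
  show "\<xi> l = \<zeta> l" if l: "l \<in> carrier M" for l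
  proof (rule bchar_eqI)
    fix u assume u: "u \<in> bchars B"
    show "u (\<xi> l) \<longleftrightarrow> u (\<zeta> l)"
      using ev(2)[OF assms(1) u l] ev(2)[OF assms(2) u l] assms(3)[OF u] by simp
  qed (use assms BP_fun[OF _ l] in auto)
qed

text \<open>The term of the defining join that belongs to \<open>ls\<close> is true at u for a
  single tuple only, namely that of the values picked by u.\<close>

lemma bchar_map2:
  assumes "u \<in> bchars B" "length \<xi>s = length ls" "set \<xi>s \<subseteq> carrier BP" "set ls \<subseteq> carrier M"
  shows "(\<forall>x \<in> set (map2 (\<lambda>\<xi> k. \<xi> k) \<xi>s ls). u x) \<longleftrightarrow> ls = map (ev u) \<xi>s"
  using assms(2-) by (induction \<xi>s ls rule: list_induct2) (auto simp: ev(2)[OF _ assms(1)])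

text \<open>Finiteness of S makes the join range over finitely many tuples, so u passes inside; by
  \<open>bchar_map2\<close> only the tuple of values picked by u can contribute.\<close>

lemma oper_BP:
  assumes \<xi>s: "\<xi>s \<in> args sig (carrier BP) f" and l: "l \<in> carrier M"
  shows "oper BP f \<xi>s l \<in> carrier B"
    and "\<And>u. u \<in> bchars B \<Longrightarrow> u (oper BP f \<xi>s l) \<longleftrightarrow> oper M f (map (ev u) \<xi>s) = l"
proof -
  define g where "g ls = foldr (meet bool_sig B) (map2 (\<lambda>\<xi> k. \<xi> k) \<xi>s ls) bone" for ls
  define X where "X = g ` {ls \<in> args sig (carrier M) f. oper M f ls = l}"
  have opX: "oper BP f \<xi>s l = Join bool_sig B X"
    using l by (simp add: boolean_power_def X_def g_def setcompr_eq_image)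
  have sub: "set (map2 (\<lambda>\<xi> k. \<xi> k) \<xi>s ls) \<subseteq> carrier B" if "ls \<in> args sig (carrier M) f" for ls
  proof -
    have "\<xi> k \<in> carrier B" if "(\<xi>, k) \<in> set (zip \<xi>s ls)" for \<xi> k
    proof (rule BP_fun)
      show "\<xi> \<in> carrier BP" using set_zip_leftD[OF that] \<xi>s by (auto simp: args_def)
      show "k \<in> carrier M" using set_zip_rightD[OF that] \<open>ls \<in> _\<close> by (auto simp: args_def)
    qed
    then show ?thesis by auto
  qed
  have fX: "finite X" "X \<subseteq> carrier B"
    using finite_args[OF fin, of sig f] foldr_meet(1)[OF sub] by (auto simp: X_def g_def)
  show "oper BP f \<xi>s l \<in> carrier B"
    using Join_finite(1)[OF fX] opX by simp
  fix u assume u: "u \<in> bchars B"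
  have ug: "u (g ls) \<longleftrightarrow> ls = map (ev u) \<xi>s" if ls: "ls \<in> args sig (carrier M) f" for ls
    unfolding g_def foldr_meet(2)[OF sub[OF ls] u]
    using bchar_map2[OF u, of \<xi>s ls] \<xi>s ls by (simp add: args_def)
  have ma: "map (ev u) \<xi>s \<in> args sig (carrier M) f"
    using map_args[of "carrier BP" "ev u" "carrier M" \<xi>s sig f] ev(1)[OF _ u] \<xi>s by blast
  have "u (oper BP f \<xi>s l) \<longleftrightarrow> (\<exists>x \<in> X. u x)"
    unfolding opX by (rule Join_finite(2)[OF fX u])
  also have "\<dots> \<longleftrightarrow> (\<exists>ls \<in> args sig (carrier M) f. oper M f ls = l \<and> u (g ls))"
    by (auto simp: X_def)
  also have "\<dots> \<longleftrightarrow> (\<exists>ls \<in> args sig (carrier M) f. oper M f ls = l \<and> ls = map (ev u) \<xi>s)"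
    using ug by blast
  also have "\<dots> \<longleftrightarrow> oper M f (map (ev u) \<xi>s) = l"
    using ma by blast
  finally show "u (oper BP f \<xi>s l) \<longleftrightarrow> oper M f (map (ev u) \<xi>s) = l" .
qed

lemma oper_BP_ev:
  assumes \<xi>s: "\<xi>s \<in> args sig (carrier BP) f"
  shows "oper BP f \<xi>s \<in> carrier BP"
    and "\<And>u. u \<in> bchars B \<Longrightarrow> ev u (oper BP f \<xi>s) = oper M f (map (ev u) \<xi>s)"
proof -
  have mem: "oper M f (map (ev u) \<xi>s) \<in> carrier M" if u: "u \<in> bchars B" for u
    using map_args[of "carrier BP" "ev u" "carrier M" \<xi>s sig f] ev(1)[OF _ u] \<xi>s
    by (intro is_algebra_oper[OF alg]) blast
  have "oper BP f \<xi>s \<in> extensional (carrier M)" by (simp add: boolean_power_def)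
  then have "oper BP f \<xi>s \<in> carrier M \<rightarrow>\<^sub>E carrier B"
    using oper_BP(1)[OF \<xi>s] by (auto simp: PiE_def)
  moreover have "\<exists>!l. l \<in> carrier M \<and> u (oper BP f \<xi>s l)" if u: "u \<in> bchars B" for u
    using oper_BP(2)[OF \<xi>s _ u] mem[OF u] by (intro ex1I[of _ "oper M f (map (ev u) \<xi>s)"]) auto
  ultimately show c: "oper BP f \<xi>s \<in> carrier BP" unfolding BP_mem by blast
  show "ev u (oper BP f \<xi>s) = oper M f (map (ev u) \<xi>s)" if u: "u \<in> bchars B" for u
    using ev(2)[OF c u mem[OF u]] oper_BP(2)[OF \<xi>s mem[OF u] u] by blast
qed

section \<open>The copy of the Boolean power inside the universe of elements\<close>

lemma carrier_P: "carrier P = Tuple ` carrier BP"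
  by (simp add: power_ob_def transport_def)

lemma inj_Tuple: "inj_on Tuple X"
  by (rule inj_onI) simp

lemma untuple_P: "x \<in> carrier P \<Longrightarrow> untuple x \<in> carrier BP \<and> Tuple (untuple x) = x"
  by (auto simp: carrier_P)

lemma P_I: "\<xi> \<in> carrier BP \<Longrightarrow> Tuple \<xi> \<in> carrier P"
  by (simp add: carrier_P)

lemma oper_P:
  assumes "xs \<in> args sig (carrier P) f"
  shows "oper P f xs = Tuple (oper BP f (map untuple xs))"
proof -
  have *: "map (the_inv_into (carrier BP) Tuple) xs = map untuple xs"
    using assms by (auto simp: args_def carrier_P subset_iff image_iff the_inv_into_f_f[OF inj_Tuple])
  show ?thesis by (simp only: power_ob_def transport_def algebra.simps *)
qed

definition evP :: "(('l, 'u) univ \<Rightarrow> bool) \<Rightarrow> ('l, 'u) univ \<Rightarrow> 'l" where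
  "evP u x = ev u (untuple x)"

lemma evP:
  assumes "x \<in> carrier P" "u \<in> bchars B"
  shows "evP u x \<in> carrier M" "l \<in> carrier M \<Longrightarrow> u (untuple x l) \<longleftrightarrow> evP u x = l"
  using ev[of "untuple x" u] untuple_P[OF assms(1)] assms(2) by (auto simp: evP_def)

lemma P_eqI:
  assumes "x \<in> carrier P" "y \<in> carrier P" "\<And>u. u \<in> bchars B \<Longrightarrow> evP u x = evP u y"
  shows "x = y"
  using BP_eqI[of "untuple x" "untuple y"] untuple_P assms unfolding evP_def by metis

lemma is_algebra_P: "is_algebra sig P"
  and evP_hom: "u \<in> bchars B \<Longrightarrow> restrict (evP u) (carrier P) \<in> homs sig P M"
proof -
  have a: "map untuple xs \<in> args sig (carrier BP) f" if "xs \<in> args sig (carrier P) f" for xs f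
    using map_args[of "carrier P" untuple "carrier BP" xs sig f] untuple_P that by blast
  show alg: "is_algebra sig P"
    unfolding is_algebra_def using oper_P oper_BP_ev(1)[OF a] P_I by simp
  assume u: "u \<in> bchars B"
  show "restrict (evP u) (carrier P) \<in> homs sig P M"
  proof (rule homs_restrictI)
    fix f xs assume xs: "xs \<in> args sig (carrier P) f"
    have "map (ev u) (map untuple xs) = map (evP u) xs" by (simp add: evP_def)
    then show "evP u (oper P f xs) = oper M f (map (evP u) xs)"
      using oper_BP_ev(2)[OF a[OF xs] u] oper_P[OF xs] by (simp only: evP_def univ.sel)
  qed (use alg evP u in auto)
qed

lemma P_HSP: "P \<in> HSP sig M"
proof (rule separated_imp_HSP[OF is_algebra_P])
  fix x y assume x: "x \<in> carrier P" and y: "y \<in> carrier P"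
    and eq: "\<And>h. h \<in> homs sig P M \<Longrightarrow> h x = h y"
  show "x = y"
    by (rule P_eqI[OF x y]) (use eq[OF evP_hom] x y in auto)
qed

end

text \<open>Evaluating the image of x at a character u of C is evaluating x at the pulled back
  character u \<circ> h of B. Both evaluations are homomorphisms into M, so preservation of
  operations is checked in M, one character at a time.\<close>

lemma power_hom:
  fixes B C :: "(bool_op, ('l, 'u) univ) algebra" and M :: "('f, 'l) algebra"
  assumes B: "B \<in> boolean_algebras" and C: "C \<in> boolean_algebras"
    and M: "finite (carrier M)" "is_algebra sig M"
    and h: "h \<in> homs bool_sig B C"
  shows "(\<lambda>x\<in>carrier (power_ob sig M B). Tuple (compose (carrier M) h (untuple x)))
    \<in> homs sig (power_ob sig M B) (power_ob sig M C)"
proof -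
  interpret B: bool_power B sig M by unfold_locales (use assms in auto)
  interpret C: bool_power C sig M by unfold_locales (use assms in auto)
  define k where "k x = Tuple (compose (carrier M) h (untuple x))" for x
  have k: "k x \<in> carrier C.P" and evk: "u \<in> bchars C \<Longrightarrow> C.evP u (k x) = B.evP (\<lambda>x. u (h x)) x"
    if x: "x \<in> carrier B.P" for x u
  proof -
    have c: "compose (carrier M) h (untuple x) \<in> carrier C.BP"
      unfolding C.BP_mem
    proof (intro conjI ballI)
      have "untuple x \<in> carrier B.BP" using B.untuple_P[OF x] by simp
      then have *: "\<forall>u \<in> bchars B. \<exists>!l. l \<in> carrier M \<and> u (untuple x l)"
        unfolding B.BP_mem by (rule conjunct2)
      show "compose (carrier M) h (untuple x) \<in> carrier M \<rightarrow>\<^sub>E carrier C"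
        using B.untuple_P[OF x] B.BP_fun homs_mem[OF h] by (auto simp: compose_def)
      fix v assume v: "v \<in> bchars C"
      have "\<exists>!l. l \<in> carrier M \<and> v (h (untuple x l))"
        using bspec[OF * bchars_comp[OF h v]] .
      then show "\<exists>!l. l \<in> carrier M \<and> v (compose (carrier M) h (untuple x) l)"
        by (simp add: compose_def cong: conj_cong)
    qed
    then show kx: "k x \<in> carrier C.P" by (simp add: k_def C.P_I)
    assume u: "u \<in> bchars C"
    have l: "B.evP (\<lambda>x. u (h x)) x \<in> carrier M" using B.evP(1)[OF x bchars_comp[OF h u]] .
    have "u (h (untuple x (B.evP (\<lambda>x. u (h x)) x)))"
      using B.evP(2)[OF x bchars_comp[OF h u] l] by simp
    then show "C.evP u (k x) = B.evP (\<lambda>x. u (h x)) x"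
      using C.evP(2)[OF kx u l] l by (simp add: k_def compose_def)
  qed
  have "restrict k (carrier B.P) \<in> homs sig B.P C.P"
  proof (rule homs_restrictI)
    fix f xs assume xs: "xs \<in> args sig (carrier B.P) f"
    note op = is_algebra_oper[OF B.is_algebra_P xs]
    have kxs: "map k xs \<in> args sig (carrier C.P) f"
      using map_args[of "carrier B.P" k "carrier C.P" xs sig f] k xs by blast
    show "k (oper B.P f xs) = oper C.P f (map k xs)"
    proof (rule C.P_eqI)
      fix u assume u: "u \<in> bchars C"
      have e: "map (restrict (C.evP u) (carrier C.P)) (map k xs) =
          map (restrict (B.evP (\<lambda>x. u (h x))) (carrier B.P)) xs"
        using xs evk[OF _ u] k by (auto simp: args_def)
      have "C.evP u (k (oper B.P f xs)) = oper M f (map (restrict (B.evP (\<lambda>x. u (h x))) (carrier B.P)) xs)"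
        using evk[OF op u] homs_oper[OF B.evP_hom[OF bchars_comp[OF h u]] xs] op by simp
      also have "\<dots> = C.evP u (oper C.P f (map k xs))"
        unfolding e[symmetric]
        using homs_oper[OF C.evP_hom[OF u] kxs] is_algebra_oper[OF C.is_algebra_P kxs]
        by (simp del: map_map)
      finally show "C.evP u (k (oper B.P f xs)) = C.evP u (oper C.P f (map k xs))" .
    qed (use k op is_algebra_oper[OF C.is_algebra_P kxs] in auto)
  qed (use k B.is_algebra_P in auto)
  then show ?thesis by (simp add: k_def[abs_def])
qed

lemma fob_power [simp]: "fob (power_functor sig M) = power_ob sig M"
  and far_power: "far (power_functor sig M) m = \<lparr>src = power_ob sig M (src m), tgt = power_ob sig M (tgt m),
    fn = (\<lambda>x\<in>carrier (power_ob sig M (src m)). Tuple (compose (carrier M) (fn m) (untuple x)))\<rparr>"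
  by (simp_all add: power_functor_def)

lemma is_functor_power:
  fixes M :: "('f, 'l) algebra"
  assumes M: "finite (carrier M)" "is_algebra sig M"
  shows "is_functor (BA :: (bool_op, ('l, 'u) univ) alg_category) (variety sig M) (power_functor sig M)"
  unfolding BA_def variety_def
proof (rule is_functor_algI)
  have bp: "bool_power A sig M" if "A \<in> boolean_algebras" for A :: "(bool_op, ('l, 'u) univ) algebra"
    using that M by unfold_locales
  show "is_algebra bool_sig A" if "A \<in> boolean_algebras" for A :: "(bool_op, ('l, 'u) univ) algebra"
    using that by (simp add: boolean_algebras_def is_bounded_lattice_def)
  show "is_algebra sig A" if "A \<in> HSP sig M" for A :: "('f, ('l, 'u) univ) algebra"
    using HSP_is_algebra that .
  show "fob (power_functor sig M) A \<in> HSP sig M" if "A \<in> boolean_algebras"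
    for A :: "(bool_op, ('l, 'u) univ) algebra"
    using bool_power.P_HSP[OF bp[OF that]] by simp
  show "fn (far (power_functor sig M) \<lparr>src = A, tgt = B, fn = h\<rparr>) \<in>
      homs sig (fob (power_functor sig M) A) (fob (power_functor sig M) B)"
    if "A \<in> boolean_algebras" "B \<in> boolean_algebras" "h \<in> homs bool_sig A B"
    for A B :: "(bool_op, ('l, 'u) univ) algebra" and h
    using power_hom[OF that(1,2) M that(3)] by (simp add: far_power)
  show "fn (far (power_functor sig M) \<lparr>src = A, tgt = A, fn = \<lambda>x\<in>carrier A. x\<rparr>) x = x"
    if A: "A \<in> boolean_algebras" and x: "x \<in> carrier (fob (power_functor sig M) A)"
    for A :: "(bool_op, ('l, 'u) univ) algebra" and x
  proof -
    interpret bool_power A sig M by (rule bp[OF A])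
    have "compose (carrier M) (\<lambda>x\<in>carrier A. x) (untuple x) = untuple x"
      using untuple_P[of x] x BP_fun by (auto simp: compose_def BP_mem PiE_def extensional_def intro!: ext)
    then show ?thesis using x untuple_P[of x] by (simp add: far_power)
  qed
  show "fn (far (power_functor sig M) \<lparr>src = A, tgt = C, fn = compose (carrier A) k h\<rparr>) x =
      fn (far (power_functor sig M) \<lparr>src = B, tgt = C, fn = k\<rparr>)
        (fn (far (power_functor sig M) \<lparr>src = A, tgt = B, fn = h\<rparr>) x)"
    if A: "A \<in> boolean_algebras" and B': "B \<in> boolean_algebras" and h: "h \<in> homs bool_sig A B"
      and x: "x \<in> carrier (fob (power_functor sig M) A)"
    for A B C :: "(bool_op, ('l, 'u) univ) algebra" and h k x
  proof -
    interpret bool_power A sig M by (rule bp[OF A])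
    have "compose (carrier M) (compose (carrier A) k h) (untuple x) =
        compose (carrier M) k (compose (carrier M) h (untuple x))"
      using untuple_P[of x] x BP_fun by (auto simp: compose_def)
    then show ?thesis
      using x homs_mem[OF power_hom[OF A B' M h], of x] by (simp add: far_power)
  qed
qed (simp add: far_power)

section \<open>The Boolean skeleton\<close>

lemma interp_cong:
  "is_term sig n t \<Longrightarrow> (\<And>i. i < n \<Longrightarrow> \<rho> i = \<sigma> i) \<Longrightarrow> interp A \<rho> t = interp A \<sigma> t"
proof (induction t)
  case (App f ts)
  then have "map (interp A \<rho>) ts = map (interp A \<sigma>) ts" by auto
  then show ?case by (simp only: interp.simps)
qed simp

locale semi_primal_lattice =
  fixes sig :: "'f lat_signature" and L :: "('f, 'l) algebra" and S :: "'l set"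
  assumes fin_L: "finite (carrier L)"
    and lattice_L: "is_bounded_lattice sig L"
    and nontrivial: "zero sig L \<noteq> one sig L"
    and sp: "semi_primal sig L"
    and sub_S: "subuniverse sig L S"
begin

abbreviation M where "M \<equiv> subalgebra L S"
abbreviation T where "T \<equiv> T_op sig L"
abbreviation oneL where "oneL \<equiv> one sig L"
abbreviation zeroL where "zeroL \<equiv> zero sig L"

lemma arity_simps [simp]:
  "arity sig (meet_sym sig) = 2" "arity sig (join_sym sig) = 2"
  "arity sig (zero_sym sig) = 0" "arity sig (one_sym sig) = 0"
  using lattice_L by (auto simp: is_bounded_lattice_def is_lat_signature_def)

lemma alg_L: "is_algebra sig L"
  using lattice_L by (simp add: is_bounded_lattice_def)

lemma lat_closed:
  assumes "is_algebra sig A"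
  shows "x \<in> carrier A \<Longrightarrow> y \<in> carrier A \<Longrightarrow> meet sig A x y \<in> carrier A"
    "x \<in> carrier A \<Longrightarrow> y \<in> carrier A \<Longrightarrow> join sig A x y \<in> carrier A"
    "zero sig A \<in> carrier A" "one sig A \<in> carrier A"
  unfolding meet_def join_def zero_def one_def
  by (auto intro!: is_algebra_oper[OF assms] simp: args_def)

lemma S_facts: "S \<subseteq> carrier L" "oneL \<in> S" "zeroL \<in> S" "finite S" "is_algebra sig M"
proof -
  show 1: "S \<subseteq> carrier L" using sub_S by (simp add: subuniverse_def)
  show "finite S" using finite_subset[OF 1 fin_L] .
  show "is_algebra sig M" using is_algebra_subalgebra[OF sub_S] .
  show "oneL \<in> S" "zeroL \<in> S"
    unfolding one_def zero_def by (auto intro!: subuniverse_oper[OF sub_S] simp: args_def)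
qed

lemma L_laws:
  assumes "x \<in> carrier L" "y \<in> carrier L"
  shows "meet sig L x y = meet sig L y x" "join sig L x y = join sig L y x"
    "meet sig L x (join sig L x y) = x" "join sig L x (meet sig L x y) = x"
    "z \<in> carrier L \<Longrightarrow> meet sig L x (meet sig L y z) = meet sig L (meet sig L x y) z"
    "z \<in> carrier L \<Longrightarrow> join sig L x (join sig L y z) = join sig L (join sig L x y) z"
  using lattice_L assms unfolding is_bounded_lattice_def by blast+

lemma L_bounds:
  assumes x: "x \<in> carrier L"
  shows "meet sig L x oneL = x" "meet sig L oneL x = x" "join sig L x zeroL = x" "join sig L zeroL x = x"
    "meet sig L x zeroL = zeroL" "meet sig L zeroL x = zeroL"
    "join sig L x oneL = oneL" "join sig L oneL x = oneL"
proof -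
  note c = lat_closed(3,4)[OF alg_L]
  show 1: "meet sig L x oneL = x" and 2: "join sig L x zeroL = x"
    using lattice_L x unfolding is_bounded_lattice_def by blast+
  show 3: "meet sig L oneL x = x" and 4: "join sig L zeroL x = x"
    using L_laws(1)[OF x c(2)] L_laws(2)[OF x c(1)] 1 2 by simp_all
  show 5: "meet sig L zeroL x = zeroL"
    using L_laws(3)[OF c(1) x] 4 by simp
  show 6: "join sig L oneL x = oneL"
    using L_laws(4)[OF c(2) x] 3 by simp
  show "meet sig L x zeroL = zeroL" "join sig L x oneL = oneL"
    using L_laws(1)[OF x c(1)] L_laws(2)[OF x c(2)] 5 6 by simp_all
qed

lemma L_bounds_simps [simp]:
  "oneL \<in> carrier L" "zeroL \<in> carrier L" "zeroL \<noteq> oneL" "oneL \<noteq> zeroL"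
  "meet sig L oneL oneL = oneL" "meet sig L zeroL oneL = zeroL"
  "meet sig L oneL zeroL = zeroL" "meet sig L zeroL zeroL = zeroL"
  "join sig L oneL oneL = oneL" "join sig L zeroL oneL = oneL"
  "join sig L oneL zeroL = oneL" "join sig L zeroL zeroL = zeroL"
  using nontrivial lat_closed(3,4)[OF alg_L] L_bounds by auto

text \<open>The function takes only the values 0 and 1, which are constants of the signature and lie
  in every subuniverse. Hence it preserves subalgebras and semi-primality provides a term.\<close>

lemma T_term:
  "is_term sig 1 (T_term sig L l) \<and>
    (\<forall>x \<in> carrier L. interp L (\<lambda>_. x) (T_term sig L l) = (if x = l then oneL else zeroL))"
  unfolding T_term_def
proof (rule someI_ex)
  define g where "g xs = (if hd xs = l then oneL else zeroL)" for xs
  have "g xs \<in> generated sig L (set xs)" for xs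
  proof -
    have "oneL \<in> Y \<and> zeroL \<in> Y" if "subuniverse sig L Y" for Y
      unfolding one_def zero_def by (auto intro!: subuniverse_oper[OF that] simp: args_def)
    then show ?thesis by (auto simp: generated_def g_def)
  qed
  then obtain t where t: "is_term sig 1 t"
    "\<And>xs. length xs = 1 \<Longrightarrow> set xs \<subseteq> carrier L \<Longrightarrow> interp L (\<lambda>i. xs ! i) t = g xs"
    using sp unfolding semi_primal_def by (metis order_refl)
  have "interp L (\<lambda>_. x) t = (if x = l then oneL else zeroL)" if "x \<in> carrier L" for x
  proof -
    \<comment> \<open>The two valuations need to agree only at index 0, the sole variable of a term
      of arity 1; beyond it \<open>[x] ! i\<close> is unspecified.\<close>
    have "interp L (\<lambda>_. x) t = interp L (\<lambda>i. [x] ! i) t"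
      by (rule interp_cong[OF t(1)]) simp
    then show ?thesis using t(2)[of "[x]"] that by (simp add: g_def)
  qed
  with t(1) show "\<exists>t. is_term sig 1 t \<and>
      (\<forall>x \<in> carrier L. interp L (\<lambda>_. x) t = (if x = l then oneL else zeroL))" by blast
qed

lemma T_L [simp]: "x \<in> carrier L \<Longrightarrow> T l L x = (if x = l then oneL else zeroL)"
  using T_term[of l] by (simp add: T_op_def)

lemma T_M [simp]: "T l M x = T l L x"
  by (simp add: T_op_def)

lemma lat_M [simp]:
  "meet sig M x y = meet sig L x y" "join sig M x y = join sig L x y"
  "one sig M = oneL" "zero sig M = zeroL"
  by (simp_all add: meet_def join_def one_def zero_def)

lemma T_closed: "is_algebra sig A \<Longrightarrow> a \<in> carrier A \<Longrightarrow> T l A a \<in> carrier A"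
  unfolding T_op_def
  using T_term[of l] by (intro interp_closed[OF is_algebra_subuniverse]) auto

lemma hom_T:
  "is_algebra sig A \<Longrightarrow> h \<in> homs sig A B \<Longrightarrow> a \<in> carrier A \<Longrightarrow> h (T l A a) = T l B (h a)"
  unfolding T_op_def using homs_interp[of sig A h B "\<lambda>_. a" 1 "T_term sig L l"] T_term[of l] by simp

lemma hom_lat:
  assumes "h \<in> homs sig A B"
  shows "x \<in> carrier A \<Longrightarrow> y \<in> carrier A \<Longrightarrow> h (meet sig A x y) = meet sig B (h x) (h y)"
    "x \<in> carrier A \<Longrightarrow> y \<in> carrier A \<Longrightarrow> h (join sig A x y) = join sig B (h x) (h y)"
    "h (zero sig A) = zero sig B" "h (one sig A) = one sig B"
  using homs_oper[OF assms, of "[x, y]" "meet_sym sig"] homs_oper[OF assms, of "[x, y]" "join_sym sig"]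
    homs_oper[OF assms, of "[]" "zero_sym sig"] homs_oper[OF assms, of "[]" "one_sym sig"]
  by (simp_all add: args_def meet_def join_def zero_def one_def)

section \<open>Transfer of identities from L to its variety\<close>

abbreviation tT where "tT l s \<equiv> tsub s (T_term sig L l)"
abbreviation tM where "tM s t \<equiv> App (meet_sym sig) [s, t]"
abbreviation tJ where "tJ s t \<equiv> App (join_sym sig) [s, t]"
abbreviation t0 where "t0 \<equiv> App (zero_sym sig) []"
abbreviation t1 where "t1 \<equiv> App (one_sym sig) []"

lemma interp_simps:
  "interp A \<rho> (tT l s) = T l A (interp A \<rho> s)"
  "interp A \<rho> (tM s t) = meet sig A (interp A \<rho> s) (interp A \<rho> t)"
  "interp A \<rho> (tJ s t) = join sig A (interp A \<rho> s) (interp A \<rho> t)"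
  "interp A \<rho> t0 = zero sig A" "interp A \<rho> t1 = one sig A"
  by (simp_all add: interp_tsub T_op_def meet_def join_def zero_def one_def)

lemma is_term_tT: "is_term sig n s \<Longrightarrow> is_term sig n (tT l s)"
  using T_term[of l] is_term_tsub by blast

lemma HSP_law:
  assumes "A \<in> HSP sig L" "is_term sig n s" "is_term sig n t"
    and "\<And>\<rho>. (\<And>i. \<rho> i \<in> carrier L) \<Longrightarrow> interp L \<rho> s = interp L \<rho> t"
    and "\<And>i. \<rho> i \<in> carrier A"
  shows "interp A \<rho> s = interp A \<rho> t"
proof -
  have "satisfies L s t" using assms(4) by (auto simp: satisfies_def)
  from HSP_satisfies[OF assms(1) this assms(2,3)] show ?thesis
    using assms(5) by (auto simp: satisfies_def)
qed

text \<open>Three variables suffice for all lattice and skeleton laws. The valuation is written out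
  so that the simplifier can evaluate it; z also fills every index above 2 to keep the valuation
  inside the carrier.\<close>

lemma HSP_law3:
  assumes "A \<in> HSP sig L" "is_term sig 3 s" "is_term sig 3 t"
    and "\<And>\<rho>. \<rho> 0 \<in> carrier L \<Longrightarrow> \<rho> 1 \<in> carrier L \<Longrightarrow> \<rho> 2 \<in> carrier L \<Longrightarrow> interp L \<rho> s = interp L \<rho> t"
    and "x \<in> carrier A" "y \<in> carrier A" "z \<in> carrier A"
  shows "interp A (\<lambda>i. if i = 0 then x else if i = 1 then y else z) s =
    interp A (\<lambda>i. if i = 0 then x else if i = 1 then y else z) t"
  by (rule HSP_law[OF assms(1-3)]) (use assms in auto)

lemmas law_simps = interp_simps is_term_tT

context
  fixes A :: "('f, 'a) algebra"
  assumes A: "A \<in> HSP sig L"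
begin

lemma A_lattice:
  assumes "x \<in> carrier A" "y \<in> carrier A"
  shows "meet sig A x y = meet sig A y x" "join sig A x y = join sig A y x"
    "meet sig A x (join sig A x y) = x" "join sig A x (meet sig A x y) = x"
    "z \<in> carrier A \<Longrightarrow> meet sig A x (meet sig A y z) = meet sig A (meet sig A x y) z"
    "z \<in> carrier A \<Longrightarrow> join sig A x (join sig A y z) = join sig A (join sig A x y) z"
    "meet sig A x (one sig A) = x" "join sig A x (zero sig A) = x" "meet sig A (one sig A) x = x"
  using HSP_law3[OF A, of "tM (Var 0) (Var 1)" "tM (Var 1) (Var 0)" x y x]
    HSP_law3[OF A, of "tJ (Var 0) (Var 1)" "tJ (Var 1) (Var 0)" x y x]
    HSP_law3[OF A, of "tM (Var 0) (tJ (Var 0) (Var 1))" "Var 0" x y x]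
    HSP_law3[OF A, of "tJ (Var 0) (tM (Var 0) (Var 1))" "Var 0" x y x]
    HSP_law3[OF A, of "tM (Var 0) (tM (Var 1) (Var 2))" "tM (tM (Var 0) (Var 1)) (Var 2)" x y z]
    HSP_law3[OF A, of "tJ (Var 0) (tJ (Var 1) (Var 2))" "tJ (tJ (Var 0) (Var 1)) (Var 2)" x y z]
    HSP_law3[OF A, of "tM (Var 0) t1" "Var 0" x x x] HSP_law3[OF A, of "tJ (Var 0) t0" "Var 0" x x x]
    HSP_law3[OF A, of "tM t1 (Var 0)" "Var 0" x x x]
    assms
  \<comment> \<open>Dropping \<open>interp.simps(2)\<close> keeps applications from being unfolded
    to \<open>oper\<close>, so that \<open>interp_simps\<close> can read them as meet, join and
    T.\<close>
  by (simp_all add: law_simps del: interp.simps(2) add: L_laws(1,2) L_laws(3-6) L_bounds)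

text \<open>In L the values of T_l are 0 and 1, and there T_1 is the identity.\<close>

lemma T_skeleton: "a \<in> carrier A \<Longrightarrow> T oneL A (T l A a) = T l A a"
  using HSP_law3[OF A, of "tT oneL (tT l (Var 0))" "tT l (Var 0)" a a a]
  by (simp add: law_simps del: interp.simps(2))

lemma T_disjoint:
  "a \<in> carrier A \<Longrightarrow> l \<noteq> l' \<Longrightarrow> meet sig A (T l A a) (T l' A a) = zero sig A"
  using HSP_law3[OF A, of "tM (tT l (Var 0)) (tT l' (Var 0))" t0 a a a]
  by (simp add: law_simps del: interp.simps(2))

text \<open>A law restricted to the skeleton becomes an identity when T_1(x) is written for x: in L
  these terms range over 0 and 1 only, and on the skeleton T_1(x) is x again. The next lemmas use
  the same device.\<close>

lemma skeleton_closed: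
  assumes "x \<in> carrier A" "y \<in> carrier A" "T oneL A x = x" "T oneL A y = y"
  shows "T oneL A (meet sig A x y) = meet sig A x y" "T oneL A (join sig A x y) = join sig A x y"
  using HSP_law3[OF A, of "tT oneL (tM (tT oneL (Var 0)) (tT oneL (Var 1)))"
      "tM (tT oneL (Var 0)) (tT oneL (Var 1))" x y x]
    HSP_law3[OF A, of "tT oneL (tJ (tT oneL (Var 0)) (tT oneL (Var 1)))"
      "tJ (tT oneL (Var 0)) (tT oneL (Var 1))" x y x]
    assms
  by (simp_all add: law_simps del: interp.simps(2))

lemma skeleton_bounds: "T oneL A (zero sig A) = zero sig A" "T oneL A (one sig A) = one sig A"
  using HSP_law3[OF A, of "tT oneL t0" t0] HSP_law3[OF A, of "tT oneL t1" t1]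
    lat_closed(4)[OF HSP_is_algebra[OF A]]
  by (simp_all add: law_simps del: interp.simps(2))

text \<open>L itself may fail to be distributive; the terms T_1 confine the verification to the
  two-element chain of bounds.\<close>

lemma skeleton_distrib:
  assumes "x \<in> carrier A" "y \<in> carrier A" "z \<in> carrier A"
    "T oneL A x = x" "T oneL A y = y" "T oneL A z = z"
  shows "meet sig A x (join sig A y z) = join sig A (meet sig A x y) (meet sig A x z)"
  using HSP_law3[OF A, of
      "tM (tT oneL (Var 0)) (tJ (tT oneL (Var 1)) (tT oneL (Var 2)))"
      "tJ (tM (tT oneL (Var 0)) (tT oneL (Var 1))) (tM (tT oneL (Var 0)) (tT oneL (Var 2)))" x y z]
    assms
  by (simp add: law_simps del: interp.simps(2))

lemma skeleton_compl:
  assumes "x \<in> carrier A" "T oneL A x = x"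
  shows "meet sig A x (T zeroL A x) = zero sig A" "join sig A x (T zeroL A x) = one sig A"
  using HSP_law3[OF A, of "tM (tT oneL (Var 0)) (tT zeroL (tT oneL (Var 0)))" t0 x x x]
    HSP_law3[OF A, of "tJ (tT oneL (Var 0)) (tT zeroL (tT oneL (Var 0)))" t1 x x x]
    assms
  by (simp_all add: law_simps del: interp.simps(2))

end

abbreviation Sk where "Sk A \<equiv> skeleton sig L A"

lemma Sk_mem: "x \<in> carrier (Sk A) \<longleftrightarrow> x \<in> carrier A \<and> T oneL A x = x"
  by (simp add: skeleton_def)

lemma Sk_ops:
  "meet bool_sig (Sk A) x y = meet sig A x y" "join bool_sig (Sk A) x y = join sig A x y"
  "zero bool_sig (Sk A) = zero sig A" "one bool_sig (Sk A) = one sig A"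
  "oper (Sk A) BCompl [x] = T zeroL A x"
  by (simp_all add: skeleton_def meet_def join_def zero_def one_def bool_sig_def)

lemma Sk_boolean:
  assumes A: "A \<in> HSP sig L"
  shows "Sk A \<in> boolean_algebras"
proof -
  note alg = HSP_is_algebra[OF A]
  note closed = lat_closed[OF alg] T_closed[OF alg]
  have op: "oper (Sk A) BMeet [x, y] = meet sig A x y" "oper (Sk A) BJoin [x, y] = join sig A x y"
    "oper (Sk A) BZero [] = zero sig A" "oper (Sk A) BOne [] = one sig A" for x y
    by (simp_all add: skeleton_def meet_def join_def zero_def one_def)
  have "oper (Sk A) f xs \<in> carrier (Sk A)" if xs: "xs \<in> args bool_sig (carrier (Sk A)) f" for f xs
  proof -
    consider x y where "f = BMeet" "xs = [x, y]" "x \<in> carrier (Sk A)" "y \<in> carrier (Sk A)"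
      | x y where "f = BJoin" "xs = [x, y]" "x \<in> carrier (Sk A)" "y \<in> carrier (Sk A)"
      | x where "f = BCompl" "xs = [x]" "x \<in> carrier (Sk A)" | "f = BZero" "xs = []" | "f = BOne" "xs = []"
      using xs by (cases f) (auto simp: args_def bool_sig_def length_Suc_conv numeral_2_eq_2)
    then show ?thesis
    proof cases
      case 1
      then show ?thesis
        using skeleton_closed(1)[OF A, of x y] closed(1)[of x y] unfolding op 1 Sk_mem by simp
    next
      case 2
      then show ?thesis
        using skeleton_closed(2)[OF A, of x y] closed(2)[of x y] unfolding op 2 Sk_mem by simp
    next
      case 3
      then show ?thesis
        using T_skeleton[OF A, of x zeroL] closed(5)[of x zeroL] unfolding Sk_ops 3 Sk_mem by simp
    next
      case 4
      then show ?thesis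
        using skeleton_bounds[OF A] closed(3) unfolding op 4 Sk_mem by simp
    next
      case 5
      then show ?thesis
        using skeleton_bounds[OF A] closed(4) unfolding op 5 Sk_mem by simp
    qed
  qed
  then have "is_algebra bool_sig (Sk A)" by (simp add: is_algebra_def)
  moreover have "is_lat_signature bool_sig" by (simp add: is_lat_signature_def bool_sig_def)
  ultimately show ?thesis
    unfolding boolean_algebras_def is_bounded_lattice_def mem_Collect_eq Sk_ops
    by (intro conjI ballI; (unfold Sk_mem)?)
      (auto intro: A_lattice[OF A] skeleton_distrib[OF A] skeleton_compl[OF A])
qed

text \<open>Homomorphisms commute with the terms T_1 and T_0, hence map skeleton to skeleton and
  preserve complements.\<close>

lemma Sk_hom:
  assumes A: "A \<in> HSP sig L" and B: "B \<in> HSP sig L" and h: "h \<in> homs sig A B"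
  shows "restrict h (carrier (Sk A)) \<in> homs bool_sig (Sk A) (Sk B)"
proof (rule bool_homsI[OF Sk_boolean[OF A] Sk_boolean[OF B]])
  note alg = HSP_is_algebra[OF A]
  show mem: "h x \<in> carrier (Sk B)" if "x \<in> carrier (Sk A)" for x
    using that hom_T[OF alg h, of x oneL] homs_mem[OF h] by (simp add: Sk_mem)
  interpret B: boolean_alg "Sk B" by unfold_locales (rule Sk_boolean[OF B])
  fix u assume u: "u \<in> bchars (Sk B)"
  show "(\<lambda>x. u (h x)) \<in> bchars (Sk A)"
    unfolding bchars_def Sk_ops
  proof (intro CollectI conjI ballI)
    show "u (h (one sig A))" using B.bchar_simps(1)[OF u] by (simp add: Sk_ops hom_lat[OF h])
    fix x assume x: "x \<in> carrier (Sk A)"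
    show "u (h (T zeroL A x)) \<longleftrightarrow> \<not> u (h x)"
      using B.bchar_simps(5)[OF u mem[OF x]] x hom_T[OF alg h, of x zeroL] by (simp add: Sk_ops Sk_mem)
    fix y assume y: "y \<in> carrier (Sk A)"
    show "u (h (meet sig A x y)) \<longleftrightarrow> u (h x) \<and> u (h y)"
      using B.bchar_simps(3)[OF u mem[OF x] mem[OF y]] x y hom_lat(1)[OF h, of x y]
      by (simp add: Sk_ops Sk_mem)
  qed
qed

end

section \<open>The adjunction between skeleton and Boolean power\<close>

context semi_primal_lattice
begin

lemma HSP_M: "A \<in> HSP sig M \<Longrightarrow> A \<in> HSP sig L"
  using HSP_subalgebra_subset[OF sub_S] by blast

section \<open>The term \<chi> and the partition of unity given by T\<close>

abbreviation chi where "chi \<equiv> chi_term sig L S"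

text \<open>The enumeration picked by \<open>SOME\<close> is opaque; finiteness of S guarantees that
  it lists exactly the elements of S, and this is all that later proofs take from it.\<close>

lemma chi_list:
  obtains ss where "set ss = S" "chi = foldr (\<lambda>s t. App (join_sym sig) [T_term sig L s, t]) ss t0"
proof
  let ?ss = "SOME ss. set ss = S \<and> distinct ss"
  show "chi = foldr (\<lambda>s t. App (join_sym sig) [T_term sig L s, t]) ?ss t0"
    by (simp add: chi_term_def)
  have "\<exists>ss. set ss = S \<and> distinct ss" using finite_distinct_list[OF S_facts(4)] .
  from someI_ex[OF this] show "set ?ss = S" by blast
qed

lemma interp_join_T:
  "interp A (\<lambda>_. a) (foldr (\<lambda>s t. App (join_sym sig) [T_term sig L s, t]) ss t0) =
    foldr (\<lambda>s. join sig A (T s A a)) ss (zero sig A)"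
  by (induction ss) (simp_all add: zero_def join_def T_op_def)

lemma is_term_chi: "is_term sig 1 chi"
proof -
  obtain ss where "chi = foldr (\<lambda>s t. App (join_sym sig) [T_term sig L s, t]) ss t0"
    by (rule chi_list)
  moreover have "is_term sig 1 (foldr (\<lambda>s t. App (join_sym sig) [T_term sig L s, t]) ss t0)" for ss
    by (induction ss) (simp_all add: T_term[THEN conjunct1, simplified])
  ultimately show ?thesis by simp
qed

lemma chi_L:
  assumes "x \<in> carrier L"
  shows "interp L (\<lambda>_. x) chi = (if x \<in> S then oneL else zeroL)"
proof -
  have "foldr (\<lambda>s. join sig L (T s L x)) ss zeroL = (if x \<in> set ss then oneL else zeroL)" for ss
    using assms by (induction ss) auto
  then show ?thesis by (metis chi_list interp_join_T)
qed

text \<open>\<chi> is constantly 1 on S, and the identity passes to the variety of S. This gives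
  both the join condition for the unit into the Boolean power and the triviality of the quotient on
  that variety.\<close>

lemma chi_HSP_M:
  assumes A: "A \<in> HSP sig M" and a: "a \<in> carrier A"
  shows "interp A (\<lambda>_. a) chi = one sig A"
proof -
  have "satisfies M chi t1"
    unfolding satisfies_def
  proof (intro allI impI)
    fix \<rho> :: "nat \<Rightarrow> 'l" assume "range \<rho> \<subseteq> carrier M"
    then have \<rho>: "\<rho> 0 \<in> S" by auto
    have "interp M \<rho> chi = interp L (\<lambda>_. \<rho> 0) chi"
      using interp_cong[OF is_term_chi, of \<rho> "\<lambda>_. \<rho> 0" L] by simp
    then show "interp M \<rho> chi = interp M \<rho> t1"
      using chi_L[of "\<rho> 0"] \<rho> S_facts(1) by (auto simp: one_def)
  qed
  then have "satisfies A chi t1"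
    by (rule HSP_satisfies[OF A _ is_term_chi]) simp
  then have "interp A (\<lambda>_. a) chi = interp A (\<lambda>_. a) t1"
    using a unfolding satisfies_def by (metis image_subset_iff)
  then show ?thesis by (simp add: one_def)
qed

lemma T_mem_Sk: "A \<in> HSP sig L \<Longrightarrow> a \<in> carrier A \<Longrightarrow> T l A a \<in> carrier (Sk A)"
  by (simp add: Sk_mem T_closed[OF HSP_is_algebra] T_skeleton)

lemma Sk_alg: "A \<in> HSP sig L \<Longrightarrow> boolean_alg (Sk A)"
  using Sk_boolean by (simp add: boolean_alg_def)

text \<open>Existence: the join of the T_s(a) over S is \<chi>(a), which is 1 in the variety of S.
  Uniqueness: distinct T_l(a) are disjoint. By \<open>BP_mem\<close> this is what places l \<mapsto>
  T_l(a) in the Boolean power.\<close>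

lemma T_ex1:
  assumes A: "A \<in> HSP sig M" and a: "a \<in> carrier A" and u: "u \<in> bchars (Sk A)"
  shows "\<exists>!l. l \<in> S \<and> u (T l A a)"
proof -
  note AL = HSP_M[OF A]
  interpret boolean_alg "Sk A" by (rule Sk_alg[OF AL])
  obtain ss where ss: "set ss = S" "chi = foldr (\<lambda>s t. App (join_sym sig) [T_term sig L s, t]) ss t0"
    by (rule chi_list)
  \<comment> \<open>Membership in the skeleton is carried through the induction, because u can be
    split only over joins of skeleton elements.\<close>
  have fold: "foldr (\<lambda>s. join sig A (T s A a)) ks (zero sig A) \<in> carrier (Sk A) \<and>
      (u (foldr (\<lambda>s. join sig A (T s A a)) ks (zero sig A)) \<longleftrightarrow> (\<exists>s \<in> set ks. u (T s A a)))" for ks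
  proof (induction ks)
    case Nil
    show ?case using closed(4) bchar_simps(2)[OF u] by (simp add: Sk_ops)
  next
    case (Cons k ks)
    then show ?case
      using T_mem_Sk[OF AL a, of k] closed(2)[of "T k A a"] bchar_simps(4)[OF u, of "T k A a"]
      by (simp add: Sk_ops)
  qed
  have "foldr (\<lambda>s. join sig A (T s A a)) ss (zero sig A) = one sig A"
    using chi_HSP_M[OF A a] ss(2) interp_join_T[of A a ss] by simp
  then obtain l where l: "l \<in> S" "u (T l A a)"
    using fold[of ss] ss(1) bchar_simps(1)[OF u] by (auto simp: Sk_ops)
  show ?thesis
  proof (rule ex1I)
    show "l \<in> S \<and> u (T l A a)" using l by simp
    fix k assume k: "k \<in> S \<and> u (T k A a)"
    have "u (meet sig A (T k A a) (T l A a))"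
      using bchar_simps(3)[OF u T_mem_Sk[OF AL a] T_mem_Sk[OF AL a], of k l] k l by (simp add: Sk_ops)
    then show "k = l"
      using T_disjoint[OF AL a, of k l] bchar_simps(2)[OF u] unfolding Sk_ops by metis
  qed
qed

text \<open>L satisfies an inequality: the meet of the T_{l_i}(x_i) lies below T_{f(l)}(f(x)).
  Indeed in L the left side is 0 unless x_i = l_i for all i, and then the right side is 1. Written
  as an equation with a meet, it transfers to A, where u is applied to both sides.\<close>

lemma T_oper:
  assumes A: "A \<in> HSP sig L" and as: "as \<in> args sig (carrier A) f" and u: "u \<in> bchars (Sk A)"
    and ls: "length ls = arity sig f" and uT: "\<And>i. i < arity sig f \<Longrightarrow> u (T (ls ! i) A (as ! i))"
  shows "u (T (oper L f ls) A (oper A f as))"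
proof -
  interpret boolean_alg "Sk A" by (rule Sk_alg[OF A])
  define n where "n = arity sig f"
  \<comment> \<open>The left side of the inequality, for an arbitrary list of indices so that
    induction applies. The empty meet 1 takes care of constant symbols.\<close>
  define t where "t js = foldr (\<lambda>i t. tM (tT (ls ! i) (Var i)) t) js t1" for js
  define s where "s = tT (oper L f ls) (App f (map Var [0..<n]))"
  \<comment> \<open>Any element of the carrier would do beyond n; 0 is one that always exists, even
    when f has no arguments.\<close>
  define \<rho> where "\<rho> i = (if i < n then as ! i else zero sig A)" for i
  have \<rho>: "\<rho> i \<in> carrier A" for i
    using as lat_closed(3)[OF HSP_is_algebra[OF A]] by (auto simp: \<rho>_def n_def args_def)
  have "map \<rho> [0..<n] = as"
    using as by (intro nth_equalityI) (auto simp: args_def n_def \<rho>_def)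
  then have s: "interp A \<rho> s = T (oper L f ls) A (oper A f as)"
    by (simp add: s_def interp_tsub T_op_def o_def)
  have tA: "interp A \<rho> (t js) \<in> carrier (Sk A) \<and>
      (u (interp A \<rho> (t js)) \<longleftrightarrow> (\<forall>i \<in> set js. u (T (ls ! i) A (\<rho> i))))" for js
  proof (induction js)
    case Nil
    show ?case using closed(5) bchar_simps(1)[OF u] by (simp add: t_def one_def Sk_ops[unfolded one_def])
  next
    case (Cons k ks)
    have "interp A \<rho> (t (k # ks)) = meet sig A (T (ls ! k) A (\<rho> k)) (interp A \<rho> (t ks))"
      by (simp only: t_def foldr.simps o_def law_simps interp.simps(1))
    then show ?case
      using Cons T_mem_Sk[OF A \<rho>, of "ls ! k" k] closed(1)[of "T (ls ! k) A (\<rho> k)"]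
        bchar_simps(3)[OF u, of "T (ls ! k) A (\<rho> k)"]
      by (simp add: Sk_ops)
  qed
  have tL: "interp L \<sigma> (t js) = (if \<forall>i \<in> set js. \<sigma> i = ls ! i then oneL else zeroL)"
    if \<sigma>: "\<And>i. \<sigma> i \<in> carrier L" for \<sigma> js
  proof (induction js)
    case Nil
    show ?case by (simp add: t_def one_def)
  next
    case (Cons k ks)
    have "interp L \<sigma> (t (k # ks)) = meet sig L (T (ls ! k) L (\<sigma> k)) (interp L \<sigma> (t ks))"
      by (simp only: t_def foldr.simps o_def law_simps interp.simps(1))
    then show ?case using Cons \<sigma> by simp
  qed
  have is_t: "is_term sig n (t js)" if "set js \<subseteq> {..<n}" for js
    using that
  proof (induction js)
    case (Cons k ks)
    then show ?case using is_term_tT[of n "Var k" "ls ! k"] by (simp add: t_def)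
  qed (simp add: t_def)
  have is_s: "is_term sig n s"
    unfolding s_def by (rule is_term_tT) (simp add: n_def)
  have "interp A \<rho> (tM (t [0..<n]) s) = interp A \<rho> (t [0..<n])"
  proof (rule HSP_law[OF A])
    have "set [0..<n] \<subseteq> {..<n}" by auto
    then show "is_term sig n (tM (t [0..<n]) s)" "is_term sig n (t [0..<n])"
      using is_t[of "[0..<n]"] is_s by simp_all
    fix \<sigma> :: "nat \<Rightarrow> 'l" assume \<sigma>: "\<And>i. \<sigma> i \<in> carrier L"
    have op: "oper L f (map \<sigma> [0..<n]) \<in> carrier L"
      using \<sigma> by (intro is_algebra_oper[OF alg_L]) (auto simp: args_def n_def)
    have sL: "interp L \<sigma> s = T (oper L f ls) L (oper L f (map \<sigma> [0..<n]))"
      by (simp add: s_def interp_tsub T_op_def o_def)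
    show "interp L \<sigma> (tM (t [0..<n]) s) = interp L \<sigma> (t [0..<n])"
    proof (cases "\<forall>i \<in> set [0..<n]. \<sigma> i = ls ! i")
      case True
      then have "map \<sigma> [0..<n] = ls"
        using ls by (intro nth_equalityI) (auto simp: n_def)
      then show ?thesis
        using tL[of \<sigma> "[0..<n]", OF \<sigma>] True sL op unfolding interp_simps by simp
    next
      case False
      then have "interp L \<sigma> (t [0..<n]) = zeroL" using tL[of \<sigma> "[0..<n]", OF \<sigma>] by simp
      then show ?thesis using sL op unfolding interp_simps by simp
    qed
  qed (rule \<rho>)
  then have m: "meet sig A (interp A \<rho> (t [0..<n])) (interp A \<rho> s) = interp A \<rho> (t [0..<n])"
    by (simp only: interp_simps)
  have "u (interp A \<rho> (t [0..<n]))"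
    using tA[of "[0..<n]"] uT by (simp add: \<rho>_def n_def)
  moreover have "interp A \<rho> s \<in> carrier (Sk A)"
    unfolding s using as is_algebra_oper[OF HSP_is_algebra[OF A]] by (intro T_mem_Sk[OF A]) auto
  ultimately show ?thesis
    using bchar_simps(3)[OF u, of "interp A \<rho> (t [0..<n])" "interp A \<rho> s"] tA[of "[0..<n]"] m
    unfolding s Sk_ops by simp
qed

section \<open>The unit of the Boolean power adjunction\<close>

definition unit_P :: "('f, ('l, 'u) univ) algebra \<Rightarrow> ('l, 'u) univ \<Rightarrow> ('l, 'u) univ" where
  "unit_P A a = Tuple (\<lambda>l\<in>S. T l A a)"

lemma bool_power_Sk:
  fixes A :: "('f, ('l, 'u) univ) algebra"
  shows "A \<in> HSP sig L \<Longrightarrow> bool_power (Sk A) sig M"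
  using Sk_alg[of A] S_facts by (simp add: bool_power_def bool_power_axioms_def)

lemma unit_P_mem:
  fixes A :: "('f, ('l, 'u) univ) algebra"
  assumes A: "A \<in> HSP sig M" and a: "a \<in> carrier A"
  shows "unit_P A a \<in> carrier (power_ob sig M (Sk A))"
    and "\<And>u l. u \<in> bchars (Sk A) \<Longrightarrow> l \<in> S \<Longrightarrow> bool_power.evP M u (unit_P A a) = l \<longleftrightarrow> u (T l A a)"
proof -
  interpret bool_power "Sk A" sig M by (rule bool_power_Sk[OF HSP_M[OF A]])
  have "(\<lambda>l\<in>S. T l A a) \<in> carrier BP"
    unfolding BP_mem
  proof (intro conjI ballI)
    show "(\<lambda>l\<in>S. T l A a) \<in> carrier M \<rightarrow>\<^sub>E carrier (Sk A)"
      using T_mem_Sk[OF HSP_M[OF A] a] by simp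
    fix u assume u: "u \<in> bchars (Sk A)"
    show "\<exists>!l. l \<in> carrier M \<and> u ((\<lambda>l\<in>S. T l A a) l)"
      using T_ex1[OF A a u] by (simp cong: conj_cong)
  qed
  then show c: "unit_P A a \<in> carrier P" by (simp add: unit_P_def P_I)
  fix u l assume u: "u \<in> bchars (Sk A)" and l: "l \<in> S"
  show "evP u (unit_P A a) = l \<longleftrightarrow> u (T l A a)"
    using evP(2)[OF c u, of l] l by (simp add: unit_P_def)
qed

text \<open>At a character u the claim reads: if u picks l_i for each argument a_i, it picks f(l_1,
  ..., l_k) for the result f(a_1, ..., a_k). This is \<open>T_oper\<close>.\<close>

lemma unit_P_hom:
  fixes A :: "('f, ('l, 'u) univ) algebra"
  assumes A: "A \<in> HSP sig M"
  shows "restrict (unit_P A) (carrier A) \<in> homs sig A (power_ob sig M (Sk A))"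
proof (rule homs_restrictI)
  interpret bool_power "Sk A" sig M by (rule bool_power_Sk[OF HSP_M[OF A]])
  note alg = HSP_is_algebra[OF A]
  note mem = unit_P_mem(1)[OF A]
  fix f as assume as: "as \<in> args sig (carrier A) f"
  note op = is_algebra_oper[OF alg as]
  have map_as: "map (unit_P A) as \<in> args sig (carrier P) f"
    using map_args[of "carrier A" "unit_P A" "carrier P" as sig f] mem as by blast
  show "unit_P A (oper A f as) = oper P f (map (unit_P A) as)"
  proof (rule P_eqI)
    fix u assume u: "u \<in> bchars (Sk A)"
    define ls where "ls = map (evP u) (map (unit_P A) as)"
    have len: "length ls = arity sig f" using as by (simp add: ls_def args_def)
    have lsS: "evP u (unit_P A a) \<in> S" if "a \<in> carrier A" for a
      using evP(1)[OF mem[OF that] u] by simp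
    have "ls \<in> args sig S f"
      using as lsS len by (auto simp: ls_def args_def)
    from subuniverse_oper[OF sub_S this] have opS: "oper L f ls \<in> S" .
    have "u (T (ls ! i) A (as ! i))" if "i < arity sig f" for i
    proof -
      have ai: "as ! i \<in> carrier A" using as that by (auto simp: args_def)
      have "ls ! i = evP u (unit_P A (as ! i))" using as that by (simp add: ls_def args_def)
      then show ?thesis using unit_P_mem(2)[OF A ai u lsS[OF ai]] by simp
    qed
    then have "u (T (oper L f ls) A (oper A f as))"
      by (rule T_oper[OF HSP_M[OF A] as u len])
    then have "evP u (unit_P A (oper A f as)) = oper L f ls"
      using unit_P_mem(2)[OF A op u opS] by simp
    also have "\<dots> = evP u (oper P f (map (unit_P A) as))"
    proof -
      have "map (restrict (evP u) (carrier P)) (map (unit_P A) as) = ls"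
        using as mem by (auto simp: ls_def args_def)
      then show ?thesis
        using homs_oper[OF evP_hom[OF u] map_as] is_algebra_oper[OF is_algebra_P map_as]
        by (simp del: map_map)
    qed
    finally show "evP u (unit_P A (oper A f as)) = evP u (oper P f (map (unit_P A) as))" .
  qed (use mem[OF op] is_algebra_oper[OF is_algebra_P map_as] in auto)
qed (use unit_P_mem(1)[OF A] HSP_is_algebra[OF A] in auto)

section \<open>The counit and the adjunction\<close>

definition counit_P :: "('l, 'u) univ \<Rightarrow> ('l, 'u) univ" where
  "counit_P x = untuple x oneL"

lemma bool_power_B:
  "B \<in> boolean_algebras \<Longrightarrow> bool_power B sig M"
  using S_facts by (simp add: bool_power_def bool_power_axioms_def boolean_alg_def)

lemma evP_T:
  assumes B: "B \<in> boolean_algebras" and u: "u \<in> bchars B" and x: "x \<in> carrier (power_ob sig M B)"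
  shows "bool_power.evP M u (T l (power_ob sig M B) x) =
    (if bool_power.evP M u x = l then oneL else zeroL)"
proof -
  interpret bool_power B sig M by (rule bool_power_B[OF B])
  have "evP u x \<in> carrier L" using evP(1)[OF x u] S_facts(1) by auto
  then show ?thesis
    using hom_T[OF is_algebra_P evP_hom[OF u] x, of l] x T_closed[OF is_algebra_P x, of l] by simp
qed

text \<open>A character u of B is true at x(1) exactly when u picks 1 from x. On the skeleton u can
  pick only 0 or 1, so u after the counit is again a character, and \<open>bool_homsI\<close>
  applies.\<close>

lemma counit_P_hom:
  assumes B: "B \<in> boolean_algebras"
  shows "restrict counit_P (carrier (Sk (power_ob sig M B))) \<in> homs bool_sig (Sk (power_ob sig M B)) B"
proof -
  interpret bool_power B sig M by (rule bool_power_B[OF B])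
  note PL = HSP_M[OF P_HSP]
  have uc: "u (counit_P x) \<longleftrightarrow> evP u x = oneL" if "u \<in> bchars B" "x \<in> carrier P" for u x
    using evP(2)[OF that(2,1), of oneL] S_facts(2) by (simp add: counit_P_def)
  show ?thesis
  proof (rule bool_homsI[OF Sk_boolean[OF PL] B])
    fix x assume "x \<in> carrier (Sk P)"
    then have "untuple x \<in> carrier BP" using untuple_P[of x] by (simp add: Sk_mem)
    then show "counit_P x \<in> carrier B"
      using BP_fun[of "untuple x" oneL] S_facts(2) by (simp add: counit_P_def)
  next
    fix u assume u: "u \<in> bchars B"
    note hom = evP_hom[OF u]
    \<comment> \<open>x is fixed by T_1 and evaluation commutes with T_1, so the picked value is a
      value of T_1 on L.\<close>
    have ev01: "evP u x = oneL \<or> evP u x = zeroL" if "x \<in> carrier (Sk P)" for x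
      using evP_T[OF B u, of x oneL] that by (auto simp: Sk_mem split: if_splits)
    show "(\<lambda>x. u (counit_P x)) \<in> bchars (Sk P)"
      unfolding bchars_def Sk_ops
    proof (intro CollectI conjI ballI)
      note c = lat_closed[OF is_algebra_P]
      show "u (counit_P (one sig P))"
        using hom_lat(4)[OF hom] c(4) uc[OF u c(4)] by simp
      fix x assume x: "x \<in> carrier (Sk P)"
      then have xP: "x \<in> carrier P" by (simp add: Sk_mem)
      show "u (counit_P (T zeroL P x)) \<longleftrightarrow> \<not> u (counit_P x)"
        using uc[OF u xP] uc[OF u T_closed[OF is_algebra_P xP, of zeroL]] evP_T[OF B u xP, of zeroL] ev01[OF x]
        by auto
      fix y assume y: "y \<in> carrier (Sk P)"
      then have yP: "y \<in> carrier P" by (simp add: Sk_mem)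
      have "evP u (meet sig P x y) = meet sig L (evP u x) (evP u y)"
        using hom_lat(1)[OF hom xP yP] xP yP c(1)[OF xP yP] by simp
      then show "u (counit_P (meet sig P x y)) \<longleftrightarrow> u (counit_P x) \<and> u (counit_P y)"
        using uc[OF u xP] uc[OF u yP] uc[OF u c(1)[OF xP yP]] ev01[OF x] ev01[OF y] by auto
    qed
  qed
qed

lemma fob_skeleton [simp]: "fob (skeleton_functor sig L) = skeleton sig L"
  and far_skeleton: "far (skeleton_functor sig L) m = \<lparr>src = Sk (src m), tgt = Sk (tgt m),
    fn = restrict (fn m) (carrier (Sk (src m)))\<rparr>"
  by (simp_all add: skeleton_functor_def)

lemma BA_is_algebra: "B \<in> boolean_algebras \<Longrightarrow> is_algebra bool_sig B"
  by (simp add: boolean_algebras_def is_bounded_lattice_def)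

lemma is_functor_skeleton:
  "is_functor (variety sig M) BA (skeleton_functor sig L)"
  unfolding BA_def variety_def
proof (rule is_functor_algI)
  fix A B C :: "('f, 'a) algebra" and h k x
  show "A \<in> HSP sig M \<Longrightarrow> fob (skeleton_functor sig L) A \<in> boolean_algebras"
    using Sk_boolean[OF HSP_M] by simp
  show "fn (far (skeleton_functor sig L) \<lparr>src = A, tgt = B, fn = h\<rparr>) \<in>
      homs bool_sig (fob (skeleton_functor sig L) A) (fob (skeleton_functor sig L) B)"
    if "A \<in> HSP sig M" "B \<in> HSP sig M" "h \<in> homs sig A B"
    using Sk_hom[OF HSP_M HSP_M] that by (simp add: far_skeleton)
  show "fn (far (skeleton_functor sig L) \<lparr>src = A, tgt = A, fn = \<lambda>x\<in>carrier A. x\<rparr>) x = x"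
    if "x \<in> carrier (fob (skeleton_functor sig L) A)"
    using that by (simp add: far_skeleton Sk_mem)
  show "fn (far (skeleton_functor sig L) \<lparr>src = A, tgt = C, fn = compose (carrier A) k h\<rparr>) x =
      fn (far (skeleton_functor sig L) \<lparr>src = B, tgt = C, fn = k\<rparr>)
        (fn (far (skeleton_functor sig L) \<lparr>src = A, tgt = B, fn = h\<rparr>) x)"
    if "A \<in> HSP sig M" "B \<in> HSP sig M" "h \<in> homs sig A B" "x \<in> carrier (fob (skeleton_functor sig L) A)"
    using that homs_mem[OF Sk_hom[OF HSP_M HSP_M], of A B h x]
    by (simp add: far_skeleton Sk_mem compose_def)
qed (auto simp: far_skeleton HSP_is_algebra BA_is_algebra)

definition eta_P where
  "eta_P A = \<lparr>src = A, tgt = power_ob sig M (Sk A), fn = restrict (unit_P A) (carrier A)\<rparr>"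

definition eps_P where
  "eps_P B = \<lparr>src = Sk (power_ob sig M B), tgt = B,
    fn = restrict counit_P (carrier (Sk (power_ob sig M B)))\<rparr>"

lemma adjunction_P:
  "is_adjunction (variety sig M :: ('f, ('l, 'u) univ) alg_category) BA
    (skeleton_functor sig L) (power_functor sig M) eta_P eps_P"
proof -
  let ?V = "variety sig M :: ('f, ('l, 'u) univ) alg_category"
  let ?B = "BA :: (bool_op, ('l, 'u) univ) alg_category"
  let ?F = "skeleton_functor sig L" and ?G = "power_functor sig M"
  note finM = S_facts(4,5)
  have F: "is_functor ?V ?B ?F" by (rule is_functor_skeleton)
  have G: "is_functor ?B ?V ?G" using finM by (intro is_functor_power) simp_all
  have catV: "is_category ?V" and catB: "is_category ?B" using F by (simp_all add: is_functor_def)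
  have idV: "is_functor ?V ?V id_functor" and idB: "is_functor ?B ?B id_functor"
    using catV catB by (auto simp: is_functor_def is_category_def Hom_def)
  have PH: "power_ob sig M B \<in> HSP sig M" if "B \<in> boolean_algebras"
    for B :: "(bool_op, ('l, 'u) univ) algebra"
    using bool_power.P_HSP[OF bool_power_B[OF that]] .
  have SkP_mem: "x \<in> carrier (Sk (power_ob sig M B)) \<Longrightarrow> x \<in> carrier (power_ob sig M B)" for x B
    by (simp add: Sk_mem)
  have un: "is_nat_trans ?V ?V id_functor (?G \<circ>\<^sub>F ?F) eta_P"
    unfolding variety_def
  proof (rule is_nat_trans_algI[OF idV[unfolded variety_def] is_functor_comp[OF F G, unfolded variety_def]])
    show "src (eta_P A) = fob id_functor A \<and> tgt (eta_P A) = fob (?G \<circ>\<^sub>F ?F) A \<and>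
        fn (eta_P A) \<in> homs sig (fob id_functor A) (fob (?G \<circ>\<^sub>F ?F) A)"
      if "A \<in> Obj (alg_category sig (HSP sig M))" for A :: "('f, ('l, 'u) univ) algebra"
      using unit_P_hom[of A] that by (simp add: eta_P_def)
    fix f :: "('f, ('l, 'u) univ) alg_arrow" and x
    assume f: "f \<in> Arr (alg_category sig (HSP sig M))"
      and x: "x \<in> carrier (fob id_functor (Dom (alg_category sig (HSP sig M)) f))"
    then have A: "src f \<in> HSP sig M" and B: "tgt f \<in> HSP sig M"
      and h: "fn f \<in> homs sig (src f) (tgt f)" and x: "x \<in> carrier (src f)" by auto
    \<comment> \<open>Naturality of the unit is the fact that homomorphisms commute with the terms
      T_l.\<close>
    have "compose S (restrict (fn f) (carrier (Sk (src f)))) (\<lambda>l\<in>S. T l (src f) x) =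
        (\<lambda>l\<in>S. T l (tgt f) (fn f x))"
      using T_mem_Sk[OF HSP_M[OF A] x] hom_T[OF HSP_is_algebra[OF A] h x]
      by (auto simp: compose_def)
    then show "fn (far (?G \<circ>\<^sub>F ?F) f) (fn (eta_P (Dom (alg_category sig (HSP sig M)) f)) x) =
        fn (eta_P (Cod (alg_category sig (HSP sig M)) f)) (fn (far id_functor f) x)"
      using unit_P_mem(1)[OF A x] x homs_mem[OF h x]
      by (simp add: eta_P_def far_power far_skeleton unit_P_def)
  qed
  have co: "is_nat_trans ?B ?B (?F \<circ>\<^sub>F ?G) id_functor eps_P"
    unfolding BA_def
  proof (rule is_nat_trans_algI[OF is_functor_comp[OF G F, unfolded BA_def] idB[unfolded BA_def]])
    show "src (eps_P A) = fob (?F \<circ>\<^sub>F ?G) A \<and> tgt (eps_P A) = fob id_functor A \<and>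
        fn (eps_P A) \<in> homs bool_sig (fob (?F \<circ>\<^sub>F ?G) A) (fob id_functor A)"
      if "A \<in> Obj (alg_category bool_sig boolean_algebras)" for A :: "(bool_op, ('l, 'u) univ) algebra"
      using counit_P_hom[of A] that by (simp add: eps_P_def)
    fix f :: "(bool_op, ('l, 'u) univ) alg_arrow" and x
    assume f: "f \<in> Arr (alg_category bool_sig boolean_algebras)"
      and x: "x \<in> carrier (fob (?F \<circ>\<^sub>F ?G) (Dom (alg_category bool_sig boolean_algebras) f))"
    then have A: "src f \<in> boolean_algebras" and B: "tgt f \<in> boolean_algebras"
      and h: "fn f \<in> homs bool_sig (src f) (tgt f)" and x: "x \<in> carrier (Sk (power_ob sig M (src f)))"
      by auto
    have kh: "(\<lambda>x\<in>carrier (power_ob sig M (src f)). Tuple (compose (carrier M) (fn f) (untuple x)))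
        \<in> homs sig (power_ob sig M (src f)) (power_ob sig M (tgt f))"
      using finM by (intro power_hom[OF A B _ _ h]) simp_all
    from homs_mem[OF Sk_hom[OF HSP_M[OF PH[OF A]] HSP_M[OF PH[OF B]] kh] x] x
    show "fn (far id_functor f) (fn (eps_P (Dom (alg_category bool_sig boolean_algebras) f)) x) =
        fn (eps_P (Cod (alg_category bool_sig boolean_algebras) f)) (fn (far (?F \<circ>\<^sub>F ?G) f) x)"
      using SkP_mem[OF x] S_facts(2)
      by (simp add: eps_P_def far_power far_skeleton counit_P_def compose_def)
  qed
  have tri1: "Comp ?B (eps_P (fob ?F A)) (far ?F (eta_P A)) = Ident ?B (fob ?F A)"
    if A: "A \<in> Obj ?V" for A
  proof -
    have A: "A \<in> HSP sig M" using A by (simp add: variety_def)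
    have "compose (carrier (Sk A)) (restrict counit_P (carrier (Sk (power_ob sig M (Sk A)))))
        (restrict (restrict (unit_P A) (carrier A)) (carrier (Sk A))) = (\<lambda>x\<in>carrier (Sk A). x)"
    proof (rule restrict_ext[unfolded restrict_def, folded compose_def restrict_def] | rule ext)+
      fix x
      show "compose (carrier (Sk A)) (restrict counit_P (carrier (Sk (power_ob sig M (Sk A)))))
        (restrict (restrict (unit_P A) (carrier A)) (carrier (Sk A))) x = (\<lambda>x\<in>carrier (Sk A). x) x"
      proof (cases "x \<in> carrier (Sk A)")
        case True
        \<comment> \<open>The unit is a homomorphism, so x lands in the skeleton of the Boolean
          power and the counit may be applied. The round trip gives T_1(x), which is x on the
          skeleton.\<close>
        note hom = Sk_hom[OF HSP_M[OF A] HSP_M[OF PH[OF Sk_boolean[OF HSP_M[OF A]]]] unit_P_hom[OF A]]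
        have "unit_P A x \<in> carrier (Sk (power_ob sig M (Sk A)))"
          using homs_mem[OF hom True] True by (simp add: Sk_mem)
        then show ?thesis
          using True S_facts(2) by (simp add: compose_def counit_P_def unit_P_def Sk_mem)
      qed (simp add: compose_def)
    qed
    then show ?thesis by (simp add: BA_def far_skeleton eta_P_def eps_P_def)
  qed
  have tri2: "Comp ?V (far ?G (eps_P B)) (eta_P (fob ?G B)) = Ident ?V (fob ?G B)"
    if B: "B \<in> Obj ?B" for B
  proof -
    have B': "B \<in> boolean_algebras" using B by (simp add: BA_def)
    interpret bool_power B sig M by (rule bool_power_B[OF B'])
    note PM = PH[OF B']
    have "Tuple (compose S (restrict counit_P (carrier (Sk P))) (untuple (unit_P P x))) = x"
      if x: "x \<in> carrier P" for x
    proof -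
      note ux = untuple_P[OF x]
      have "compose S (restrict counit_P (carrier (Sk P))) (untuple (unit_P P x)) = untuple x"
      proof
        fix l
        show "compose S (restrict counit_P (carrier (Sk P))) (untuple (unit_P P x)) l = untuple x l"
        proof (cases "l \<in> S")
          case True
          note TP = T_mem_Sk[OF HSP_M[OF PM] x, of l]
          note TP' = SkP_mem[OF TP]
          \<comment> \<open>At a character u, the element T_l(x) evaluates to 1 exactly when x
            evaluates to l, that is, when u is true at the coordinate l of x.\<close>
          have "counit_P (T l P x) = untuple x l"
          proof (rule bchar_eqI)
            show "counit_P (T l P x) \<in> carrier B"
              using homs_mem[OF counit_P_hom[OF B'] TP] TP by simp
            show "untuple x l \<in> carrier B" using BP_fun[of "untuple x" l] ux True by simp
            fix u assume u: "u \<in> bchars B"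
            show "u (counit_P (T l P x)) \<longleftrightarrow> u (untuple x l)"
              using evP(2)[OF TP' u, of oneL] evP(2)[OF x u, of l] evP_T[OF B' u x, of l] S_facts(2) True
              by (simp add: counit_P_def)
          qed
          then show ?thesis using True TP by (simp add: compose_def unit_P_def)
        next
          case False
          have "untuple x \<in> carrier M \<rightarrow>\<^sub>E carrier B" using ux BP_mem by blast
          then show ?thesis using False by (auto simp: compose_def PiE_def extensional_def)
        qed
      qed
      then show ?thesis using ux by simp
    qed
    then have "compose (carrier P) (\<lambda>x\<in>carrier (power_ob sig M (Sk P)).
        Tuple (compose (carrier M) (restrict counit_P (carrier (Sk P))) (untuple x)))
        (restrict (unit_P P) (carrier P)) = (\<lambda>x\<in>carrier P. x)"
      using unit_P_mem(1)[OF PM] by (auto simp: compose_def)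
    then show ?thesis by (simp add: variety_def far_power eta_P_def eps_P_def)
  qed
  show ?thesis
    unfolding is_adjunction_def using F G un co tri1 tri2 by blast
qed

end

section \<open>The quotient adjunction\<close>

lemma congruence_Inter:
  assumes "\<Theta> \<noteq> {}" "\<And>\<theta>. \<theta> \<in> \<Theta> \<Longrightarrow> congruence sig A \<theta>"
  shows "congruence sig A (\<Inter>\<Theta>)"
  unfolding congruence_def
proof (intro conjI allI ballI impI)
  have eq: "equiv (carrier A) \<theta>" if "\<theta> \<in> \<Theta>" for \<theta>
    using assms(2)[OF that] by (simp add: congruence_def)
  show "equiv (carrier A) (\<Inter>\<Theta>)"
  proof (rule equivI)
    show "\<Inter>\<Theta> \<subseteq> carrier A \<times> carrier A"
    proof -
      obtain \<theta> where "\<theta> \<in> \<Theta>" using assms(1) by blast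
      then show ?thesis using eq[of \<theta>] by (auto simp: equiv_def)
    qed
    show "refl_on (carrier A) (\<Inter>\<Theta>)"
      using eq by (auto simp: equiv_def refl_on_def)
    show "sym (\<Inter>\<Theta>)"
      using eq by (auto simp: equiv_def sym_def)
    show "trans (\<Inter>\<Theta>)"
      using eq unfolding equiv_def trans_def by (meson InterE InterI)
  qed
  fix f xs ys assume xs: "xs \<in> args sig (carrier A) f" and ys: "ys \<in> args sig (carrier A) f"
    and l: "list_all2 (\<lambda>x y. (x, y) \<in> \<Inter>\<Theta>) xs ys"
  show "(oper A f xs, oper A f ys) \<in> \<Inter>\<Theta>"
  proof
    fix \<theta> assume \<theta>: "\<theta> \<in> \<Theta>"
    have "list_all2 (\<lambda>x y. (x, y) \<in> \<theta>) xs ys"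
      using l by (rule list_all2_mono) (use \<theta> in auto)
    then show "(oper A f xs, oper A f ys) \<in> \<theta>"
      using assms(2)[OF \<theta>] xs ys unfolding congruence_def by blast
  qed
qed

text \<open>Pulling back the congruence of the codomain yields the competitor that makes the least
  congruence functorial.\<close>

lemma congruence_vimage:
  assumes A: "is_algebra sig A" and h: "h \<in> homs sig A B" and \<theta>: "congruence sig B \<theta>"
  shows "congruence sig A {(x, y) \<in> carrier A \<times> carrier A. (h x, h y) \<in> \<theta>}" (is "congruence sig A ?\<phi>")
  unfolding congruence_def
proof (intro conjI allI ballI impI)
  have eq: "equiv (carrier B) \<theta>" using \<theta> by (simp add: congruence_def)
  note mem = homs_mem[OF h]
  show "equiv (carrier A) ?\<phi>"
  proof (rule equivI)
    show "refl_on (carrier A) ?\<phi>"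
      using eq mem by (auto simp: equiv_def refl_on_def)
    show "sym ?\<phi>" using eq by (auto simp: equiv_def sym_def)
    show "trans ?\<phi>" using eq unfolding equiv_def trans_def by blast
  qed auto
  fix f xs ys assume xs: "xs \<in> args sig (carrier A) f" and ys: "ys \<in> args sig (carrier A) f"
    and l: "list_all2 (\<lambda>x y. (x, y) \<in> ?\<phi>) xs ys"
  have a: "map h zs \<in> args sig (carrier B) f" if "zs \<in> args sig (carrier A) f" for zs
    using map_args[of "carrier A" h "carrier B" zs sig f] mem that by blast
  have "list_all2 (\<lambda>x y. (x, y) \<in> \<theta>) (map h xs) (map h ys)"
    unfolding list_all2_map1 list_all2_map2 using l by (rule list_all2_mono) auto
  then have "(oper B f (map h xs), oper B f (map h ys)) \<in> \<theta>"
    using \<theta> a[OF xs] a[OF ys] unfolding congruence_def by blast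
  then show "(oper A f xs, oper A f ys) \<in> ?\<phi>"
    using homs_oper[OF h xs] homs_oper[OF h ys] is_algebra_oper[OF A xs] is_algebra_oper[OF A ys] by simp
qed

lemma congruence_Id_on: "is_algebra sig A \<Longrightarrow> congruence sig A (Id_on (carrier A))"
proof -
  assume A: "is_algebra sig A"
  have "xs = ys" if "list_all2 (\<lambda>x y. (x, y) \<in> Id_on (carrier A)) xs ys" for xs ys :: "'b list"
    using that by (induction rule: list_all2_induct) auto
  then show ?thesis
    using is_algebra_oper[OF A]
    by (auto simp: congruence_def equiv_def refl_on_def sym_def trans_def)
qed

lemma congruence_full: "is_algebra sig A \<Longrightarrow> congruence sig A (carrier A \<times> carrier A)"
  by (auto simp: congruence_def is_algebra_def equiv_def refl_on_def sym_def trans_def)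

section \<open>Quotients coded by representatives\<close>

locale alg_congruence =
  fixes sig :: "'f lat_signature" and A :: "('f, 'a) algebra" and \<theta> :: "('a \<times> 'a) set"
  assumes alg: "is_algebra sig A" and cong: "congruence sig A \<theta>"
begin

abbreviation Q where "Q \<equiv> transport rep (quotient_algebra A \<theta>)"
abbreviation repr where "repr a \<equiv> rep (\<theta> `` {a})"

lemma equiv: "equiv (carrier A) \<theta>"
  using cong by (simp add: congruence_def)

lemma repr:
  assumes "a \<in> carrier A"
  shows "(a, repr a) \<in> \<theta>" "repr a \<in> carrier A"
proof -
  have "\<exists>x. x \<in> \<theta> `` {a}" using equiv_class_self[OF equiv assms] by blast
  from someI_ex[OF this] show "(a, repr a) \<in> \<theta>" by (simp add: rep_def)
  then show "repr a \<in> carrier A" using equiv by (auto simp: equiv_def)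
qed

lemma repr_eq_iff:
  assumes "a \<in> carrier A" "b \<in> carrier A"
  shows "repr a = repr b \<longleftrightarrow> (a, b) \<in> \<theta>"
proof
  assume "repr a = repr b"
  then have "(a, repr a) \<in> \<theta>" "(b, repr a) \<in> \<theta>" using repr(1)[OF assms(1)] repr(1)[OF assms(2)] by auto
  then show "(a, b) \<in> \<theta>" using equiv unfolding equiv_def by (meson symD transD)
next
  assume "(a, b) \<in> \<theta>"
  then show "repr a = repr b" using equiv_class_eq[OF equiv] by metis
qed

lemma repr_repr: "a \<in> carrier A \<Longrightarrow> repr (repr a) = repr a"
  using repr_eq_iff[of a "repr a"] repr by metis

lemma carrier_Q: "carrier Q = (\<lambda>a. repr a) ` carrier A"
  by (auto simp: transport_def quotient_algebra_def quotient_def)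

lemma Q_repr: "x \<in> carrier Q \<Longrightarrow> x \<in> carrier A \<and> repr x = x"
  unfolding carrier_Q using repr(2) repr_repr by blast

text \<open>Choosing representatives is injective on classes, so decoding an argument to its class
  and choosing again returns the argument. An operation thus acts as in A, followed by one
  renormalisation.\<close>

lemma oper_Q:
  assumes "ys \<in> args sig (carrier Q) f"
  shows "oper Q f ys = repr (oper A f ys)"
proof -
  have "inj_on rep (carrier A // \<theta>)"
  proof (rule inj_onI)
    fix X Y assume "X \<in> carrier A // \<theta>" "Y \<in> carrier A // \<theta>" and r: "rep X = rep Y"
    then obtain a b where ab: "a \<in> carrier A" "X = \<theta> `` {a}" "b \<in> carrier A" "Y = \<theta> `` {b}"
      by (elim quotientE)
    then have "(a, b) \<in> \<theta>" using repr_eq_iff[OF ab(1,3)] r by simp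
    then show "X = Y" using equiv_class_eq[OF equiv] ab by simp
  qed
  moreover have "carrier Q = rep ` (carrier A // \<theta>)"
    by (simp add: transport_def quotient_algebra_def)
  ultimately have "rep (the_inv_into (carrier A // \<theta>) rep y) = y" if "y \<in> carrier Q" for y
    using f_the_inv_into_f that by metis
  then have "map rep (map (the_inv_into (carrier A // \<theta>) rep) ys) = ys"
    using assms by (auto simp: args_def intro!: map_idI)
  then show ?thesis by (simp only: transport_def quotient_algebra_def algebra.simps)
qed

lemma oper_cong_repr:
  assumes "xs \<in> args sig (carrier A) f"
  shows "(oper A f xs, oper A f (map (\<lambda>a. repr a) xs)) \<in> \<theta>"
proof -
  have "list_all2 (\<lambda>x y. (x, y) \<in> \<theta>) xs (map (\<lambda>a. repr a) xs)"
    unfolding list_all2_map2 using assms repr(1) by (auto simp: args_def list_all2_same)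
  moreover have "map (\<lambda>a. repr a) xs \<in> args sig (carrier A) f"
    using map_args[of "carrier A" "\<lambda>a. repr a" "carrier A" xs sig f] repr(2) assms by blast
  ultimately show ?thesis using cong assms unfolding congruence_def by blast
qed

lemma is_algebra_Q: "is_algebra sig Q"
  unfolding is_algebra_def
proof (intro allI ballI)
  fix f ys assume ys: "ys \<in> args sig (carrier Q) f"
  have "ys \<in> args sig (carrier A) f" by (rule args_mono[OF ys]) (use Q_repr in blast)
  then show "oper Q f ys \<in> carrier Q"
    unfolding oper_Q[OF ys] carrier_Q using is_algebra_oper[OF alg] by blast
qed

lemma repr_hom: "(\<lambda>a\<in>carrier A. repr a) \<in> homs sig A Q"
proof (rule homs_restrictI[OF _ _ alg])
  show m: "repr x \<in> carrier Q" if "x \<in> carrier A" for x using that unfolding carrier_Q by blast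
  fix f xs assume xs: "xs \<in> args sig (carrier A) f"
  have a: "map (\<lambda>a. repr a) xs \<in> args sig (carrier Q) f"
    using map_args[of "carrier A" "\<lambda>a. repr a" "carrier Q" xs sig f] m xs by blast
  have "carrier Q \<subseteq> carrier A" using Q_repr by blast
  from repr_eq_iff[OF is_algebra_oper[OF alg xs] is_algebra_oper[OF alg args_mono[OF a this]]]
  show "repr (oper A f xs) = oper Q f (map (\<lambda>a. repr a) xs)"
    using oper_cong_repr[OF xs] oper_Q[OF a] by simp
qed

text \<open>The companion of \<open>repr_hom\<close> for the quotient by classes, the one in which
  \<open>chi_congruence\<close> evaluates \<chi>.\<close>

lemma class_hom: "(\<lambda>a\<in>carrier A. \<theta> `` {a}) \<in> homs sig A (quotient_algebra A \<theta>)"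
proof (rule homs_restrictI[OF _ _ alg])
  show "\<theta> `` {x} \<in> carrier (quotient_algebra A \<theta>)" if "x \<in> carrier A" for x
    using that by (simp add: quotient_algebra_def quotientI)
  fix f xs assume xs: "xs \<in> args sig (carrier A) f"
  show "\<theta> `` {oper A f xs} = oper (quotient_algebra A \<theta>) f (map (\<lambda>a. \<theta> `` {a}) xs)"
    using equiv_class_eq[OF equiv oper_cong_repr[OF xs]] by (simp add: quotient_algebra_def o_def)
qed

end

context semi_primal_lattice
begin

text \<open>The condition on the quotient restated inside A, where its stability under intersections
  is visible.\<close>

definition chi_compatible :: "('f, 'a) algebra \<Rightarrow> ('a \<times> 'a) set \<Rightarrow> bool" where
  "chi_compatible A \<theta> \<longleftrightarrow> congruence sig A \<theta> \<and>
     (\<forall>a \<in> carrier A. (interp A (\<lambda>_. a) chi, one sig A) \<in> \<theta>)"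

lemma satisfies_chi_iff:
  assumes "is_algebra sig A" "congruence sig A \<theta>"
  shows "satisfies (quotient_algebra A \<theta>) chi t1 \<longleftrightarrow>
    (\<forall>a \<in> carrier A. (interp A (\<lambda>_. a) chi, one sig A) \<in> \<theta>)"
proof -
  interpret alg_congruence sig A \<theta> by unfold_locales (use assms in auto)
  let ?Q = "quotient_algebra A \<theta>"
  have chi_mem: "interp A (\<lambda>_. a) chi \<in> carrier A" if "a \<in> carrier A" for a
    using interp_closed[OF is_algebra_subuniverse[OF alg] that is_term_chi] .
  note one_mem = lat_closed(4)[OF alg]
  have chi_Q: "interp ?Q (\<lambda>_. \<theta> `` {a}) chi = \<theta> `` {interp A (\<lambda>_. a) chi}" if "a \<in> carrier A" for a
    using homs_interp[OF alg class_hom that is_term_chi] that chi_mem[OF that] by simp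
  have one_Q: "interp ?Q \<rho> t1 = \<theta> `` {one sig A}" for \<rho>
    using hom_lat(4)[OF class_hom] one_mem by (simp add: one_def)
  have iff: "interp ?Q (\<lambda>_. \<theta> `` {a}) chi = interp ?Q \<rho> t1 \<longleftrightarrow> (interp A (\<lambda>_. a) chi, one sig A) \<in> \<theta>"
    if "a \<in> carrier A" for a \<rho>
    unfolding chi_Q[OF that] one_Q by (rule eq_equiv_class_iff[OF equiv chi_mem[OF that] one_mem])
  have const: "interp ?Q \<rho> chi = interp ?Q (\<lambda>_. \<rho> 0) chi" for \<rho>
    by (rule interp_cong[OF is_term_chi]) simp
  show ?thesis
  proof
    assume *: "satisfies ?Q chi t1"
    show "\<forall>a \<in> carrier A. (interp A (\<lambda>_. a) chi, one sig A) \<in> \<theta>"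
    proof
      fix a assume a: "a \<in> carrier A"
      then have "range (\<lambda>_::nat. \<theta> `` {a}) \<subseteq> carrier ?Q"
        by (auto simp: quotient_algebra_def intro: quotientI)
      with * have "interp ?Q (\<lambda>_. \<theta> `` {a}) chi = interp ?Q (\<lambda>_. \<theta> `` {a}) t1"
        unfolding satisfies_def by blast
      then show "(interp A (\<lambda>_. a) chi, one sig A) \<in> \<theta>" using iff[OF a] by blast
    qed
  next
    assume *: "\<forall>a \<in> carrier A. (interp A (\<lambda>_. a) chi, one sig A) \<in> \<theta>"
    show "satisfies ?Q chi t1"
      unfolding satisfies_def
    proof (intro allI impI)
      fix \<rho> :: "nat \<Rightarrow> 'a set" assume "range \<rho> \<subseteq> carrier ?Q"
      then have "\<rho> 0 \<in> carrier A // \<theta>" by (auto simp: quotient_algebra_def)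
      then obtain a where a: "a \<in> carrier A" "\<rho> 0 = \<theta> `` {a}" by (auto elim: quotientE)
      then show "interp ?Q \<rho> chi = interp ?Q \<rho> t1"
        using iff[OF a(1), of \<rho>] * const[of \<rho>] by simp
    qed
  qed
qed

abbreviation chi_cong where "chi_cong A \<equiv> chi_congruence sig L S A"

text \<open>\<open>LEAST\<close> denotes something meaningful because the intersection of all
  compatible congruences is compatible. The full relation keeps that family from being
  empty.\<close>

lemma chi_cong:
  assumes A: "is_algebra sig A"
  shows "chi_compatible A (chi_cong A)" "\<And>\<theta>. chi_compatible A \<theta> \<Longrightarrow> chi_cong A \<subseteq> \<theta>"
proof -
  define \<Theta> where "\<Theta> = {\<theta>. chi_compatible A \<theta>}"
  have iff: "congruence sig A \<theta> \<and> satisfies (quotient_algebra A \<theta>) chi t1 \<longleftrightarrow> \<theta> \<in> \<Theta>" for \<theta>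
    using satisfies_chi_iff[OF A] by (auto simp: \<Theta>_def chi_compatible_def)
  have "carrier A \<times> carrier A \<in> \<Theta>"
    using congruence_full[OF A] lat_closed(4)[OF A] interp_closed[OF is_algebra_subuniverse[OF A] _ is_term_chi]
    by (simp add: \<Theta>_def chi_compatible_def)
  then have "congruence sig A (\<Inter>\<Theta>)"
    by (intro congruence_Inter) (auto simp: \<Theta>_def chi_compatible_def)
  then have mem: "\<Inter>\<Theta> \<in> \<Theta>" by (auto simp: \<Theta>_def chi_compatible_def)
  have "chi_cong A = \<Inter>\<Theta>"
    unfolding chi_congruence_def iff by (rule Least_equality) (use mem in auto)
  then show "chi_compatible A (chi_cong A)" "\<And>\<theta>. chi_compatible A \<theta> \<Longrightarrow> chi_cong A \<subseteq> \<theta>"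
    using mem by (auto simp: \<Theta>_def)
qed

lemma alg_congruence_chi: "is_algebra sig A \<Longrightarrow> alg_congruence sig A (chi_cong A)"
  using chi_cong(1) by (auto simp: alg_congruence_def chi_compatible_def)

abbreviation Qob where "Qob \<equiv> quotient_ob sig L S"
abbreviation qr where "qr A a \<equiv> rep (chi_cong A `` {a})"

section \<open>The quotient as a functor into the variety of S\<close>

lemma Qob_HSP:
  fixes A :: "('f, 'a) algebra"
  assumes A: "A \<in> HSP sig L"
  shows "Qob A \<in> HSP sig M"
proof -
  note alg = HSP_is_algebra[OF A]
  interpret C: alg_congruence sig A "chi_cong A" by (rule alg_congruence_chi[OF alg])
  have Q: "Qob A = C.Q" by (simp add: quotient_ob_def)
  obtain I :: "('a \<Rightarrow> 'l) set" and R h where R: "subuniverse sig (power_algebra L I) R"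
    and h: "h \<in> homs sig (subalgebra (power_algebra L I) R) A" "h ` R = carrier A"
    using HSP_E[OF A] .
  define R' where "R' = {r \<in> R. \<forall>i \<in> I. r i \<in> S}"
  have op: "oper (power_algebra M I) = oper (power_algebra L I)"
    by (simp add: power_algebra_def)
  have R': "subuniverse sig (power_algebra M I) R'"
    unfolding subuniverse_def
  proof (intro conjI allI ballI)
    show "R' \<subseteq> carrier (power_algebra M I)"
      using R by (auto simp: R'_def subuniverse_def PiE_def)
    fix f xs assume xs: "xs \<in> args sig R' f"
    have "xs \<in> args sig R f" by (rule args_mono[OF xs]) (auto simp: R'_def)
    then have "oper (power_algebra L I) f xs \<in> R" by (rule subuniverse_oper[OF R])
    moreover have "oper (power_algebra L I) f xs i \<in> S" if "i \<in> I" for i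
    proof -
      have "map (\<lambda>x. x i) xs \<in> args sig S f"
        using xs that by (auto simp: args_def R'_def)
      then show ?thesis using subuniverse_oper[OF sub_S] that by (simp add: oper_power)
    qed
    ultimately show "oper (power_algebra M I) f xs \<in> R'"
      unfolding op by (simp add: R'_def)
  qed
  have hop: "h (oper (power_algebra L I) f xs) = oper A f (map h xs)" if "xs \<in> args sig R f" for f xs
    using homs_oper[OF h(1)] that by simp
  have hR: "h x \<in> carrier A" if "x \<in> R" for x using that h(2) by blast
  have "restrict (\<lambda>x. qr A (h x)) (carrier (subalgebra (power_algebra M I) R'))
      \<in> homs sig (subalgebra (power_algebra M I) R') (Qob A)"
  proof (rule homs_restrictI)
    show "qr A (h x) \<in> carrier (Qob A)" if "x \<in> carrier (subalgebra (power_algebra M I) R')" for x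
      using that hR[of x] unfolding Q C.carrier_Q by (auto simp: R'_def)
    fix f xs assume "xs \<in> args sig (carrier (subalgebra (power_algebra M I) R')) f"
    then have "xs \<in> args sig R' f" by simp
    then have xs: "xs \<in> args sig R f" by (rule args_mono) (auto simp: R'_def)
    have hxs: "map h xs \<in> args sig (carrier A) f"
      using map_args[of R h "carrier A" xs sig f] hR xs by blast
    have "map (\<lambda>a\<in>carrier A. qr A a) (map h xs) = map (\<lambda>x. qr A (h x)) xs"
      using xs hR by (auto simp: args_def)
    then show "qr A (h (oper (subalgebra (power_algebra M I) R') f xs)) =
        oper (Qob A) f (map (\<lambda>x. qr A (h x)) xs)"
      using homs_oper[OF C.repr_hom hxs] is_algebra_oper[OF alg hxs] hop[OF xs]
      by (simp only: Q op oper_subalgebra restrict_apply')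
  qed (rule is_algebra_subalgebra[OF R'])
  moreover have "restrict (\<lambda>x. qr A (h x)) R' ` R' = carrier (Qob A)"
  proof
    show "restrict (\<lambda>x. qr A (h x)) R' ` R' \<subseteq> carrier (Qob A)"
      using hR unfolding Q C.carrier_Q by (auto simp: R'_def)
    show "carrier (Qob A) \<subseteq> restrict (\<lambda>x. qr A (h x)) R' ` R'"
    proof
      fix q assume "q \<in> carrier (Qob A)"
      then obtain r where r: "r \<in> R" "q = qr A (h r)"
        unfolding Q C.carrier_Q h(2)[symmetric] by auto
      \<comment> \<open>\<open>\<chi>\<^sub>S(r) \<and> r\<close> equals \<open>r\<close> where \<open>r\<close> takes values in \<open>S\<close> and \<open>0\<close> elsewhere; modulo the congruence
        it is \<open>1 \<and> r = r\<close>.\<close>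
      define c where "c = interp (power_algebra L I) (\<lambda>_. r) chi"
      define r' where "r' = meet sig (power_algebra L I) c r"
      have c: "c \<in> R" unfolding c_def by (rule interp_closed[OF R r(1) is_term_chi])
      have cr: "[c, r] \<in> args sig R (meet_sym sig)" using c r(1) by (simp add: args_def)
      have rL: "r i \<in> carrier L" if "i \<in> I" for i
        using R r(1) that by (auto simp: subuniverse_def)
      have "r' i = (if r i \<in> S then r i else zeroL)" if "i \<in> I" for i
      proof -
        have "r' i = meet sig L (interp L (\<lambda>_. r i) chi) (r i)"
          using that by (simp add: r'_def c_def meet_def oper_power interp_power)
        then show ?thesis using chi_L[OF rL[OF that]] L_bounds[OF rL[OF that]] by simp
      qed
      moreover have "r' \<in> R" unfolding r'_def meet_def by (rule subuniverse_oper[OF R cr])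
      \<comment> \<open>The coordinates of r outside S were replaced by 0, which lies in S as a
        constant of the signature.\<close>
      ultimately have "r' \<in> R'" using S_facts(3) by (auto simp: R'_def)
      moreover have "qr A (h r') = q"
      proof -
        note hr = hR[OF r(1)]
        define k where "k = interp A (\<lambda>_. h r) chi"
        have "h c = k"
          using homs_interp[OF is_algebra_subalgebra[OF R] h(1) _ is_term_chi, of "\<lambda>_. r"] r(1)
          by (simp add: c_def k_def)
        then have hr': "h r' = meet sig A k (h r)" using hop[OF cr] by (simp add: r'_def meet_def)
        have kA: "k \<in> carrier A" using \<open>h c = k\<close> hR[OF c] by simp
        note oneA = lat_closed(4)[OF alg]
        have "(k, one sig A) \<in> chi_cong A"
          using chi_cong(1)[OF alg] hr by (simp add: chi_compatible_def k_def)
        then have "qr A k = qr A (one sig A)" using C.repr_eq_iff[OF kA oneA] by simp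
        moreover have "qr A (meet sig A x (h r)) = meet sig C.Q (qr A x) (qr A (h r))"
          if "x \<in> carrier A" for x
          using hom_lat(1)[OF C.repr_hom that hr] that hr lat_closed(1)[OF alg that hr] by simp
        ultimately have "qr A (h r') = qr A (meet sig A (one sig A) (h r))"
          using kA oneA hr' by simp
        then show ?thesis using A_lattice(9)[OF A hr hr] r(2) by simp
      qed
      ultimately show "q \<in> restrict (\<lambda>x. qr A (h x)) R' ` R'" by force
    qed
  qed
  ultimately show ?thesis
    unfolding HSP_def
    by (intro CollectI conjI exI[of _ I] exI[of _ R'] exI[of _ "restrict (\<lambda>x. qr A (h x)) R'"] R')
      (simp_all add: Q C.is_algebra_Q)
qed

lemma Qob_carrier:
  assumes "is_algebra sig A" "x \<in> carrier (Qob A)"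
  shows "x \<in> carrier A" "qr A x = x"
proof -
  interpret C: alg_congruence sig A "chi_cong A" by (rule alg_congruence_chi[OF assms(1)])
  show "x \<in> carrier A" "qr A x = x" using C.Q_repr[of x] assms(2) by (simp_all add: quotient_ob_def)
qed

lemma qr_mem:
  assumes "is_algebra sig A" "x \<in> carrier A"
  shows "qr A x \<in> carrier (Qob A)"
proof -
  interpret C: alg_congruence sig A "chi_cong A" by (rule alg_congruence_chi[OF assms(1)])
  show ?thesis using assms(2) C.carrier_Q by (auto simp: quotient_ob_def)
qed

lemma qr_hom:
  assumes "is_algebra sig A"
  shows "(\<lambda>a\<in>carrier A. qr A a) \<in> homs sig A (Qob A)"
proof -
  interpret C: alg_congruence sig A "chi_cong A" by (rule alg_congruence_chi[OF assms(1)])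
  show ?thesis using C.repr_hom by (simp add: quotient_ob_def)
qed

text \<open>h need not send representatives to representatives, but it sends related elements to
  related ones: the pullback of the congruence of B along h is compatible, hence contains the least
  one of A.\<close>

lemma qr_natural:
  assumes A: "is_algebra sig A" and B: "is_algebra sig B" and h: "h \<in> homs sig A B"
    and x: "x \<in> carrier A"
  shows "qr B (h (qr A x)) = qr B (h x)"
proof -
  interpret A: alg_congruence sig A "chi_cong A" by (rule alg_congruence_chi[OF A])
  interpret B: alg_congruence sig B "chi_cong B" by (rule alg_congruence_chi[OF B])
  note mem = homs_mem[OF h]
  define \<phi> where "\<phi> = {(x, y) \<in> carrier A \<times> carrier A. (h x, h y) \<in> chi_cong B}"
  have "(interp A (\<lambda>_. a) chi, one sig A) \<in> \<phi>" if a: "a \<in> carrier A" for a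
  proof -
    have "h (interp A (\<lambda>_. a) chi) = interp B (\<lambda>_. h a) chi"
      using homs_interp[OF A h a is_term_chi] .
    then have "(h (interp A (\<lambda>_. a) chi), h (one sig A)) \<in> chi_cong B"
      using chi_cong(1)[OF B] mem[OF a] hom_lat(4)[OF h] by (simp add: chi_compatible_def)
    then show ?thesis
      using interp_closed[OF is_algebra_subuniverse[OF A] a is_term_chi] lat_closed(4)[OF A]
      by (simp add: \<phi>_def)
  qed
  then have "chi_compatible A \<phi>"
    using congruence_vimage[OF A h B.cong] by (simp add: chi_compatible_def \<phi>_def)
  then have "chi_cong A \<subseteq> \<phi>" by (rule chi_cong(2)[OF A])
  then have "(x, qr A x) \<in> \<phi>" using A.repr(1)[OF x] by blast
  then show ?thesis
    using B.repr_eq_iff[OF mem[OF x] mem[OF A.repr(2)[OF x]]] by (simp add: \<phi>_def)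
qed

lemma Qmap_hom:
  assumes A: "is_algebra sig A" and B: "is_algebra sig B" and h: "h \<in> homs sig A B"
  shows "(\<lambda>x\<in>carrier (Qob A). qr B (h x)) \<in> homs sig (Qob A) (Qob B)"
proof (rule homs_restrictI)
  interpret A: alg_congruence sig A "chi_cong A" by (rule alg_congruence_chi[OF A])
  have QA: "Qob A = A.Q" by (simp add: quotient_ob_def)
  show "is_algebra sig (Qob A)" unfolding QA by (rule A.is_algebra_Q)
  show "qr B (h x) \<in> carrier (Qob B)" if "x \<in> carrier (Qob A)" for x
    using qr_mem[OF B homs_mem[OF h Qob_carrier(1)[OF A that]]] .
  fix f xs assume xs: "xs \<in> args sig (carrier (Qob A)) f"
  have xsA: "xs \<in> args sig (carrier A) f"
    by (rule args_mono[OF xs]) (use Qob_carrier(1)[OF A] in blast)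
  have hxs: "map h xs \<in> args sig (carrier B) f"
    using map_args[of "carrier A" h "carrier B" xs sig f] homs_mem[OF h] xsA by blast
  have "oper (Qob A) f xs = qr A (oper A f xs)"
    using A.oper_Q xs by (simp add: QA)
  then have "qr B (h (oper (Qob A) f xs)) = qr B (oper B f (map h xs))"
    using qr_natural[OF A B h is_algebra_oper[OF A xsA]] homs_oper[OF h xsA] by simp
  also have "\<dots> = oper (Qob B) f (map (\<lambda>a\<in>carrier B. qr B a) (map h xs))"
    using homs_oper[OF qr_hom[OF B] hxs] is_algebra_oper[OF B hxs] by (simp only: restrict_apply')
  also have "map (\<lambda>a\<in>carrier B. qr B a) (map h xs) = map (\<lambda>x. qr B (h x)) xs"
    using xsA homs_mem[OF h] by (auto simp: args_def)
  finally show "qr B (h (oper (Qob A) f xs)) = oper (Qob B) f (map (\<lambda>x. qr B (h x)) xs)" .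
qed

text \<open>In the variety of S equality is already compatible, so the least congruence is equality
  and each class is a singleton.\<close>

lemma qr_HSP_M:
  assumes "B \<in> HSP sig M" "b \<in> carrier B"
  shows "qr B b = b"
proof -
  note alg = HSP_is_algebra[OF assms(1)]
  interpret B: alg_congruence sig B "chi_cong B" by (rule alg_congruence_chi[OF alg])
  have "chi_compatible B (Id_on (carrier B))"
    using congruence_Id_on[OF alg] chi_HSP_M[OF assms(1)] lat_closed(4)[OF alg]
    by (auto simp: chi_compatible_def)
  then have "chi_cong B \<subseteq> Id_on (carrier B)" by (rule chi_cong(2)[OF alg])
  then show ?thesis using B.repr(1)[OF assms(2)] by auto
qed

lemma fob_quotient [simp]: "fob (quotient_functor sig L S) = Qob"
  and far_quotient: "far (quotient_functor sig L S) m = \<lparr>src = Qob (src m), tgt = Qob (tgt m),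
    fn = (\<lambda>x\<in>carrier (Qob (src m)). qr (tgt m) (fn m x))\<rparr>"
  by (simp_all add: quotient_functor_def)

lemma inclusion_simps [simp]: "fob inclusion_functor A = A" "far inclusion_functor m = m"
  by (simp_all add: inclusion_functor_def)

lemma is_functor_quotient:
  "is_functor (variety sig L) (variety sig M) (quotient_functor sig L S)"
  unfolding variety_def
proof (rule is_functor_algI)
  fix A B C :: "('f, 'a) algebra" and h k x
  show "A \<in> HSP sig L \<Longrightarrow> fob (quotient_functor sig L S) A \<in> HSP sig M"
    using Qob_HSP by simp
  show "fn (far (quotient_functor sig L S) \<lparr>src = A, tgt = B, fn = h\<rparr>) \<in>
      homs sig (fob (quotient_functor sig L S) A) (fob (quotient_functor sig L S) B)"
    if "A \<in> HSP sig L" "B \<in> HSP sig L" "h \<in> homs sig A B"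
    using Qmap_hom[OF HSP_is_algebra HSP_is_algebra] that by (simp add: far_quotient)
  show "fn (far (quotient_functor sig L S) \<lparr>src = A, tgt = A, fn = \<lambda>x\<in>carrier A. x\<rparr>) x = x"
    if "A \<in> HSP sig L" "x \<in> carrier (fob (quotient_functor sig L S) A)"
    using that(2) Qob_carrier[OF HSP_is_algebra[OF that(1)], of x] by (simp add: far_quotient)
  show "fn (far (quotient_functor sig L S) \<lparr>src = A, tgt = C, fn = compose (carrier A) k h\<rparr>) x =
      fn (far (quotient_functor sig L S) \<lparr>src = B, tgt = C, fn = k\<rparr>)
        (fn (far (quotient_functor sig L S) \<lparr>src = A, tgt = B, fn = h\<rparr>) x)"
    if A: "A \<in> HSP sig L" and B: "B \<in> HSP sig L" and C: "C \<in> HSP sig L"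
      and h: "h \<in> homs sig A B" and k: "k \<in> homs sig B C"
      and x: "x \<in> carrier (fob (quotient_functor sig L S) A)"
  proof -
    have x': "x \<in> carrier (Qob A)" using x by simp
    have xA: "x \<in> carrier A" using Qob_carrier(1)[OF HSP_is_algebra[OF A] x'] .
    note hx = homs_mem[OF h xA]
    \<comment> \<open>The representative taken in B between the two maps is absorbed by naturality
      of k.\<close>
    show ?thesis
      using x' xA qr_mem[OF HSP_is_algebra[OF B] hx]
        qr_natural[OF HSP_is_algebra[OF B] HSP_is_algebra[OF C] k hx]
      by (simp add: far_quotient compose_def)
  qed
qed (auto simp: far_quotient HSP_is_algebra)

lemma is_functor_inclusion:
  "is_functor (variety sig M) (variety sig L) inclusion_functor"
  unfolding variety_def
  by (rule is_functor_algI) (auto simp: HSP_is_algebra HSP_M compose_def homs_mem)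

definition eta_Q where
  "eta_Q A = \<lparr>src = A, tgt = Qob A, fn = (\<lambda>a\<in>carrier A. qr A a)\<rparr>"

text \<open>For B in the variety of S the algebras \<open>Qob B\<close> and B have the same elements
  and the same operations on them, but their operation functions may differ on other lists. The
  counit is therefore an identity map without being an identity arrow.\<close>

definition eps_Q where
  "eps_Q B = \<lparr>src = Qob B, tgt = B, fn = (\<lambda>x\<in>carrier (Qob B). x)\<rparr>"

text \<open>Naturality of the unit is \<open>qr_natural\<close>. As the counit moves no element,
  both triangles reduce to representatives being fixed in algebras of the variety of S.\<close>

lemma adjunction_Q:
  "is_adjunction (variety sig L :: ('f, 'a) alg_category) (variety sig M)
    (quotient_functor sig L S) inclusion_functor eta_Q eps_Q"
proof -
  let ?V = "variety sig L :: ('f, 'a) alg_category"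
  let ?W = "variety sig M :: ('f, 'a) alg_category"
  let ?F = "quotient_functor sig L S"
  let ?G = "inclusion_functor :: (('f, 'a) algebra, ('f, 'a) alg_arrow, ('f, 'a) algebra, ('f, 'a) alg_arrow) functor_data"
  have F: "is_functor ?V ?W ?F" by (rule is_functor_quotient)
  have G: "is_functor ?W ?V ?G" by (rule is_functor_inclusion)
  have cat: "is_category ?V" "is_category ?W" using F by (simp_all add: is_functor_def)
  have idV: "is_functor ?V ?V id_functor" and idW: "is_functor ?W ?W id_functor"
    using cat by (auto simp: is_functor_def is_category_def Hom_def)
  have un: "is_nat_trans ?V ?V id_functor (?G \<circ>\<^sub>F ?F) eta_Q"
    unfolding variety_def
  proof (rule is_nat_trans_algI[OF idV[unfolded variety_def] is_functor_comp[OF F G, unfolded variety_def]])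
    show "src (eta_Q A) = fob id_functor A \<and> tgt (eta_Q A) = fob (?G \<circ>\<^sub>F ?F) A \<and>
        fn (eta_Q A) \<in> homs sig (fob id_functor A) (fob (?G \<circ>\<^sub>F ?F) A)"
      if "A \<in> Obj (alg_category sig (HSP sig L))" for A :: "('f, 'a) algebra"
      using qr_hom[OF HSP_is_algebra] that by (simp add: eta_Q_def)
    fix f :: "('f, 'a) alg_arrow" and x
    assume f: "f \<in> Arr (alg_category sig (HSP sig L))"
      and x: "x \<in> carrier (fob id_functor (Dom (alg_category sig (HSP sig L)) f))"
    then have A: "is_algebra sig (src f)" and B: "is_algebra sig (tgt f)"
      and h: "fn f \<in> homs sig (src f) (tgt f)" and x: "x \<in> carrier (src f)"
      by (auto simp: HSP_is_algebra)
    show "fn (far (?G \<circ>\<^sub>F ?F) f) (fn (eta_Q (Dom (alg_category sig (HSP sig L)) f)) x) =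
        fn (eta_Q (Cod (alg_category sig (HSP sig L)) f)) (fn (far id_functor f) x)"
      using qr_natural[OF A B h x] qr_mem[OF A x] x homs_mem[OF h x]
      by (simp add: eta_Q_def far_quotient)
  qed
  have eps: "(\<lambda>x\<in>carrier (Qob B). x) \<in> homs sig (Qob B) B" if B: "B \<in> HSP sig M" for B :: "('f, 'a) algebra"
  proof (rule homs_restrictI)
    note alg = HSP_is_algebra[OF B]
    interpret B: alg_congruence sig B "chi_cong B" by (rule alg_congruence_chi[OF alg])
    show "is_algebra sig (Qob B)" using B.is_algebra_Q by (simp add: quotient_ob_def)
    show "x \<in> carrier B" if "x \<in> carrier (Qob B)" for x using Qob_carrier(1)[OF alg that] .
    fix f xs assume xs: "xs \<in> args sig (carrier (Qob B)) f"
    have "xs \<in> args sig (carrier B) f"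
      by (rule args_mono[OF xs]) (use Qob_carrier(1)[OF alg] in blast)
    then show "oper (Qob B) f xs = oper B f (map (\<lambda>x. x) xs)"
      using B.oper_Q[of xs f] xs qr_HSP_M[OF B is_algebra_oper[OF alg]] by (simp add: quotient_ob_def)
  qed
  have co: "is_nat_trans ?W ?W (?F \<circ>\<^sub>F ?G) id_functor eps_Q"
    unfolding variety_def
  proof (rule is_nat_trans_algI[OF is_functor_comp[OF G F, unfolded variety_def] idW[unfolded variety_def]])
    show "src (eps_Q A) = fob (?F \<circ>\<^sub>F ?G) A \<and> tgt (eps_Q A) = fob id_functor A \<and>
        fn (eps_Q A) \<in> homs sig (fob (?F \<circ>\<^sub>F ?G) A) (fob id_functor A)"
      if "A \<in> Obj (alg_category sig (HSP sig M))" for A :: "('f, 'a) algebra"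
      using eps that by (simp add: eps_Q_def)
    fix f :: "('f, 'a) alg_arrow" and x
    assume f: "f \<in> Arr (alg_category sig (HSP sig M))"
      and x: "x \<in> carrier (fob (?F \<circ>\<^sub>F ?G) (Dom (alg_category sig (HSP sig M)) f))"
    then have A: "src f \<in> HSP sig M" and B: "tgt f \<in> HSP sig M"
      and h: "fn f \<in> homs sig (src f) (tgt f)" and x: "x \<in> carrier (Qob (src f))"
      by auto
    have xA: "x \<in> carrier (src f)" using Qob_carrier(1)[OF HSP_is_algebra[OF A] x] .
    note hx = homs_mem[OF h xA]
    show "fn (far id_functor f) (fn (eps_Q (Dom (alg_category sig (HSP sig M)) f)) x) =
        fn (eps_Q (Cod (alg_category sig (HSP sig M)) f)) (fn (far (?F \<circ>\<^sub>F ?G) f) x)"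
      using x qr_mem[OF HSP_is_algebra[OF B] hx] qr_HSP_M[OF B hx]
      by (simp add: eps_Q_def far_quotient)
  qed
  have tri1: "Comp ?W (eps_Q (fob ?F A)) (far ?F (eta_Q A)) = Ident ?W (fob ?F A)"
    if A: "A \<in> Obj ?V" for A
  proof -
    have A: "A \<in> HSP sig L" using A by (simp add: variety_def)
    note QA = Qob_HSP[OF A]
    have "qr (Qob A) (qr A x) = x \<and> x \<in> carrier A \<and> x \<in> carrier (Qob (Qob A))" if x: "x \<in> carrier (Qob A)" for x
      using Qob_carrier[OF HSP_is_algebra[OF A] x] qr_HSP_M[OF QA x] qr_mem[OF HSP_is_algebra[OF QA] x]
      by simp
    then have "compose (carrier (Qob A)) (\<lambda>x\<in>carrier (Qob (Qob A)). x)
        (\<lambda>x\<in>carrier (Qob A). qr (Qob A) ((\<lambda>a\<in>carrier A. qr A a) x)) = (\<lambda>x\<in>carrier (Qob A). x)"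
      by (auto simp: compose_def)
    then show ?thesis by (simp add: variety_def far_quotient eta_Q_def eps_Q_def)
  qed
  have tri2: "Comp ?V (far ?G (eps_Q B)) (eta_Q (fob ?G B)) = Ident ?V (fob ?G B)"
    if B: "B \<in> Obj ?W" for B
  proof -
    have B: "B \<in> HSP sig M" using B by (simp add: variety_def)
    have "qr B x = x \<and> x \<in> carrier (Qob B)" if x: "x \<in> carrier B" for x
      using qr_HSP_M[OF B x] qr_mem[OF HSP_is_algebra[OF B] x] by simp
    then have "compose (carrier B) (\<lambda>x\<in>carrier (Qob B). x) (\<lambda>a\<in>carrier B. qr B a) = (\<lambda>x\<in>carrier B. x)"
      by (auto simp: compose_def)
    then show ?thesis by (simp add: variety_def eta_Q_def eps_Q_def)
  qed
  show ?thesis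
    unfolding is_adjunction_def using F G un co tri1 tri2 by blast
qed

end

theorem theorem4p16:
  fixes sig :: "'f lat_signature"
    and L :: "('f, 'l) algebra"
    and S :: "'l set"
  assumes "finite (carrier L)"
    and "is_bounded_lattice sig L"
    and "zero sig L \<noteq> one sig L"
    and "semi_primal sig L"
    and "subuniverse sig L S"
  shows "\<exists>K I \<eta> \<epsilon> \<eta>\<^sub>P \<epsilon>\<^sub>P \<eta>\<^sub>Q \<epsilon>\<^sub>Q.
    is_adjunction (variety sig L :: ('f, ('l, 'u) univ) alg_category)
      (BA :: (bool_op, ('l, 'u) univ) alg_category) K I \<eta> \<epsilon> \<and>
    is_adjunction (variety sig (subalgebra L S) :: ('f, ('l, 'u) univ) alg_category)
      (BA :: (bool_op, ('l, 'u) univ) alg_category)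
      (skeleton_functor sig L) (power_functor sig (subalgebra L S)) \<eta>\<^sub>P \<epsilon>\<^sub>P \<and>
    is_adjunction (variety sig L :: ('f, ('l, 'u) univ) alg_category)
      (variety sig (subalgebra L S) :: ('f, ('l, 'u) univ) alg_category)
      (quotient_functor sig L S) inclusion_functor \<eta>\<^sub>Q \<epsilon>\<^sub>Q \<and>
    I = inclusion_functor \<circ>\<^sub>F power_functor sig (subalgebra L S) \<and>
    K = skeleton_functor sig L \<circ>\<^sub>F quotient_functor sig L S \<and>
    (\<forall>A \<in> Obj (variety sig L).
       \<eta> A = Comp (variety sig L)
         (far inclusion_functor (\<eta>\<^sub>P (fob (quotient_functor sig L S) A))) (\<eta>\<^sub>Q A)) \<and>
    (\<forall>B \<in> Obj BA.
       \<epsilon> B = Comp BA (\<epsilon>\<^sub>P B)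
         (far (skeleton_functor sig L) (\<epsilon>\<^sub>Q (fob (power_functor sig (subalgebra L S)) B))))"
proof -
  interpret semi_primal_lattice sig L S by unfold_locales (fact assms)+
  \<comment> \<open>The quotient adjunction is the inner one. The composite unit and counit supplied
    here have literally the shape demanded in the conclusion.\<close>
  note adj = is_adjunction_comp[OF adjunction_Q adjunction_P]
  show ?thesis
    by (intro exI conjI, rule adj, rule adjunction_P, rule adjunction_Q) auto
qed

end
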